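(* Let $\mathbf p=(p_k)_{k\ge0}$ be a probability mass function on $\{0,1,2,\dots\}$ and $Z\sim\mathbf p$. Assume $\mathbb E[Z]<\infty$, $p_0\in(0,1)$, $p_0+p_1<1$ and $\gcd\{j:p_j>0\}=1$. Let $D$ be the random variable with the law of the limiting degree distribution, and let $R,s_0,q_*$ be the constants, all defined in the context. (i) If $\mathbb E[Z]\le1$, then $$\lim_{k\to\infty}\frac{\log\mathbb P(D\ge k)}{\log k}=-R.$$ (ii) If $\mathbb E[Z]>1$, then $$-R\le\liminf_{k\to\infty}\frac{\log\mathbb P(D\ge k)}{\log k}\le\limsup_{k\to\infty}\frac{\log\mathbb P(D\ge k)}{\log k}\le-\Big(R\wedge\frac{\log q_*}{\log s_0}\Big).$$
   Context: Constants. $f(s)=\sum_{k\ge0}p_ks^k$, $s\ge0$. $s_0$ is the unique positive root of $sf'(s)=f(s)$ if it exists, and otherwise the radius of convergence of $f$. $R:=\lim_{s\uparrow s_0}s/f(s)$. $q_*$ is the smallest positive solution of $f(q)=q$ (the extinction probability of a Galton–Watson process with offspring law $\mathbf p$); $q_*<1$ when $\mathbb E[Z]>1$. The variable $D$. $\mathcal T^*(t)$, $t\ge0$, is the continuous time tree process starting at time $0$ from a single root vertex, in which every existing vertex $v$ reproduces independently at rate one; when $v$ reproduces, an independent $Z\sim\mathbf p$ is sampled; if $Z\le\mathrm{dist}(\text{root},v)$ then a new vertex is attached as a child to the vertex $u$ on the path from $v$ to the root with $\mathrm{dist}(v,u)=Z$; if $Z>\mathrm{dist}(\text{root},v)$ nothing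 happens. With $\tau\sim\mathrm{Exp}(1)$ independent of $\mathcal T^*$, $D$ is the number of children of the root in $\mathcal T^*(\tau)$. (It is the limit law in the sense that in the discrete tree network $\mathcal T_n(\mathbf p)$, in which each new vertex picks a uniform existing vertex, walks up $Z$ steps towards the root, stopping at the root if reached, and attaches there, the proportion of vertices with degree $k+1$ converges in probability to $\mathbb P(D=k)$.) *)

theory Defs
  imports "HOL-Probability.Probability"
begin

section \<open>The constants\<close>

definition mean :: "nat pmf \<Rightarrow> real" where
  "mean p = measure_pmf.expectation p real"

(* Meaningful only where the series converges, i.e. where f is finite; the definitions below
   only use it there. *)
definition pgf :: "nat pmf \<Rightarrow> real \<Rightarrow> real" where
  "pgf p s = (\<Sum>k. pmf p k * s ^ k)"

(* The root is sought inside the open disc of convergence, where f is differentiable.  If the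
   (one-sided) equation happens to hold at the radius of convergence itself, then it has no root
   inside the disc and the second branch returns the same value.  With p_0 + p_1 < 1 an infinite
   radius of convergence forces a root, so real_of_ereal is then not applied to infinity. *)
definition s0 :: "nat pmf \<Rightarrow> real" where
  "s0 p =
    (let root = (\<lambda>s. 0 < s \<and> ereal s < conv_radius (pmf p) \<and> s * deriv (pgf p) s = pgf p s)
     in if \<exists>s. root s then (THE s. root s) else real_of_ereal (conv_radius (pmf p)))"

definition R_const :: "nat pmf \<Rightarrow> real" where
  "R_const p = Lim (at_left (s0 p)) (\<lambda>s. s / pgf p s)"

definition q_star :: "nat pmf \<Rightarrow> real" where
  "q_star p = (LEAST q. 0 < q \<and> summable (\<lambda>k. pmf p k * q ^ k) \<and> pgf p q = q)"

section \<open>The continuous time tree process\<close>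

text \<open>
  Vertices are labelled by their reproduction history: the root is \<open>[]\<close>, and \<open>i # v\<close> is the vertex
  created by the \<open>i\<close>-th reproduction event of \<open>v\<close> (counting from 0, and counting also the events at
  which nothing happens). Note that \<open>v\<close> is in general not the parent of \<open>i # v\<close>.

  \<open>W v i\<close> is the waiting time between the \<open>i\<close>-th reproduction event of \<open>v\<close> and the preceding one
  (or the birth of \<open>v\<close>, if \<open>i = 0\<close>), and \<open>Z v i\<close> is the number of steps sampled at this event.
\<close>

type_synonym vertex = "nat list"

(* The path from a vertex to the root, both included. The parent of i # v is the vertex on the
   path from v to the root at distance Z v i from v. The values are meaningful only for labels
   satisfying is_vertex below. *)
fun path_to_root :: "(vertex \<Rightarrow> nat \<Rightarrow> nat) \<Rightarrow> vertex \<Rightarrow> vertex list" where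
  "path_to_root Z [] = [[]]"
| "path_to_root Z (i # v) = (i # v) # drop (Z v i) (path_to_root Z v)"

definition dist_root :: "(vertex \<Rightarrow> nat \<Rightarrow> nat) \<Rightarrow> vertex \<Rightarrow> nat" where
  "dist_root Z v = length (path_to_root Z v) - 1"

(* Whether a label is that of a vertex which is born at some time. *)
fun is_vertex :: "(vertex \<Rightarrow> nat \<Rightarrow> nat) \<Rightarrow> vertex \<Rightarrow> bool" where
  "is_vertex Z [] \<longleftrightarrow> True"
| "is_vertex Z (i # v) \<longleftrightarrow> is_vertex Z v \<and> Z v i \<le> dist_root Z v"

fun birth_time :: "(vertex \<Rightarrow> nat \<Rightarrow> real) \<Rightarrow> vertex \<Rightarrow> real" where
  "birth_time W [] = 0"
| "birth_time W (i # v) = birth_time W v + (\<Sum>j\<le>i. W v j)"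

definition tree_vertices ::
    "(vertex \<Rightarrow> nat \<Rightarrow> real) \<Rightarrow> (vertex \<Rightarrow> nat \<Rightarrow> nat) \<Rightarrow> real \<Rightarrow> vertex set" where
  "tree_vertices W Z t = {v. is_vertex Z v \<and> birth_time W v \<le> t}"

(* Pairs (parent, child). *)
definition tree_edges ::
    "(vertex \<Rightarrow> nat \<Rightarrow> real) \<Rightarrow> (vertex \<Rightarrow> nat \<Rightarrow> nat) \<Rightarrow> real \<Rightarrow> (vertex \<times> vertex) set" where
  "tree_edges W Z t =
    {(path_to_root Z v ! Z v i, i # v) | v i. i # v \<in> tree_vertices W Z t}"

(* The random tree below is almost surely finite, so that card = 0 on infinite sets is immaterial. *)
definition root_children ::
    "(vertex \<Rightarrow> nat \<Rightarrow> real) \<Rightarrow> (vertex \<Rightarrow> nat \<Rightarrow> nat) \<Rightarrow> real \<Rightarrow> nat" where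
  "root_children W Z t = card (tree_edges W Z t `` {[]})"

section \<open>Randomness\<close>

datatype source = Wait vertex nat | Steps vertex nat | Stop

(* The integer variables Z v i are viewed as real variables in the independence assumption only
   because indep_vars needs a common codomain; the generated sigma-algebras are the same. *)
locale tree_process = prob_space M
  for M :: "'w measure" +
  fixes p :: "nat pmf"
    and W :: "vertex \<Rightarrow> nat \<Rightarrow> 'w \<Rightarrow> real"
    and Z :: "vertex \<Rightarrow> nat \<Rightarrow> 'w \<Rightarrow> nat"
    and \<tau> :: "'w \<Rightarrow> real"
  assumes W_exponential: "\<And>v i. distributed M lborel (W v i) (exponential_density 1)"
    and Z_measurable: "\<And>v i. Z v i \<in> measurable M (count_space UNIV)"
    and Z_law: "\<And>v i. distr M (count_space UNIV) (Z v i) = measure_pmf p"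
    and \<tau>_exponential: "distributed M lborel \<tau> (exponential_density 1)"
    and independent: "indep_vars (\<lambda>_. borel)
      (\<lambda>s. case s of Wait v i \<Rightarrow> W v i | Steps v i \<Rightarrow> (\<lambda>\<omega>. real (Z v i \<omega>)) | Stop \<Rightarrow> \<tau>) UNIV"
begin

definition D :: "'w \<Rightarrow> nat" where
  "D \<omega> = root_children (\<lambda>v i. W v i \<omega>) (\<lambda>v i. Z v i \<omega>) (\<tau> \<omega>)"

end

end

theory Submission
  imports Defs "HOL-Real_Asymp.Real_Asymp"
begin

text \<open>
  A vertex at depth \<open>d\<close> gives birth, at rate \<open>p\<^sub>j\<close> for each \<open>j \<le> d\<close>, to a vertex at depth
  \<open>d + 1 - j\<close>, and \<open>D\<close> is the number of vertices at depth one at an independent exponential time.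
  So the depths form a branching random walk, and everything follows from the size of its population
  at depth one. The weights \<open>s\<^bsup>-d\<^esup>\<close> are eigenfunctions of the mean matrix up to the killing below the
  root, with eigenvalue \<open>f(s) / s\<close>; the least such eigenvalue is \<open>1 / R\<close>, attained at \<open>s0\<close>. Hence
  the population at depth one grows like \<open>e\<^bsup>t/R\<^esup>\<close>, it takes time about \<open>R log k\<close> to reach size \<open>k\<close>,
  and the exponential clock survives this long with probability \<open>k\<^bsup>-R\<^esup>\<close>.

  Upper bound. A first moment is useless beyond the exponent \<open>1\<close>, so an exponential moment with a
  small parameter \<open>\<lambda>\<close> is used. As long as every vertex at depth \<open>d\<close> with remaining time \<open>u\<close> satisfies
  \<open>\<lambda> s\<^bsup>1-d\<^esup> e\<^bsup>\<theta>u\<^esup> \<le> \<delta>\<close>, where \<open>\<theta>\<close> is slightly above \<open>f(s) / s\<close>, the left-hand side is a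
  supersolution of the logarithmic moment equation (\<open>killed_exponential_moment\<close>), and taking
  \<open>\<lambda> = r log k / k\<close> makes the Chernoff bound of order \<open>k\<^bsup>-r\<^esup>\<close>. What remains is the probability that
  some vertex violates the condition (\<open>exceed_probability\<close>). If \<open>s \<ge> 1\<close> the weights do not increase
  with the depth, and a violation means that the clock is late, which costs \<open>k\<^bsup>-r\<^esup>\<close> up to logarithms
  for every \<open>r < R\<close>. If \<open>s < 1\<close> a vertex may be too deep. The expected number of violating vertices
  is dominated by the \<open>r\<close>-th power of the violated quantity, which is possible if
  \<open>f(s\<^sup>r) < s\<^sup>r\<close>, that is \<open>q\<^sub>* < s\<^sup>r\<close>; this is where the second exponent
  \<open>log q\<^sub>* / log s0\<close> comes from.

  Lower bound. With \<open>v\<^sub>d(t) = 1 - E e\<^bsup>-\<lambda>N\<^esup>\<close>, where \<open>N\<close> counts the vertices at depth one at time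
  \<open>t\<close> when the initial vertex has depth \<open>d\<close>, the first event gives
  \<open>v\<^sub>d(t + h) \<ge> v\<^sub>d(t) + (1 - e\<^bsup>-h\<^esup>) (1 - v\<^sub>d(t)) \<Sum>\<^bsub>j \<le> d\<^esub> p\<^sub>j v\<^bsub>d+1-j\<^esub>(t)\<close>
  (\<open>deficit_step\<close>), a discrete logistic equation. It grows exponentially from \<open>\<lambda> \<approx> 1/k\<close> to a
  constant at any rate \<open>\<theta> < 1/R\<close> (\<open>logistic_iteration_lower_bound\<close>), provided that the mean matrix
  has a bounded subeigenvector for \<open>\<theta>\<close>. The latter exists because the weighted number of walks
  from depth one to itself grows at rate \<open>1/R\<close> (\<open>walks_growth\<close>), which is a consequence of the
  Lagrange equation \<open>s = z f(s)\<close> for the Green function.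
\<close>

section \<open>The generating function and its constants\<close>

lemma summable_pmf_nat: "summable (pmf (p :: nat pmf))"
  and suminf_pmf_nat: "(\<Sum>k. pmf (p :: nat pmf) k) = 1"
proof -
  have eq: "(\<Sum>k. ennreal (pmf p k)) = 1"
    using nn_integral_pmf[of UNIV p] by (simp add: nn_integral_count_space_nat)
  then show s: "summable (pmf p)" by (intro summable_suminf_not_top) auto
  have "ennreal (\<Sum>k. pmf p k) = 1" using eq s by (simp add: suminf_ennreal2)
  then show "(\<Sum>k. pmf p k) = 1" by (simp add: ennreal_eq_1)
qed

lemma sums_mean:
  assumes "integrable (measure_pmf (p :: nat pmf)) real"
  shows "(\<lambda>k. real k * pmf p k) sums mean p"
proof -
  have "integrable (count_space UNIV) (\<lambda>k. pmf p k *\<^sub>R real k)"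
    using assms unfolding measure_pmf_eq_density by (subst (asm) integrable_density) auto
  from sums_integral_count_space_nat[OF this] show ?thesis
    unfolding mean_def measure_pmf_eq_density by (subst integral_density) (auto simp: mult.commute)
qed

text \<open>
  This is \<open>s f'(s) - f(s) = s\<^sup>2 (f(s) / s)'\<close>, written as a series so that it also makes sense at the
  radius of convergence.
\<close>
definition pgf_slope :: "nat pmf \<Rightarrow> real \<Rightarrow> real" where
  "pgf_slope p s = (\<Sum>k. (real k - 1) * pmf p k * s ^ k)"

abbreviation pgf_summable :: "nat pmf \<Rightarrow> real \<Rightarrow> bool" where
  "pgf_summable p s \<equiv> summable (\<lambda>k. pmf p k * s ^ k)"

abbreviation slope_summable :: "nat pmf \<Rightarrow> real \<Rightarrow> bool" where
  "slope_summable p s \<equiv> summable (\<lambda>k. (real k - 1) * pmf p k * s ^ k)"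

lemma pgf_summable_mono: "0 \<le> x \<Longrightarrow> x \<le> y \<Longrightarrow> pgf_summable p y \<Longrightarrow> pgf_summable p x"
  by (rule summable_comparison_test[where g="\<lambda>k. pmf p k * y ^ k"])
     (auto intro!: exI[of _ 0] mult_left_mono power_mono)

lemma pgf_nonneg: "0 \<le> s \<Longrightarrow> pgf_summable p s \<Longrightarrow> 0 \<le> pgf p s"
  unfolding pgf_def by (intro suminf_nonneg) auto

lemma pgf_summable_1: "pgf_summable p 1" using summable_pmf_nat by simp

lemma pgf_1: "pgf p 1 = 1" using suminf_pmf_nat by (simp add: pgf_def)

lemma pgf_mono: "0 \<le> x \<Longrightarrow> x \<le> y \<Longrightarrow> pgf_summable p y \<Longrightarrow> pgf p x \<le> pgf p y"
  unfolding pgf_def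
  by (rule suminf_le) (auto intro: pgf_summable_mono intro!: mult_left_mono power_mono)

lemma pgf_summable_in_disc: "0 \<le> s \<Longrightarrow> ereal s < conv_radius (pmf p) \<Longrightarrow> pgf_summable p s"
  by (rule summable_in_conv_radius) simp

lemma one_le_conv_radius: "1 \<le> conv_radius (pmf (p :: nat pmf))"
  using conv_radius_geI[of "pmf p" 1] pgf_summable_1[of p] by (simp add: one_ereal_def)

lemma pgf_deriv_in_disc:
  assumes "ereal \<bar>s\<bar> < conv_radius (pmf p)"
  shows "(pgf p has_real_derivative (\<Sum>n. diffs (pmf p) n * s ^ n)) (at s)"
    and "summable (\<lambda>n. diffs (pmf p) n * s ^ n)"
proof -
  obtain r where r: "\<bar>s\<bar> < r" "ereal r < conv_radius (pmf p)"
    using ereal_dense2[OF assms] by auto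
  have sm: "\<And>z. norm z < r \<Longrightarrow> summable (\<lambda>n. pmf p n * z ^ n)"
    using r(2) by (intro summable_in_conv_radius) (metis less_ereal.simps(1) order_less_trans)
  show "(pgf p has_real_derivative (\<Sum>n. diffs (pmf p) n * s ^ n)) (at s)"
    unfolding pgf_def[abs_def] by (rule termdiffs_strong'[OF sm]) (use r in auto)
  show "summable (\<lambda>n. diffs (pmf p) n * s ^ n)"
    by (rule termdiff_converges[OF _ sm]) (use r in auto)
qed

lemma slope_in_disc:
  assumes "0 < s" "ereal s < conv_radius (pmf p)"
  shows "slope_summable p s" and "pgf_slope p s = s * deriv (pgf p) s - pgf p s"
proof -
  have a: "ereal \<bar>s\<bar> < conv_radius (pmf p)" using assms by simp
  note d = pgf_deriv_in_disc[OF a]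
  have sums0: "(\<lambda>n. s * (diffs (pmf p) n * s ^ n)) sums (s * deriv (pgf p) s)"
    using d by (simp add: DERIV_imp_deriv sums_mult summable_sums)
  have "(\<lambda>n. real (Suc n) * pmf p (Suc n) * s ^ Suc n) sums (s * deriv (pgf p) s)"
    using sums0 by (simp add: diffs_def mult_ac)
  then have "(\<lambda>n. real n * pmf p n * s ^ n) sums (s * deriv (pgf p) s)"
    by (subst (asm) sums_Suc_iff) simp
  moreover have "(\<lambda>n. pmf p n * s ^ n) sums pgf p s"
    unfolding pgf_def using assms by (intro summable_sums pgf_summable_in_disc) auto
  ultimately have "(\<lambda>k. real k * pmf p k * s ^ k - pmf p k * s ^ k) sums (s * deriv (pgf p) s - pgf p s)"
    by (rule sums_diff)
  then have "(\<lambda>k. (real k - 1) * pmf p k * s ^ k) sums (s * deriv (pgf p) s - pgf p s)"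
    by (simp add: algebra_simps)
  then show "slope_summable p s" "pgf_slope p s = s * deriv (pgf p) s - pgf p s"
    by (simp_all add: pgf_slope_def sums_iff)
qed

lemma slope_at_1:
  assumes "integrable (measure_pmf p) real"
  shows "slope_summable p 1" and "pgf_slope p 1 = mean p - 1"
proof -
  have "(\<lambda>k. real k * pmf p k - pmf p k) sums (mean p - 1)"
    using sums_diff[OF sums_mean[OF assms] summable_sums[OF summable_pmf_nat]] by (simp add: suminf_pmf_nat)
  then have "(\<lambda>k. (real k - 1) * pmf p k * 1 ^ k) sums (mean p - 1)" by (simp add: algebra_simps)
  then show "slope_summable p 1" "pgf_slope p 1 = mean p - 1" by (simp_all add: pgf_slope_def sums_iff)
qed

text \<open>
  Each term \<open>x\<^bsup>k-1\<^esup>\<close> of \<open>f(x) / x\<close> is a convex function of \<open>log x\<close>, so \<open>f(x) / x\<close> lies above its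
  tangent in this variable. All comparisons of values of \<open>f(x) / x\<close> below use this inequality, at
  \<open>x\<close> up to and including the radius of convergence.
\<close>
lemma pgf_quotient_tangent:
  assumes s: "0 < s" "pgf_summable p s" "slope_summable p s" and x: "0 < x" "pgf_summable p x"
  shows "pgf p s / s + (ln x - ln s) * (pgf_slope p s / s) \<le> pgf p x / x"
proof -
  have tm: "pmf p k * s ^ k / s + (ln x - ln s) * ((real k - 1) * pmf p k * s ^ k / s) \<le> pmf p k * x ^ k / x" for k
  proof -
    define y where "y = (real k - 1) * (ln x - ln s)"
    have "x ^ k / x = exp (real k * ln x - ln x)" "s ^ k / s = exp (real k * ln s - ln s)"
      using x s by (simp_all add: exp_diff exp_of_nat_mult)
    then have "x ^ k / x = s ^ k / s * exp y"
      by (simp add: y_def algebra_simps flip: exp_add)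
    moreover have "s ^ k / s * (1 + y) \<le> s ^ k / s * exp y"
      using s(1) by (intro mult_left_mono) auto
    ultimately have "s ^ k / s * (1 + y) \<le> x ^ k / x" by simp
    then have "pmf p k * (s ^ k / s * (1 + y)) \<le> pmf p k * (x ^ k / x)" by (intro mult_left_mono) auto
    then show ?thesis by (simp add: y_def algebra_simps diff_divide_distrib add_divide_distrib)
  qed
  have "(\<Sum>k. pmf p k * s ^ k / s + (ln x - ln s) * ((real k - 1) * pmf p k * s ^ k / s)) \<le> (\<Sum>k. pmf p k * x ^ k / x)"
    by (intro suminf_le tm summable_add summable_mult summable_divide s x)
  also have "(\<Sum>k. pmf p k * s ^ k / s + (ln x - ln s) * ((real k - 1) * pmf p k * s ^ k / s))
      = pgf p s / s + (ln x - ln s) * (pgf_slope p s / s)"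
    unfolding pgf_def pgf_slope_def using s
    by (subst suminf_add[symmetric]) (auto intro!: summable_mult summable_divide simp: suminf_mult suminf_divide)
  also have "(\<Sum>k. pmf p k * x ^ k / x) = pgf p x / x"
    unfolding pgf_def using x by (simp add: suminf_divide)
  finally show ?thesis .
qed

locale step_law =
  fixes p :: "nat pmf"
  assumes p0: "0 < pmf p 0" and p01: "pmf p 0 + pmf p 1 < 1"
begin

lemma ex_step_ge_2: "\<exists>j\<ge>2. 0 < pmf p j"
proof (rule ccontr)
  assume "\<not> ?thesis"
  then have z: "pmf p j = 0" if "j \<notin> {..<2}" for j
    using that by (metis lessThan_iff not_less pmf_nonneg order_le_less)
  have "(\<Sum>k. pmf p k) = (\<Sum>k<2. pmf p k)" using z by (intro suminf_finite) auto
  then show False using p01 suminf_pmf_nat[of p] by (simp add: numeral_2_eq_2)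
qed

lemma pgf_ge_p0: "0 \<le> s \<Longrightarrow> pgf_summable p s \<Longrightarrow> pmf p 0 \<le> pgf p s"
  unfolding pgf_def using sum_le_suminf[of "\<lambda>k. pmf p k * s ^ k" "{0}"] by auto

lemma pgf_pos: "0 \<le> s \<Longrightarrow> pgf_summable p s \<Longrightarrow> 0 < pgf p s"
  using pgf_ge_p0 p0 by fastforce

lemma slope_strict_mono:
  assumes "0 < x" "x < y" "slope_summable p x" "slope_summable p y"
  shows "pgf_slope p x < pgf_slope p y"
proof -
  obtain j where j: "j \<ge> 2" "0 < pmf p j" using ex_step_ge_2 by auto
  have le: "(real k - 1) * pmf p k * x ^ k \<le> (real k - 1) * pmf p k * y ^ k" for k
  proof (cases k)
    case (Suc n)
    have "x ^ k \<le> y ^ k" using assms by (intro power_mono) auto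
    then show ?thesis using Suc by (intro mult_left_mono) auto
  qed simp
  have "0 < (\<Sum>k. (real k - 1) * pmf p k * y ^ k - (real k - 1) * pmf p k * x ^ k)"
  proof (rule suminf_pos2[of _ j])
    show "0 < (real j - 1) * pmf p j * y ^ j - (real j - 1) * pmf p j * x ^ j"
      using j assms by (auto intro!: mult_strict_left_mono power_strict_mono)
  qed (use le assms in \<open>auto intro!: summable_diff\<close>)
  then show ?thesis unfolding pgf_slope_def using assms by (subst (asm) suminf_diff[symmetric]) auto
qed

abbreviation "in_disc s \<equiv> 0 < s \<and> ereal s < conv_radius (pmf p)"
abbreviation "is_root s \<equiv> 0 < s \<and> ereal s < conv_radius (pmf p) \<and> s * deriv (pgf p) s = pgf p s"

lemma is_root_iff: "is_root s \<longleftrightarrow> in_disc s \<and> pgf_slope p s = 0"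
  using slope_in_disc(2)[of s p] by auto

lemma is_root_unique: "is_root s \<Longrightarrow> is_root t \<Longrightarrow> s = t"
  using slope_strict_mono[of s t] slope_strict_mono[of t s] slope_in_disc(1)[of s p] slope_in_disc(1)[of t p]
  unfolding is_root_iff by linarith

lemma s0_eq_root: "is_root s \<Longrightarrow> s0 p = s"
proof -
  assume s: "is_root s"
  then have "(THE s. is_root s) = s" using is_root_unique by blast
  then show ?thesis using s unfolding s0_def Let_def by auto
qed

lemma s0_eq_radius: "\<nexists>s. is_root s \<Longrightarrow> s0 p = real_of_ereal (conv_radius (pmf p))"
  unfolding s0_def Let_def by auto

lemma isCont_pgf: "in_disc s \<Longrightarrow> isCont (pgf p) s"
  using pgf_deriv_in_disc(1)[of s p] DERIV_isCont by force

lemma isCont_slope: assumes "in_disc s" shows "isCont (pgf_slope p) s"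
proof -
  have "pgf_slope p = (\<lambda>s. \<Sum>k. ((real k - 1) * pmf p k) * s ^ k)"
    by (simp add: pgf_slope_def fun_eq_iff)
  moreover obtain r where r: "s < r" "ereal r < conv_radius (pmf p)"
    using ereal_dense2[of s "conv_radius (pmf p)"] assms by auto
  ultimately show ?thesis
    using slope_in_disc(1)[of r p] assms
    by (auto intro!: isCont_powser[of _ r])
qed

lemma root_from_sign_change:
  assumes "in_disc a" "in_disc b" "a \<le> b" "pgf_slope p a \<le> 0" "0 \<le> pgf_slope p b"
  shows "\<exists>s. a \<le> s \<and> s \<le> b \<and> is_root s"
proof -
  have "\<exists>s. a \<le> s \<and> s \<le> b \<and> pgf_slope p s = 0"
    using assms
    by (intro IVT allI impI isCont_slope) (auto intro: order_le_less_trans[of "ereal _" "ereal b"])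
  then show ?thesis unfolding is_root_iff using assms
    by (meson ereal_less_eq(3) order_le_less_trans order_less_le_trans)
qed

text \<open>
  At \<open>0\<close> the slope is \<open>-p\<^sub>0\<close>.
\<close>
lemma slope_negative_near_0: "\<exists>a>0. \<forall>x. 0 < x \<and> x \<le> a \<longrightarrow> in_disc x \<and> pgf_slope p x < 0"
proof -
  have s: "slope_summable p (1/2)"
    using less_le_trans[OF _ one_le_conv_radius[of p], of "ereal (1/2)"]
    by (intro slope_in_disc) auto
  have "isCont (\<lambda>s. \<Sum>k. ((real k - 1) * pmf p k) * s ^ k) 0"
    by (rule isCont_powser[of _ "1/2"]) (use s in auto)
  then have c: "isCont (pgf_slope p) 0" by (simp add: pgf_slope_def[abs_def])
  have "pgf_slope p 0 = (real 0 - 1) * pmf p 0"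
    unfolding pgf_slope_def using powser_zero[of "\<lambda>k. (real k - 1) * pmf p k"] by simp
  then have neg: "pgf_slope p 0 < 0" using p0 by simp
  have "eventually (\<lambda>x. pgf_slope p x < 0) (at 0)"
    using order_tendstoD(2)[OF c[unfolded isCont_def] neg] .
  then obtain d where d: "d > 0" "\<And>x. x \<noteq> 0 \<Longrightarrow> dist x 0 < d \<Longrightarrow> pgf_slope p x < 0"
    unfolding eventually_at by auto
  show ?thesis
  proof (intro exI[of _ "min (d/2) (1/2)"] conjI allI impI)
    fix x assume x: "0 < x \<and> x \<le> min (d/2) (1/2)"
    then have "ereal x < 1" by simp
    then show "ereal x < conv_radius (pmf p)" using one_le_conv_radius[of p] by (rule less_le_trans)
    show "pgf_slope p x < 0" using x d by (intro d(2)) auto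
  qed (use d in auto)
qed

lemma slope_negative_no_root:
  assumes "\<nexists>s. is_root s" "in_disc s" shows "pgf_slope p s < 0"
proof (rule ccontr)
  assume n: "\<not> ?thesis"
  obtain a where a: "a > 0" "\<And>x. 0 < x \<and> x \<le> a \<Longrightarrow> in_disc x \<and> pgf_slope p x < 0"
    using slope_negative_near_0 by blast
  show False
    using root_from_sign_change[of "min a s" s] a(2)[of "min a s"] a(1) assms n by auto
qed

text \<open>
  Some \<open>p\<^sub>j\<close> with \<open>j \<ge> 2\<close> is positive, and its term makes the slope positive for large \<open>s\<close>.
\<close>
lemma conv_radius_finite_no_root:
  assumes "\<nexists>s. is_root s" shows "conv_radius (pmf p) \<noteq> \<infinity>"
proof
  assume inf: "conv_radius (pmf p) = \<infinity>"
  obtain j where j: "j \<ge> 2" "0 < pmf p j" using ex_step_ge_2 by auto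
  define s where "s = max 1 (pmf p 0 / pmf p j)"
  have s: "1 \<le> s" "pmf p 0 / pmf p j \<le> s" by (auto simp: s_def)
  have disc: "in_disc s" using inf s by auto
  have "(\<Sum>k\<in>{0,j}. (real k - 1) * pmf p k * s ^ k) \<le> pgf_slope p s"
    unfolding pgf_slope_def
  proof (rule sum_le_suminf)
    show "slope_summable p s" using disc by (intro slope_in_disc) auto
    fix n assume "n \<in> - {0, j}" then show "0 \<le> (real n - 1) * pmf p n * s ^ n"
      using s(1) by (cases n) auto
  qed auto
  moreover have "(\<Sum>k\<in>{0,j}. (real k - 1) * pmf p k * s ^ k) = (real j - 1) * pmf p j * s ^ j - pmf p 0"
    using j by simp
  moreover have "pmf p 0 \<le> 1 * pmf p j * s" using s j by (simp add: field_simps)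
  moreover have "1 * pmf p j * s \<le> (real j - 1) * pmf p j * s ^ j"
    using j s self_le_power[of s j] by (intro mult_mono) auto
  ultimately show False using slope_negative_no_root[OF assms disc] by simp
qed

text \<open>
  At a root the tangent is horizontal, so the root minimises \<open>f(x) / x\<close>.
\<close>
lemma R_root:
  assumes "is_root s" shows "s0 p = s" "R_const p = s / pgf p s"
    "\<And>x. 0 < x \<Longrightarrow> pgf_summable p x \<Longrightarrow> pgf p s / s \<le> pgf p x / x"
proof -
  show s: "s0 p = s" using s0_eq_root assms .
  have ps: "pgf_summable p s" "slope_summable p s" "pgf_slope p s = 0"
    using assms slope_in_disc(1)[of s p] is_root_iff[of s] by (auto intro: pgf_summable_in_disc)
  have "isCont (\<lambda>s. s / pgf p s) s"
    using isCont_pgf[of s] pgf_pos[of s] assms ps by (intro continuous_intros) auto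
  then have "((\<lambda>s. s / pgf p s) \<longlongrightarrow> s / pgf p s) (at_left s)"
    unfolding isCont_def by (rule tendsto_within_subset) simp
  then show "R_const p = s / pgf p s" unfolding R_const_def s
    by (intro tendsto_Lim) auto
  show "pgf p s / s \<le> pgf p x / x" if "0 < x" "pgf_summable p x" for x
    using pgf_quotient_tangent[of s p x] that ps assms by simp
qed

lemma quotient_decreasing:
  assumes "0 < x" "x < s" "pgf_summable p s" "slope_summable p s" "pgf_slope p s < 0"
  shows "pgf p s / s < pgf p x / x"
proof -
  have "pgf p s / s + (ln x - ln s) * (pgf_slope p s / s) \<le> pgf p x / x"
    using assms pgf_summable_mono[of x s p] by (intro pgf_quotient_tangent) auto
  moreover have "0 < (ln x - ln s) * (pgf_slope p s / s)"
    using assms by (intro mult_neg_neg divide_neg_pos) auto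
  ultimately show ?thesis by linarith
qed

text \<open>
  Without a root the slope is negative in the whole disc, so \<open>s / f(s)\<close> increases up to the radius
  of convergence; it is bounded since \<open>f \<ge> p\<^sub>0\<close>.
\<close>
lemma R_no_root:
  assumes nr: "\<nexists>s. is_root s"
  shows "conv_radius (pmf p) = ereal (s0 p)" "1 \<le> s0 p"
    "((\<lambda>s. s / pgf p s) \<longlongrightarrow> R_const p) (at_left (s0 p))"
    "\<And>x. 0 < x \<Longrightarrow> x < s0 p \<Longrightarrow> x / pgf p x \<le> R_const p"
proof -
  show r: "conv_radius (pmf p) = ereal (s0 p)"
    unfolding s0_eq_radius[OF nr] using conv_radius_finite_no_root[OF nr] one_le_conv_radius[of p]
    by (cases "conv_radius (pmf p)") auto
  show s1: "1 \<le> s0 p" using one_le_conv_radius[of p] unfolding r by simp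
  define g where "g = (\<lambda>s. s / pgf p s)"
  have mono: "g x \<le> g y" if "0 < x" "x < y" "y < s0 p" for x y
  proof -
    have d: "in_disc x" "in_disc y" using that r by auto
    have "pgf p y / y < pgf p x / x"
      using d that slope_negative_no_root[OF nr] by (intro quotient_decreasing slope_in_disc) (auto intro: pgf_summable_in_disc)
    then show ?thesis unfolding g_def
      using d pgf_pos[of x] pgf_pos[of y] pgf_summable_in_disc[of _ p] that
      by (simp add: field_simps)
  qed
  have bdd: "g x \<le> s0 p / pmf p 0" if "0 < x" "x < s0 p" for x
    unfolding g_def using that r p0 pgf_ge_p0[of x] pgf_summable_in_disc[of x p]
    by (intro frac_le) auto
  define S where "S = (SUP x\<in>{0<..<s0 p}. g x)"
  have B: "bdd_above (g ` {0<..<s0 p})" using bdd by (auto intro!: bdd_aboveI2)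
  have ub: "g x \<le> S" if "0 < x" "x < s0 p" for x
    unfolding S_def using that B by (intro cSUP_upper) auto
  have lim: "(g \<longlongrightarrow> S) (at_left (s0 p))"
  proof (rule order_tendstoI)
    fix a assume "a < S"
    then obtain x where x: "0 < x" "x < s0 p" "a < g x"
      unfolding S_def using B s1 by (subst (asm) less_cSUP_iff) auto
    have "eventually (\<lambda>y. y \<in> {x<..<s0 p}) (at_left (s0 p))"
      using x by (intro eventually_at_left_real)
    then show "eventually (\<lambda>y. a < g y) (at_left (s0 p))"
      by eventually_elim (use x mono in fastforce)
  next
    fix a assume a: "S < a"
    have "eventually (\<lambda>y. y \<in> {0<..<s0 p}) (at_left (s0 p))"
      using s1 by (intro eventually_at_left_real) auto
    then show "eventually (\<lambda>y. g y < a) (at_left (s0 p))"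
      by eventually_elim (use a ub in fastforce)
  qed
  have R: "R_const p = S" unfolding R_const_def using lim by (intro tendsto_Lim) (auto simp: g_def)
  show "((\<lambda>s. s / pgf p s) \<longlongrightarrow> R_const p) (at_left (s0 p))" using lim R by (simp add: g_def)
  show "x / pgf p x \<le> R_const p" if "0 < x" "x < s0 p" for x using ub[OF that] R by (simp add: g_def)
qed

lemma quotient_le_R:
  assumes "0 < x" "pgf_summable p x" shows "x / pgf p x \<le> R_const p"
proof (cases "\<exists>s. is_root s")
  case True
  then obtain s where s: "is_root s" by auto
  have f: "0 < pgf p s" "0 < pgf p x" using s assms by (auto intro!: pgf_pos pgf_summable_in_disc)
  have "pgf p s / s \<le> pgf p x / x" using R_root(3)[OF s assms] .
  then have "x / pgf p x \<le> s / pgf p s" using s f assms by (simp add: field_simps)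
  then show ?thesis using R_root(2)[OF s] by simp
next
  case False
  note nr = R_no_root[OF False]
  have f: "0 < pgf p x" using assms by (auto intro!: pgf_pos)
  have "x \<le> s0 p" using conv_radius_geI[OF assms(2)] assms(1) nr(1) by simp
  then consider "x < s0 p" | "x = s0 p" by linarith
  then show ?thesis
  proof cases
    case 1 then show ?thesis using nr(4) assms by auto
  next
    case 2
    have "((\<lambda>s. s / pgf p x) \<longlongrightarrow> x / pgf p x) (at_left x)"
      using f by (intro tendsto_intros) auto
    moreover have "eventually (\<lambda>y. y / pgf p x \<le> R_const p) (at_left x)"
    proof -
      have "eventually (\<lambda>y. y \<in> {0<..<x}) (at_left x)" using assms by (intro eventually_at_left_real) auto
      then show ?thesis
      proof eventually_elim
        case (elim y)
        have "y / pgf p x \<le> y / pgf p y" using elim assms pgf_mono[of y x p] pgf_pos[of y] pgf_summable_mono[of y x p]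
          by (intro divide_left_mono mult_pos_pos f) auto
        also have "\<dots> \<le> R_const p" using nr(4) elim 2 by auto
        finally show ?case .
      qed
    qed
    ultimately show ?thesis by (rule tendsto_upperbound) simp
  qed
qed

lemma one_le_R: "1 \<le> R_const p"
  using quotient_le_R[of 1] pgf_summable_1[of p] pgf_1[of p] by simp

text \<open>
  The slope is \<open>E Z - 1 \<le> 0\<close> at \<open>1\<close>, so \<open>s0 \<ge> 1\<close>. If \<open>s0\<close> is not a root, a point slightly to its left
  will do, unless \<open>s0 = 1\<close>; then \<open>R \<le> 1 = 1 / f(1)\<close>, and \<open>s = 1\<close> will do.
\<close>
lemma approximate_R_subcritical:
  assumes m: "integrable (measure_pmf p) real" "mean p \<le> 1" and r: "r < R_const p"
  shows "\<exists>s\<ge>1. pgf_summable p s \<and> r < s / pgf p s"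
proof (cases "\<exists>s. is_root s")
  case True
  then obtain s where s: "is_root s" by auto
  have "1 \<le> s"
  proof (rule ccontr)
    assume "\<not> 1 \<le> s"
    then have "pgf_slope p s < pgf_slope p 1"
      using s slope_at_1[OF m(1)] slope_in_disc[of s p] by (intro slope_strict_mono) auto
    then show False using s slope_at_1[OF m(1)] m(2) is_root_iff[of s] by auto
  qed
  moreover have "pgf_summable p s" using s by (intro pgf_summable_in_disc) auto
  ultimately show ?thesis using R_root(2)[OF s] r by (intro exI[of _ s]) simp
next
  case False
  note nr = R_no_root[OF False]
  show ?thesis
  proof (cases "s0 p = 1")
    case True
    have "eventually (\<lambda>y. y \<in> {0<..<1}) (at_left (1::real))" by (intro eventually_at_left_real) auto
    then have "eventually (\<lambda>y. y / pgf p y \<le> 1) (at_left 1)"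
    proof eventually_elim
      case (elim y)
      have "pgf_summable p y" using elim nr(1) True by (auto intro: pgf_summable_in_disc)
      moreover have "pgf p 1 / 1 + (ln y - ln 1) * (pgf_slope p 1 / 1) \<le> pgf p y / y"
        using elim slope_at_1[OF m(1)] \<open>pgf_summable p y\<close> pgf_summable_1 by (intro pgf_quotient_tangent) auto
      moreover have "0 \<le> ln y * (mean p - 1)" using elim m(2) by (intro mult_nonpos_nonpos) auto
      ultimately have "1 \<le> pgf p y / y" using slope_at_1[OF m(1)] pgf_1[of p] by simp
      then show ?case using elim pgf_pos[of y] \<open>pgf_summable p y\<close> by (simp add: field_simps)
    qed
    then have "R_const p \<le> 1" using nr(3) unfolding True by (intro tendsto_upperbound[where F="at_left 1"]) auto
    then show ?thesis using r pgf_1[of p] pgf_summable_1[of p] by (intro exI[of _ 1]) auto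
  next
    case ne: False
    then have "eventually (\<lambda>y. y \<in> {1<..<s0 p}) (at_left (s0 p))" using nr(2) by (intro eventually_at_left_real) auto
    moreover have "eventually (\<lambda>y. r < y / pgf p y) (at_left (s0 p))" using order_tendstoD(1)[OF nr(3) r] .
    ultimately have "eventually (\<lambda>y. y \<in> {1<..<s0 p} \<and> r < y / pgf p y) (at_left (s0 p))" by eventually_elim auto
    then obtain y where "y \<in> {1<..<s0 p}" "r < y / pgf p y"
      using eventually_happens[of _ "at_left (s0 p)"] by auto
    moreover have "pgf_summable p y" using calculation nr(1) by (intro pgf_summable_in_disc) auto
    ultimately show ?thesis by (intro exI[of _ y]) auto
  qed
qed

text \<open>
  The slope is \<open>E Z - 1 > 0\<close> at \<open>1\<close>, so the root lies below \<open>1\<close>. The quotient \<open>f(x) / x\<close> decreases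
  from above \<open>1\<close> to its minimum at the root, which gives the least fixed point \<open>q_star\<close>, and stays
  below its value \<open>1\<close> at \<open>1\<close> afterwards.
\<close>
lemma supercritical_constants:
  assumes m: "integrable (measure_pmf p) real" "1 < mean p"
  shows "0 < s0 p" "s0 p < 1" "R_const p = s0 p / pgf p (s0 p)" "0 < q_star p" "q_star p < 1"
    "\<And>x. q_star p < x \<Longrightarrow> x < 1 \<Longrightarrow> pgf p x < x"
proof -
  have disc: "in_disc x" if "0 < x" "x < 1" for x
    using that one_le_conv_radius[of p] by (metis less_ereal.simps(1) less_le_trans one_ereal_def)
  have "\<exists>b. 0 < b \<and> b < 1 \<and> 0 < pgf_slope p b"
  proof -
    have "(\<lambda>n. \<Sum>k<n. (real k - 1) * pmf p k * 1 ^ k) \<longlonglongrightarrow> mean p - 1"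
      using summable_LIMSEQ[OF slope_at_1(1)[OF m(1)]] slope_at_1(2)[OF m(1)] unfolding pgf_slope_def by simp
    from order_tendstoD(1)[OF this, of 0]
    have "eventually (\<lambda>n. 0 < (\<Sum>k<n. (real k - 1) * pmf p k * 1 ^ k)) sequentially"
      using m(2) by simp
    then obtain N where "\<And>n. n \<ge> N \<Longrightarrow> 0 < (\<Sum>k<n. (real k - 1) * pmf p k * 1 ^ k)"
      unfolding eventually_sequentially by blast
    then obtain n where n: "0 < (\<Sum>k<n. (real k - 1) * pmf p k * 1 ^ k)" "1 \<le> n"
      by (meson max.cobounded1 max.cobounded2)
    have "((\<lambda>x. \<Sum>k<n. (real k - 1) * pmf p k * x ^ k) \<longlongrightarrow> (\<Sum>k<n. (real k - 1) * pmf p k * 1 ^ k)) (at_left 1)"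
      by (intro tendsto_intros)
    from order_tendstoD(1)[OF this n(1)]
    have "eventually (\<lambda>x. 0 < (\<Sum>k<n. (real k - 1) * pmf p k * x ^ k)) (at_left 1)" .
    moreover have "eventually (\<lambda>y. y \<in> {0<..<1}) (at_left (1::real))" by (intro eventually_at_left_real) auto
    ultimately have "eventually (\<lambda>x. x \<in> {0<..<1} \<and> 0 < (\<Sum>k<n. (real k - 1) * pmf p k * x ^ k)) (at_left 1)"
      by eventually_elim auto
    then obtain b where b: "b \<in> {0<..<1}" "0 < (\<Sum>k<n. (real k - 1) * pmf p k * b ^ k)"
      using eventually_happens[of _ "at_left (1::real)"] by auto
    have "(\<Sum>k<n. (real k - 1) * pmf p k * b ^ k) \<le> pgf_slope p b"
      unfolding pgf_slope_def
    proof (rule sum_le_suminf)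
      show "slope_summable p b" using disc b by (intro slope_in_disc) auto
      fix k assume "k \<in> - {..<n}" then show "0 \<le> (real k - 1) * pmf p k * b ^ k"
        using b n(2) by auto
    qed auto
    then show ?thesis using b by auto
  qed
  then obtain b where b: "0 < b" "b < 1" "0 < pgf_slope p b" by auto
  obtain a where a: "a > 0" "\<And>x. 0 < x \<and> x \<le> a \<Longrightarrow> in_disc x \<and> pgf_slope p x < 0"
    using slope_negative_near_0 by blast
  obtain s where s: "is_root s" "s \<le> b"
    using root_from_sign_change[of "min a b" b] a(2)[of "min a b"] a(1) b disc[of b]
    by (metis less_imp_le min.cobounded1 min.cobounded2 min_less_iff_conj)
  note root = R_root[OF s(1)]
  show "0 < s0 p" "s0 p < 1" "R_const p = s0 p / pgf p (s0 p)" using root s b by auto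
  have s1: "0 < s" "s < 1" using s b by auto
  have ps: "pgf_summable p x" if "0 \<le> x" "x \<le> 1" for x using pgf_summable_mono[OF that pgf_summable_1] .
  have sl: "slope_summable p x" if "0 < x" "x < 1" for x using disc[OF that] slope_in_disc by auto
  have sgn: "pgf_slope p x < 0" if "0 < x" "x < s" for x
    using slope_strict_mono[of x s] that s1 sl[of x] sl[of s] s is_root_iff[of s] by auto
  have sgn': "0 < pgf_slope p x" if "s < x" "x < 1" for x
    using slope_strict_mono[of s x] that s1 sl[of x] sl[of s] s is_root_iff[of s] by auto
  have after: "pgf p x / x < 1" if "s \<le> x" "x < 1" for x
  proof -
    define y where "y = (x + 1) / 2"
    have y: "s < y" "y < 1" using that by (auto simp: y_def)
    have big: "pgf p y / y < 1" if y: "s < y" "y < 1" for y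
    proof -
      have "pgf p y / y + (ln 1 - ln y) * (pgf_slope p y / y) \<le> pgf p 1 / 1"
        using y s1 ps sl summable_pmf_nat by (intro pgf_quotient_tangent) auto
      moreover have "0 < (ln 1 - ln y) * (pgf_slope p y / y)"
        using y s1 sgn'[of y] by (intro mult_pos_pos divide_pos_pos) auto
      ultimately show ?thesis using pgf_1[of p] by simp
    qed
    show ?thesis
    proof (cases "x = s")
      case True
      have "pgf p s / s \<le> pgf p y / y" using root(3)[of y] y s1 ps[of y] by auto
      then show ?thesis using big[OF y] True by simp
    qed (use big that in auto)
  qed
  have "continuous_on {0..s} (pgf p)"
  proof (rule continuous_at_imp_continuous_on, safe)
    fix x assume "x \<in> {0..s}"
    then have "ereal \<bar>x\<bar> < conv_radius (pmf p)" using s(1)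
      by (auto intro: order_le_less_trans[of "ereal x" "ereal s"])
    then show "isCont (pgf p) x" using pgf_deriv_in_disc(1) DERIV_isCont by blast
  qed
  then have cont: "continuous_on {0..s} (\<lambda>x. x - pgf p x)" by (intro continuous_intros)
  have f0: "pgf p 0 = pmf p 0" unfolding pgf_def using powser_zero[of "pmf p"] by simp
  have fs: "pgf p s < s" using after[of s] s1 by (simp add: field_simps)
  obtain q where q: "0 \<le> q" "q \<le> s" "q - pgf p q = 0"
    using IVT'[of "\<lambda>x. x - pgf p x" 0 0 s] cont f0 fs p0 s1 by auto
  have q': "0 < q" "q < s" using q f0 fs p0 by (auto simp: order_le_less)
  have qs: "q_star p = q"
    unfolding q_star_def
  proof (rule Least_equality)
    show "0 < q \<and> pgf_summable p q \<and> pgf p q = q" using q q' s1 ps by auto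
    fix y assume y: "0 < y \<and> pgf_summable p y \<and> pgf p y = y"
    show "q \<le> y"
    proof (rule ccontr)
      assume "\<not> q \<le> y"
      then have "pgf p q / q < pgf p y / y"
        using y q' s1 sgn[of q] ps[of q] sl[of q] by (intro quotient_decreasing) auto
      then show False using y q q' by auto
    qed
  qed
  show "0 < q_star p" "q_star p < 1" using qs q' s1 by simp_all
  fix x assume x: "q_star p < x" "x < 1"
  have "pgf p x / x < 1"
  proof (cases "x < s")
    case True
    then have "pgf p x / x < pgf p q / q"
      using x qs q' s1 sgn[of x] ps[of x] sl[of x] by (intro quotient_decreasing) auto
    then show ?thesis using q q' by auto
  next
    case False then show ?thesis using after x by auto
  qed
  then show "pgf p x < x" using x qs q' by (simp add: field_simps)
qed

end

section \<open>Growth of the number of walks\<close>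
lemma suminf_ennreal_swap:
  fixes f :: "nat \<Rightarrow> nat \<Rightarrow> ennreal"
  shows "(\<Sum>i. \<Sum>j. f i j) = (\<Sum>j. \<Sum>i. f i j)"
  using nn_integral_suminf[of "\<lambda>j i. f i j" "count_space UNIV"]
  by (simp add: nn_integral_count_space_nat)

definition birth_rate :: "nat pmf \<Rightarrow> nat \<Rightarrow> nat \<Rightarrow> real" where
  "birth_rate p d e = (if 1 \<le> e \<and> e \<le> Suc d then pmf p (Suc d - e) else 0)"

definition offspring_sum :: "nat pmf \<Rightarrow> (nat \<Rightarrow> real) \<Rightarrow> nat \<Rightarrow> real" where
  "offspring_sum p u d = (\<Sum>j\<le>d. pmf p j * u (Suc d - j))"

text \<open>
  \<open>walks p n d\<close> is the total weight of the walks of \<open>n\<close> steps from \<open>d\<close> to \<open>1\<close>, where a step from \<open>d\<close>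
  to \<open>e\<close> has weight \<open>birth_rate p d e\<close>: the powers of the mean matrix applied to a unit vector.
\<close>
definition walks :: "nat pmf \<Rightarrow> nat \<Rightarrow> nat \<Rightarrow> real" where
  "walks p n = (offspring_sum p ^^ n) (\<lambda>d. if d = 1 then 1 else 0)"

lemma walks_0: "walks p 0 d = (if d = 1 then 1 else 0)" by (simp add: walks_def)

lemma walks_Suc: "walks p (Suc n) = offspring_sum p (walks p n)" by (simp add: walks_def)

lemma offspring_sum_nonneg: "(\<And>e. 0 \<le> u e) \<Longrightarrow> 0 \<le> offspring_sum p u d"
  unfolding offspring_sum_def by (intro sum_nonneg mult_nonneg_nonneg) auto

lemma offspring_sum_mono: "(\<And>e. u e \<le> v e) \<Longrightarrow> offspring_sum p u d \<le> offspring_sum p v d"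
  unfolding offspring_sum_def by (intro sum_mono mult_left_mono) auto

lemma offspring_sum_cmult: "offspring_sum p (\<lambda>e. c * u e) d = c * offspring_sum p u d"
  unfolding offspring_sum_def by (simp add: sum_distrib_left mult_ac)

lemma offspring_sum_sum: "offspring_sum p (\<lambda>e. \<Sum>i\<in>I. u i e) d = (\<Sum>i\<in>I. offspring_sum p (u i) d)"
  unfolding offspring_sum_def by (subst sum.swap) (simp add: sum_distrib_left)

lemma pmf_sum_le_1: "finite A \<Longrightarrow> (\<Sum>j\<in>A. pmf (p :: nat pmf) j) \<le> 1"
  by (metis measure_measure_pmf_finite measure_pmf.prob_le_1)

lemma offspring_sum_le:
  assumes "\<And>e. u e \<le> c" "0 \<le> c" shows "offspring_sum p u d \<le> c"
proof -
  have "offspring_sum p u d \<le> (\<Sum>j\<le>d. pmf p j * c)"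
    unfolding offspring_sum_def using assms by (intro sum_mono mult_left_mono) auto
  also have "\<dots> = c * (\<Sum>j\<le>d. pmf p j)" by (simp add: sum_distrib_left mult_ac)
  also have "\<dots> \<le> c * 1" using assms pmf_sum_le_1 by (intro mult_left_mono) auto
  finally show ?thesis by simp
qed

lemma walks_nonneg: "0 \<le> walks p n d"
  by (induction n arbitrary: d) (auto simp: walks_0 walks_Suc intro!: offspring_sum_nonneg)

lemma walks_le_1: "walks p n d \<le> 1"
  by (induction n arbitrary: d) (auto simp: walks_0 walks_Suc intro!: offspring_sum_le)

lemma offspring_sum_eq_suminf:
  assumes "\<And>e. 0 \<le> u e"
  shows "ennreal (offspring_sum p u d) = (\<Sum>e. ennreal (birth_rate p d e) * ennreal (u e))"
proof -
  have "(\<Sum>e. ennreal (birth_rate p d e) * ennreal (u e))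
      = (\<Sum>e\<in>{1..Suc d}. ennreal (birth_rate p d e) * ennreal (u e))"
    by (intro suminf_finite) (auto simp: birth_rate_def)
  also have "\<dots> = (\<Sum>j\<in>{..d}. ennreal (pmf p j * u (Suc d - j)))"
    by (rule sum.reindex_bij_witness[of _ "\<lambda>j. Suc d - j" "\<lambda>e. Suc d - e"])
       (auto simp: birth_rate_def ennreal_mult' assms)
  also have "\<dots> = ennreal (offspring_sum p u d)"
    unfolding offspring_sum_def using assms by (intro sum_ennreal) auto
  finally show ?thesis by simp
qed

text \<open>
  The same powers applied from the left, starting at depth one. The steps of the walk go up by at most
  one level, so the number of walks from \<open>1\<close> to \<open>d\<close>, but not from \<open>d\<close> to \<open>1\<close>, factorises over the
  levels in between.
\<close>
fun walks_from_1 :: "nat pmf \<Rightarrow> nat \<Rightarrow> nat \<Rightarrow> ennreal" where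
  "walks_from_1 p 0 e = (if e = 1 then 1 else 0)"
| "walks_from_1 p (Suc n) e = (\<Sum>d. walks_from_1 p n d * ennreal (birth_rate p d e))"

text \<open>
  The sum over the depth at which a walk is cut into two pieces does not depend on the place of the cut.
\<close>
lemma walks_from_1_return: "walks_from_1 p n 1 = ennreal (walks p n 1)"
proof -
  define I where "I = (\<lambda>m n. \<Sum>d. walks_from_1 p m d * ennreal (walks p n d))"
  have step: "I (Suc m) n = I m (Suc n)" for m n
  proof -
    have "I (Suc m) n = (\<Sum>e. \<Sum>d. walks_from_1 p m d * ennreal (birth_rate p d e) * ennreal (walks p n e))"
      unfolding I_def by simp
    also have "\<dots> = (\<Sum>d. \<Sum>e. walks_from_1 p m d * ennreal (birth_rate p d e) * ennreal (walks p n e))"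
      by (rule suminf_ennreal_swap)
    also have "\<dots> = (\<Sum>d. walks_from_1 p m d * (\<Sum>e. ennreal (birth_rate p d e) * ennreal (walks p n e)))"
      by (simp add: mult.assoc)
    also have "\<dots> = I m (Suc n)"
      unfolding I_def by (simp add: offspring_sum_eq_suminf walks_nonneg walks_Suc)
    finally show ?thesis .
  qed
  have shift: "I k m = I 0 (m + k)" for k m
    by (induction k arbitrary: m) (simp_all add: step)
  have "walks_from_1 p n 1 = I n 0"
    unfolding I_def using suminf_finite[of "{1}" "\<lambda>d. walks_from_1 p n d * ennreal (walks p 0 d)"]
    by (simp add: walks_0)
  also have "\<dots> = I 0 n" using shift[of n 0] by simp
  also have "\<dots> = ennreal (walks p n 1)"
    unfolding I_def using suminf_finite[of "{1}" "\<lambda>d. walks_from_1 p 0 d * ennreal (walks p n d)"] by simp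
  finally show ?thesis .
qed

fun green_partial :: "nat pmf \<Rightarrow> real \<Rightarrow> nat \<Rightarrow> nat \<Rightarrow> ennreal" where
  "green_partial p z 0 e = 0"
| "green_partial p z (Suc n) e =
     (if e = 1 then 1 else 0) + ennreal z * (\<Sum>d. green_partial p z n d * ennreal (birth_rate p d e))"

text \<open>
  \<open>green p z e\<close> is the generating function, in \<open>z\<close>, of the walks from \<open>1\<close> to \<open>e\<close>.
\<close>
definition green :: "nat pmf \<Rightarrow> real \<Rightarrow> nat \<Rightarrow> ennreal" where
  "green p z e = (SUP n. green_partial p z n e)"

lemma green_partial_eq:
  assumes "0 \<le> z"
  shows "green_partial p z n e = (\<Sum>m<n. ennreal (z ^ m) * walks_from_1 p m e)"
proof (induction n arbitrary: e)
  case (Suc n)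
  have "ennreal z * (\<Sum>d. green_partial p z n d * ennreal (birth_rate p d e))
      = ennreal z * (\<Sum>d. \<Sum>m<n. ennreal (z ^ m) * walks_from_1 p m d * ennreal (birth_rate p d e))"
    by (simp add: Suc sum_distrib_right)
  also have "\<dots> = ennreal z * (\<Sum>m<n. \<Sum>d. ennreal (z ^ m) * walks_from_1 p m d * ennreal (birth_rate p d e))"
    by (subst suminf_sum) auto
  also have "\<dots> = (\<Sum>m<n. ennreal (z ^ Suc m) * walks_from_1 p (Suc m) e)"
    using assms by (simp add: sum_distrib_left mult.assoc ennreal_mult)
  finally show ?case by (simp only: green_partial.simps sum.lessThan_Suc_shift) simp
qed simp

lemma green_partial_mono: "0 \<le> z \<Longrightarrow> incseq (\<lambda>n. green_partial p z n e)"
  unfolding green_partial_eq by (intro monoI sum_mono2) auto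

lemma green_eq:
  assumes z: "0 \<le> z"
  shows "green p z e = (if e = 1 then 1 else 0) + ennreal z * (\<Sum>d. green p z d * ennreal (birth_rate p d e))"
proof -
  have inc: "incseq (\<lambda>n. green_partial p z n d * ennreal (birth_rate p d e))" for d
    using green_partial_mono[OF z, of p d] by (auto simp: incseq_def intro!: mult_right_mono)
  have "green p z e = (SUP n. green_partial p z (Suc n) e)"
    unfolding green_def
  proof (rule antisym)
    have "green_partial p z n e \<le> green_partial p z (Suc n) e" for n
      using green_partial_mono[OF z, of p e] by (simp add: incseq_Suc_iff)
    then show "(SUP n. green_partial p z n e) \<le> (SUP n. green_partial p z (Suc n) e)"
      by (intro SUP_mono) (blast intro: UNIV_I)
    show "(SUP n. green_partial p z (Suc n) e) \<le> (SUP n. green_partial p z n e)"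
      by (intro SUP_mono) blast
  qed
  also have "\<dots> = (if e = 1 then 1 else 0) + (SUP n. ennreal z * (\<Sum>d. green_partial p z n d * ennreal (birth_rate p d e)))"
    by (simp add: ennreal_SUP_add_right)
  also have "(SUP n. ennreal z * (\<Sum>d. green_partial p z n d * ennreal (birth_rate p d e)))
    = ennreal z * (SUP n. (\<Sum>d. green_partial p z n d * ennreal (birth_rate p d e)))"
    by (simp add: SUP_mult_left_ennreal)
  also have "(SUP n. (\<Sum>d. green_partial p z n d * ennreal (birth_rate p d e)))
    = (\<Sum>d. SUP n. green_partial p z n d * ennreal (birth_rate p d e))"
    by (rule ennreal_suminf_SUP_eq[symmetric]) (use inc in simp)
  also have "\<dots> = (\<Sum>d. green p z d * ennreal (birth_rate p d e))"
    by (simp add: green_def SUP_mult_right_ennreal)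
  finally show ?thesis .
qed

lemma green_partial_at_0: "green_partial p z n 0 = 0"
  by (cases n) (simp_all add: birth_rate_def)

lemma suminf_ennreal_head: "(\<Sum>k. f k) = f 0 + (\<Sum>k. f (Suc k))" for f :: "nat \<Rightarrow> ennreal"
  using suminf_offset[of f 1] by (simp add: add.commute)

lemma suminf_ennreal_tail_le: "(\<Sum>k. f (m + k)) \<le> (\<Sum>k. f k)" for f :: "nat \<Rightarrow> ennreal"
  using suminf_offset[of f m] by (simp add: add.commute)

text \<open>
  A walk from \<open>1\<close> to \<open>d\<close>, a step up to \<open>d + 1\<close>, and a walk from \<open>d + 1\<close> to \<open>d + e\<close> that stays at
  \<open>d + 1\<close> or above form a walk from \<open>1\<close> to \<open>d + e\<close>, and the last visit to \<open>d\<close> recovers the pieces.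
  The proof follows the last of the three pieces step by step.
\<close>
lemma green_supermult:
  assumes z: "0 \<le> z" and "1 \<le> d"
  shows "ennreal (z * pmf p 0) * green p z d * green p z e \<le> green p z (d + e)"
proof -
  let ?c = "ennreal (z * pmf p 0) * green p z d"
  have "?c * green_partial p z n e \<le> green p z (d + e)" for n
  proof (induction n arbitrary: e)
    case (Suc n)
    show ?case
    proof (cases "e = 0")
      case False
      let ?g = "\<lambda>k. green p z (d + k) * ennreal (birth_rate p (d + k) (d + e))"
      let ?a = "\<lambda>k. if k = 0 then green p z d * ennreal (pmf p 0) * (if e = 1 then 1 else 0) else (0 :: ennreal)"
      let ?b = "\<lambda>k. ?c * (green_partial p z n k * ennreal (birth_rate p k e))"
      have tm: "?a k + ?b k \<le> ?g k" for k
      proof (cases "k = 0")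
        case True
        then show ?thesis using False assms by (auto simp: green_partial_at_0 birth_rate_def)
      next
        case k: False
        have "birth_rate p k e = birth_rate p (d + k) (d + e)"
          using k False assms by (auto simp: birth_rate_def)
        then show ?thesis using k Suc.IH[of k] by (simp add: mult.assoc[symmetric] mult_right_mono)
      qed
      have a: "(\<Sum>k. ?a k) = green p z d * ennreal (pmf p 0) * (if e = 1 then 1 else 0)"
        using suminf_finite[of "{0}" ?a] by simp
      have "?c * green_partial p z (Suc n) e
         = ennreal z * ((\<Sum>k. ?a k) + (\<Sum>k. ?b k))"
        unfolding a using z by (simp add: ennreal_mult algebra_simps)
      also have "\<dots> = ennreal z * (\<Sum>k. ?a k + ?b k)"
        by (subst suminf_add) auto
      also have "\<dots> \<le> ennreal z * (\<Sum>k. ?g k)"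
        by (intro mult_left_mono suminf_le tm) auto
      also have "\<dots> \<le> ennreal z * (\<Sum>k. green p z k * ennreal (birth_rate p k (d + e)))"
        by (intro mult_left_mono suminf_ennreal_tail_le[of "\<lambda>k. green p z k * ennreal (birth_rate p k (d + e))"]) auto
      also have "\<dots> \<le> green p z (d + e)"
        by (subst (2) green_eq[OF z]) simp
      finally show ?thesis .
    qed (simp add: birth_rate_def)
  qed simp
  then have "(SUP n. ?c * green_partial p z n e) \<le> green p z (d + e)" by (intro SUP_least)
  then show ?thesis by (simp add: SUP_mult_left_ennreal green_def)
qed

context step_law begin

text \<open>
  Put \<open>s = z p\<^sub>0 G\<close> with \<open>G\<close> the Green function at \<open>1\<close>. By supermultiplicativity the Green function at
  \<open>d\<close> is at least \<open>G s\<^bsup>d-1\<^esup>\<close>, and the equation of \<open>G\<close> at \<open>1\<close>, multiplied by \<open>z p\<^sub>0\<close>, becomes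
  \<open>z f(s) \<le> s\<close>. So \<open>z \<le> s / f(s) \<le> R\<close>.
\<close>
lemma green_finite_imp_le_R:
  assumes z: "0 < z" and fin: "green p z 1 < \<top>"
  shows "z \<le> R_const p"
proof -
  define s where "s = z * pmf p 0 * enn2real (green p z 1)"
  have g1: "1 \<le> green p z 1" using z by (subst green_eq) auto
  have sE: "ennreal s = ennreal (z * pmf p 0) * green p z 1"
    unfolding s_def using z fin by (simp add: ennreal_mult)
  have "0 < enn2real (green p z 1)" using g1 fin
    by (simp add: enn2real_positive_iff) (metis ennreal_zero_less_one order_less_le_trans)
  then have s0: "0 < s" unfolding s_def using z p0 by simp
  have geo: "ennreal (s ^ Suc k) \<le> ennreal (z * pmf p 0) * green p z (Suc k)" for k
  proof (induction k)
    case (Suc k)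
    have "ennreal (s ^ Suc (Suc k)) = ennreal (s ^ Suc k) * ennreal s"
      using s0 by (simp add: ennreal_mult'[symmetric] mult_ac)
    also have "\<dots> \<le> (ennreal (z * pmf p 0) * green p z (Suc k)) * (ennreal (z * pmf p 0) * green p z 1)"
      unfolding sE using Suc by (intro mult_right_mono) auto
    also have "\<dots> \<le> ennreal (z * pmf p 0) * green p z (Suc k + 1)"
      using mult_left_mono[OF green_supermult[of z "Suc k" p 1], of "ennreal (z * pmf p 0)"] z
      by (simp add: mult_ac)
    finally show ?case by simp
  qed (simp add: sE)
  have "ennreal z * (\<Sum>k. ennreal (pmf p k * s ^ k)) \<le> ennreal s"
  proof -
    have "ennreal z * (\<Sum>k. ennreal (pmf p k * s ^ k))
        = ennreal z * (ennreal (pmf p 0) + (\<Sum>k. ennreal (pmf p (Suc k)) * ennreal (s ^ Suc k)))"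
      using s0 by (subst suminf_ennreal_head) (simp add: ennreal_mult')
    also have "\<dots> \<le> ennreal z * (ennreal (pmf p 0) + (\<Sum>k. ennreal (pmf p (Suc k)) * (ennreal (z * pmf p 0) * green p z (Suc k))))"
      by (intro mult_left_mono add_left_mono suminf_le geo) auto
    also have "\<dots> = ennreal z * (ennreal (pmf p 0) + ennreal (z * pmf p 0) * (\<Sum>k. green p z (Suc k) * ennreal (pmf p (Suc k))))"
      by (subst ennreal_suminf_cmult[symmetric]) (simp only: mult_ac)
    also have "\<dots> = ennreal (z * pmf p 0) * (1 + ennreal z * (\<Sum>k. green p z (Suc k) * ennreal (birth_rate p (Suc k) 1)))"
      using z by (simp add: birth_rate_def ennreal_mult algebra_simps)
    also have "\<dots> \<le> ennreal (z * pmf p 0) * (1 + ennreal z * (\<Sum>k. green p z k * ennreal (birth_rate p k 1)))"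
      by (subst suminf_ennreal_head[of "\<lambda>k. green p z k * ennreal (birth_rate p k 1)"])
         (intro mult_left_mono add_left_mono, auto)
    also have "\<dots> = ennreal s" unfolding sE using z by (subst (2) green_eq) auto
    finally show ?thesis .
  qed
  then have le: "(\<Sum>k. ennreal (pmf p k * s ^ k)) \<le> ennreal (s / z)"
  proof -
    assume "ennreal z * (\<Sum>k. ennreal (pmf p k * s ^ k)) \<le> ennreal s"
    then have "ennreal (1/z) * (ennreal z * (\<Sum>k. ennreal (pmf p k * s ^ k))) \<le> ennreal (1/z) * ennreal s"
      by (intro mult_left_mono) auto
    moreover have "ennreal (1/z) * ennreal z = 1" using z by (simp flip: ennreal_mult)
    moreover have "ennreal (1/z) * ennreal s = ennreal (s / z)" using z s0 by (simp flip: ennreal_mult)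
    ultimately show ?thesis by (simp only: mult.assoc[symmetric] mult_1_left)
  qed
  then have ps: "pgf_summable p s"
    using s0 by (intro summable_suminf_not_top) (auto simp: top_unique)
  then have "pgf p s \<le> s / z"
    unfolding pgf_def using le s0 z by (subst (asm) suminf_ennreal2) auto
  then have "z \<le> s / pgf p s" using z pgf_pos[of s] ps s0 by (simp add: field_simps)
  also have "\<dots> \<le> R_const p" by (rule quotient_le_R[OF s0 ps])
  finally show ?thesis .
qed

text \<open>
  Otherwise the Green function would be dominated by a geometric series beyond \<open>R\<close>.
\<close>
lemma walks_growth:
  assumes th: "0 < th" "th < 1 / R_const p"
  shows "\<exists>N\<ge>1. th ^ N \<le> walks p N 1"
proof (rule ccontr)
  assume "\<not> ?thesis"
  then have small: "walks p n 1 \<le> th ^ n" for n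
    by (cases "n = 0") (simp add: walks_0, metis One_nat_def Suc_leI neq0_conv linear)
  obtain u where u: "th < u" "u < 1 / R_const p" using th dense by blast
  define z where "z = 1 / u"
  have z: "0 < z" "R_const p < z" using u th one_le_R by (auto simp: z_def field_simps)
  have x: "0 \<le> th / u" "th / u < 1" using th u by auto
  have "green_partial p z n 1 \<le> ennreal (1 / (1 - th / u))" for n
  proof -
    have "green_partial p z n 1 = (\<Sum>m<n. ennreal (z ^ m) * ennreal (walks p m 1))"
      using z unfolding green_partial_eq[OF less_imp_le[OF z(1)]] by (simp only: walks_from_1_return)
    also have "\<dots> = ennreal (\<Sum>m<n. z ^ m * walks p m 1)"
      using z by (subst sum_ennreal[symmetric]) (auto simp: ennreal_mult walks_nonneg)
    also have "\<dots> \<le> ennreal (\<Sum>m<n. (th / u) ^ m)"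
    proof (intro ennreal_leI sum_mono)
      fix m
      have "z ^ m * walks p m 1 \<le> z ^ m * th ^ m" using small[of m] z by (intro mult_left_mono) auto
      then show "z ^ m * walks p m 1 \<le> (th / u) ^ m" by (simp add: z_def power_divide power_mult_distrib)
    qed
    also have "\<dots> \<le> ennreal (\<Sum>m. (th / u) ^ m)"
      using x by (intro ennreal_leI sum_le_suminf summable_geometric) auto
    also have "\<dots> = ennreal (1 / (1 - th / u))" using x by (simp add: suminf_geometric)
    finally show ?thesis .
  qed
  then have "green p z 1 \<le> ennreal (1 / (1 - th / u))" unfolding green_def by (intro SUP_least)
  then have "green p z 1 < \<top>" by (simp add: order_le_less_trans)
  then have "z \<le> R_const p" using z by (intro green_finite_imp_le_R) auto
  then show False using z by simp
qed

end

section \<open>The tree process as a recursion over its first event\<close>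
text \<open>
  Reveal the process event by event. After the first event of the initial vertex there are two
  independent processes: the initial vertex continues, and its child starts. Iterating, the events are
  indexed by binary strings, read from the first event on: \<open>True\<close> stands for the continuation and
  \<open>False\<close> for the child. An event consists of a waiting time and a number of steps.
\<close>
type_synonym events = "bool list \<Rightarrow> real \<times> nat"

definition branch :: "bool \<Rightarrow> events \<Rightarrow> events" where
  "branch c x = (\<lambda>l. x (c # l))"

text \<open>
  The number of vertices at depth one at time \<open>t\<close> when the initial vertex has depth \<open>d\<close>, restricted to
  the first \<open>n\<close> levels of the binary tree of events. An event with more steps than the depth has no child.
\<close>
fun depth_one_count :: "nat \<Rightarrow> nat \<Rightarrow> real \<Rightarrow> events \<Rightarrow> nat" where
  "depth_one_count 0 d t x = (if d = 1 then 1 else 0)"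
| "depth_one_count (Suc n) d t x =
     (if fst (x []) \<le> t
      then depth_one_count n d (t - fst (x [])) (branch True x)
         + (if snd (x []) \<le> d then depth_one_count n (Suc d - snd (x [])) (t - fst (x [])) (branch False x) else 0)
      else (if d = 1 then 1 else 0))"

text \<open>
  A label records the events that created a vertex and its predecessors, the earliest one last.
  Skipping the first event of the root shifts the last entry of a label by one; a descendant of the
  first child gets the entry \<open>0\<close> at the end.
\<close>
fun delay_vertex :: "vertex \<Rightarrow> vertex" where
  "delay_vertex v = (if v = [] then [] else butlast v @ [Suc (last v)])"

fun delay_event :: "vertex \<times> nat \<Rightarrow> vertex \<times> nat" where
  "delay_event (v, i) = (if v = [] then ([], Suc i) else (delay_vertex v, i))"

fun graft_event :: "vertex \<times> nat \<Rightarrow> vertex \<times> nat" where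
  "graft_event (v, i) = (v @ [0], i)"

fun event_label :: "bool list \<Rightarrow> vertex \<times> nat" where
  "event_label [] = ([], 0)"
| "event_label (True # b) = delay_event (event_label b)"
| "event_label (False # b) = graft_event (event_label b)"

definition delayed :: "(vertex \<Rightarrow> nat \<Rightarrow> 'a) \<Rightarrow> vertex \<Rightarrow> nat \<Rightarrow> 'a" where
  "delayed X v i = case_prod X (delay_event (v, i))"

definition grafted :: "(vertex \<Rightarrow> nat \<Rightarrow> 'a) \<Rightarrow> vertex \<Rightarrow> nat \<Rightarrow> 'a" where
  "grafted X v i = case_prod X (graft_event (v, i))"

definition events_of :: "(vertex \<Rightarrow> nat \<Rightarrow> real) \<Rightarrow> (vertex \<Rightarrow> nat \<Rightarrow> nat) \<Rightarrow> events" where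
  "events_of W Z b = (case_prod W (event_label b), case_prod Z (event_label b))"

lemma events_of_Cons:
  "branch True (events_of W Z) = events_of (delayed W) (delayed Z)"
  "branch False (events_of W Z) = events_of (grafted W) (grafted Z)"
  by (auto simp: fun_eq_iff branch_def events_of_def delayed_def grafted_def simp del: delay_event.simps graft_event.simps split: prod.split)

lemma events_of_Nil: "events_of W Z [] = (W [] 0, Z [] 0)"
  by (simp add: events_of_def)

lemma inj_delay_event: "inj delay_event"
proof (rule injI)
  fix a b assume eq: "delay_event a = delay_event b"
  obtain v i w j where ab: "a = (v, i)" "b = (w, j)" by fastforce
  show "a = b" using eq unfolding ab
    by (cases v rule: rev_cases; cases w rule: rev_cases) auto
qed

lemma inj_graft_event: "inj graft_event"
  by (rule injI) (metis append_same_eq graft_event.simps prod.collapse prod.inject)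

lemma delay_neq_graft: "delay_event a \<noteq> graft_event b"
proof -
  obtain v i w j where ab: "a = (v, i)" "b = (w, j)" by fastforce
  show ?thesis unfolding ab by (cases v rule: rev_cases) auto
qed

lemma event_label_inj: "inj event_label"
proof (rule injI)
  fix b c show "event_label b = event_label c \<Longrightarrow> b = c"
  proof (induction b arbitrary: c)
    case Nil
    then show ?case
      by (cases c rule: event_label.cases; cases "event_label (tl c)") (auto split: if_splits)
  next
    case (Cons e b)
    show ?case
    proof (cases c)
      case Nil
      then show ?thesis using Cons.prems
        by (cases e; cases "event_label b") (auto split: if_splits)
    next
      case c: (Cons e' c')
      have "e = e'" using Cons.prems c delay_neq_graft[of "event_label b" "event_label c'"]
          delay_neq_graft[of "event_label c'" "event_label b"] by (cases e; cases e') auto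
      moreover have "event_label b = event_label c'"
        using Cons.prems c \<open>e = e'\<close>
        by (cases e) (auto dest: injD[OF inj_delay_event] injD[OF inj_graft_event]
          simp del: delay_event.simps graft_event.simps)
      ultimately show ?thesis using Cons.IH c by simp
    qed
  qed
qed

text \<open>
  The depth of a vertex when the initial vertex has depth \<open>d\<close>; \<open>None\<close> if the vertex is never born.
\<close>
fun depth_from :: "nat \<Rightarrow> (vertex \<Rightarrow> nat \<Rightarrow> nat) \<Rightarrow> vertex \<Rightarrow> nat option" where
  "depth_from d Z [] = Some d"
| "depth_from d Z (i # v) = (case depth_from d Z v of None \<Rightarrow> None
     | Some e \<Rightarrow> if Z v i \<le> e then Some (Suc e - Z v i) else None)"

definition depth_one_vertices ::
    "nat \<Rightarrow> real \<Rightarrow> (vertex \<Rightarrow> nat \<Rightarrow> real) \<Rightarrow> (vertex \<Rightarrow> nat \<Rightarrow> nat) \<Rightarrow> vertex set" where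
  "depth_one_vertices d t W Z = {u. depth_from d Z u = Some 1 \<and> birth_time W u \<le> t}"

lemma path_to_root_depth:
  "is_vertex Z v \<Longrightarrow> \<exists>e. depth_from 0 Z v = Some e \<and> length (path_to_root Z v) = Suc e \<and>
     (\<forall>j\<le>e. path_to_root Z v ! j = [] \<longleftrightarrow> j = e)"
  "\<not> is_vertex Z v \<Longrightarrow> depth_from 0 Z v = None"
proof (induction v)
  case (Cons i v)
  { case 1
    then obtain e where e: "depth_from 0 Z v = Some e" "length (path_to_root Z v) = Suc e"
      "\<forall>j\<le>e. path_to_root Z v ! j = [] \<longleftrightarrow> j = e" using Cons by auto
    have z: "Z v i \<le> e" using 1 e by (simp add: dist_root_def)
    have "\<forall>j\<le>Suc e - Z v i. path_to_root Z (i # v) ! j = [] \<longleftrightarrow> j = Suc e - Z v i"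
      using z e by (auto simp: nth_Cons split: nat.splits)
    then show ?case using e z by auto }
  { case 2
    show ?case
    proof (cases "is_vertex Z v")
      case True
      then obtain e where "depth_from 0 Z v = Some e" "length (path_to_root Z v) = Suc e" using Cons by auto
      then show ?thesis using 2 True by (auto simp: dist_root_def)
    qed (use Cons in auto) }
qed auto

text \<open>
  The root is the last entry of a path to the root and occurs nowhere else in it, so the parent is the
  root exactly if the number of steps is the depth, that is, if the child has depth one.
\<close>
lemma root_children_eq: "root_children W Z t = card (depth_one_vertices 0 t W Z)"
proof -
  have "u \<in> tree_edges W Z t `` {[]} \<longleftrightarrow> u \<in> depth_one_vertices 0 t W Z" for u
  proof (cases u)
    case Nil then show ?thesis by (auto simp: tree_edges_def depth_one_vertices_def)
  next
    case (Cons i v)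
    have "u \<in> tree_edges W Z t `` {[]} \<longleftrightarrow>
       path_to_root Z v ! Z v i = [] \<and> is_vertex Z u \<and> birth_time W u \<le> t"
      unfolding Cons tree_edges_def tree_vertices_def by auto
    also have "\<dots> \<longleftrightarrow> u \<in> depth_one_vertices 0 t W Z"
    proof (cases "is_vertex Z v")
      case True
      then obtain e where "depth_from 0 Z v = Some e" "length (path_to_root Z v) = Suc e"
        "\<forall>j\<le>e. path_to_root Z v ! j = [] \<longleftrightarrow> j = e" using path_to_root_depth(1) by blast
      then show ?thesis using True Cons by (auto simp: depth_one_vertices_def dist_root_def)
    next
      case False then show ?thesis using Cons path_to_root_depth(2)[OF False] by (simp add: depth_one_vertices_def)
    qed
    finally show ?thesis .
  qed
  then have "tree_edges W Z t `` {[]} = depth_one_vertices 0 t W Z" by blast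
  then show ?thesis by (simp add: root_children_def)
qed

lemma delay_vertex_Cons: "v \<noteq> [] \<Longrightarrow> delay_vertex (i # v) = i # delay_vertex v"
  by simp

lemma depth_from_delay: "depth_from d Z (delay_vertex v) = depth_from d (delayed Z) v"
proof (induction v)
  case (Cons i v)
  show ?case
  proof (cases "v = []")
    case False
    then have "delayed Z v i = Z (delay_vertex v) i" by (simp add: delayed_def)
    then show ?thesis using Cons by (simp only: delay_vertex_Cons[OF False] depth_from.simps)
  qed (simp add: delayed_def)
qed simp

lemma depth_from_graft:
  "depth_from d Z (v @ [0]) = (if Z [] 0 \<le> d then depth_from (Suc d - Z [] 0) (grafted Z) v else None)"
proof (induction v)
  case (Cons i v)
  have "grafted Z v i = Z (v @ [0]) i" by (simp add: grafted_def)
  then show ?case using Cons by (simp split: option.split)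
qed simp

lemma birth_time_delay:
  "v \<noteq> [] \<Longrightarrow> birth_time W (delay_vertex v) = W [] 0 + birth_time (delayed W) v"
proof (induction v)
  case (Cons i v)
  show ?case
  proof (cases "v = []")
    case True
    have "(\<Sum>j\<le>Suc i. W [] j) = W [] 0 + (\<Sum>j\<le>i. W [] (Suc j))" by (rule sum.atMost_Suc_shift)
    then show ?thesis using True by (simp add: delayed_def del: sum.atMost_Suc)
  next
    case False
    then have "delayed W v j = W (delay_vertex v) j" for j by (simp add: delayed_def)
    then show ?thesis using Cons False by (simp only: delay_vertex_Cons[OF False] birth_time.simps) simp
  qed
qed simp

lemma birth_time_graft: "birth_time W (v @ [0]) = W [] 0 + birth_time (grafted W) v"
  by (induction v) (auto simp: grafted_def)

text \<open>
  The level of the binary tree of events at which a vertex appears.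
\<close>
definition weight :: "vertex \<Rightarrow> nat" where "weight v = sum_list (map Suc v)"

lemma weight_delay: "v \<noteq> [] \<Longrightarrow> weight (delay_vertex v) = Suc (weight v)"
  by (cases v rule: rev_cases) (auto simp: weight_def)

lemma weight_graft: "weight (v @ [0]) = Suc (weight v)"
  by (simp add: weight_def)

lemma birth_time_nonneg: "(\<And>v i. 0 \<le> W v i) \<Longrightarrow> 0 \<le> birth_time W v"
  by (induction v) (auto intro!: add_nonneg_nonneg sum_nonneg)

lemma delay_or_graft:
  assumes "u \<noteq> []" obtains v where "v \<noteq> []" "u = delay_vertex v" | v where "u = v @ [0]"
proof -
  obtain w k where u: "u = w @ [k]" using assms by (cases u rule: rev_cases) auto
  show thesis
  proof (cases k)
    case 0 then show thesis using u that(2) by simp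
  next
    case (Suc j)
    have "delay_vertex (w @ [j]) = u" using u Suc by simp
    then show thesis using that(1)[of "w @ [j]"] by simp
  qed
qed

lemma inj_delay_vertex: "inj delay_vertex"
proof (rule injI)
  fix v w :: vertex assume "delay_vertex v = delay_vertex w"
  then show "v = w" by (cases v rule: rev_cases; cases w rule: rev_cases) auto
qed

lemma delay_vertex_eq_Nil: "delay_vertex v = [] \<longleftrightarrow> v = []" by simp

text \<open>
  A vertex other than the initial one descends from the continuation or from the first child, and
  these are the two summands of the recursion. Waiting times have to be nonnegative: otherwise a
  vertex could be born in time although the first event is late.
\<close>
lemma depth_one_count_eq_card:
  assumes "\<And>v i. 0 \<le> W v i" "0 \<le> t"
  shows "finite {u \<in> depth_one_vertices d t W Z. weight u \<le> n} \<and>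
         card {u \<in> depth_one_vertices d t W Z. weight u \<le> n} = depth_one_count n d t (events_of W Z)"
  using assms
proof (induction n arbitrary: d t W Z)
  case 0
  have "{u \<in> depth_one_vertices d t W Z. weight u \<le> 0} = (if d = 1 then {[]} else {})"
    using 0 by (auto simp: depth_one_vertices_def weight_def)
  then show ?case by simp
next
  case (Suc n)
  let ?S = "{u \<in> depth_one_vertices d t W Z. weight u \<le> Suc n}"
  let ?t = "t - W [] 0"
  let ?A = "{u \<in> depth_one_vertices d ?t (delayed W) (delayed Z). weight u \<le> n}"
  let ?B = "{u \<in> depth_one_vertices (Suc d - Z [] 0) ?t (grafted W) (grafted Z). weight u \<le> n}"
  have nn: "0 \<le> delayed W v i" "0 \<le> grafted W v i" for v i
    using Suc.prems(1) by (auto simp: delayed_def grafted_def)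
  have mem_delay: "delay_vertex v \<in> ?S \<longleftrightarrow> v \<in> ?A" if "v \<noteq> []" for v
    using that by (auto simp: depth_one_vertices_def depth_from_delay birth_time_delay weight_delay
        simp del: delay_vertex.simps)
  have mem_graft: "v @ [0] \<in> ?S \<longleftrightarrow> Z [] 0 \<le> d \<and> v \<in> ?B" for v
    by (auto simp: depth_one_vertices_def depth_from_graft birth_time_graft weight_graft)
  have mem_Nil: "[] \<in> ?S \<longleftrightarrow> d = 1"
    using Suc.prems(2) by (auto simp: depth_one_vertices_def weight_def)
  show ?case
  proof (cases "W [] 0 \<le> t")
    case True
    have memA_Nil: "[] \<in> ?A \<longleftrightarrow> d = 1"
      using True by (auto simp: depth_one_vertices_def weight_def)
    have S: "?S = delay_vertex ` ?A \<union> (if Z [] 0 \<le> d then (\<lambda>v. v @ [0]) ` ?B else {})" (is "_ = ?R")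
    proof (rule set_eqI)
      fix u
      show "u \<in> ?S \<longleftrightarrow> u \<in> ?R"
      proof (cases "u = []")
        case u: True
        have "[] \<in> ?R \<longleftrightarrow> [] \<in> ?A"
          by (auto simp del: delay_vertex.simps simp: delay_vertex_eq_Nil image_iff eq_commute[of "[]"]
              depth_one_vertices_def weight_def)
        then show ?thesis using u mem_Nil memA_Nil by simp
      next
        case False
        then show ?thesis
        proof (cases u rule: delay_or_graft)
          case (1 v)
          have "u \<in> ?R \<longleftrightarrow> v \<in> ?A"
          proof -
            have "u \<noteq> w @ [0]" for w using 1 by (cases v rule: rev_cases) auto
            moreover have "delay_vertex v \<in> delay_vertex ` ?A \<longleftrightarrow> v \<in> ?A"
              by (rule inj_image_mem_iff[OF inj_delay_vertex])
            ultimately show ?thesis using 1 by auto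
          qed
          then show ?thesis using mem_delay[OF 1(1)] 1 by simp
        next
          case (2 v)
          have "u \<noteq> delay_vertex w" for w using 2 by (cases w rule: rev_cases) auto
          then have "u \<in> ?R \<longleftrightarrow> Z [] 0 \<le> d \<and> v \<in> ?B" using 2 by auto
          then show ?thesis using mem_graft[of v] 2 by simp
        qed
      qed
    qed
    have disj: "delay_vertex ` ?A \<inter> (\<lambda>v. v @ [0]) ` ?B = {}"
    proof -
      have "delay_vertex w \<noteq> v @ [0]" for v w by (cases w rule: rev_cases) auto
      then show ?thesis by blast
    qed
    have t: "0 \<le> ?t" using True by simp
    have A: "finite ?A" "card ?A = depth_one_count n d ?t (events_of (delayed W) (delayed Z))"
      using Suc.IH[OF nn(1) t] by auto
    have B: "finite ?B" "card ?B = depth_one_count n (Suc d - Z [] 0) ?t (events_of (grafted W) (grafted Z))"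
      using Suc.IH[OF nn(2) t] by auto
    have cA: "card (delay_vertex ` ?A) = card ?A"
      by (rule card_image) (meson inj_delay_vertex inj_on_subset subset_UNIV)
    have cB: "card ((\<lambda>v. v @ [0]) ` ?B) = card ?B"
      by (rule card_image) (auto simp: inj_on_def)
    have "card ?S = card ?A + (if Z [] 0 \<le> d then card ?B else 0)"
      unfolding S using A(1) B(1) disj cA cB by (simp add: card_Un_disjoint del: delay_vertex.simps)
    moreover have "finite ?S" unfolding S using A(1) B(1) by simp
    ultimately show ?thesis using True A(2) B(2)
      by (simp add: events_of_Nil events_of_Cons)
  next
    case False
    have ne: "u \<notin> ?S" if "u \<noteq> []" for u
      using that
    proof (cases u rule: delay_or_graft)
      case (1 v)
      then have "W [] 0 \<le> birth_time W u"
        using birth_time_delay[of v W] birth_time_nonneg[of "delayed W" v, OF nn(1)] by simp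
      then show ?thesis using False by (auto simp: depth_one_vertices_def)
    next
      case (2 v)
      then have "W [] 0 \<le> birth_time W u"
        using birth_time_graft[of W v] birth_time_nonneg[of "grafted W" v, OF nn(2)] by simp
      then show ?thesis using False by (auto simp: depth_one_vertices_def)
    qed
    have "?S = (if d = 1 then {[]} else {})"
    proof (rule set_eqI)
      fix u show "u \<in> ?S \<longleftrightarrow> u \<in> (if d = 1 then {[]} else {})"
      proof (cases "u = []")
        case True then show ?thesis using mem_Nil by simp
      next
        case False then show ?thesis using ne[OF False] by simp
      qed
    qed
    then show ?thesis using False by (simp add: events_of_Nil)
  qed
qed

lemma le_root_children_imp:
  assumes "\<And>v i. 0 \<le> W v i" "0 \<le> t" "k \<le> root_children W Z t"
  shows "\<exists>n. k \<le> depth_one_count n 0 t (events_of W Z)"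
proof (cases "k = 0")
  case False
  let ?S = "depth_one_vertices 0 t W Z"
  have k: "k \<le> card ?S" using assms by (simp add: root_children_eq)
  then have fin: "finite ?S" using False card.infinite by fastforce
  define n where "n = Max (weight ` ?S)"
  have "{u \<in> ?S. weight u \<le> n} = ?S" using fin by (auto simp: n_def)
  then show ?thesis using depth_one_count_eq_card[of W, OF assms(1,2), where d=0 and n=n and Z=Z] k by auto
qed auto

lemma imp_le_root_children:
  assumes "\<And>v i. 0 \<le> W v i" "0 \<le> t" "k \<le> depth_one_count n 0 t (events_of W Z)"
    and "\<exists>m. \<forall>n. depth_one_count n 0 t (events_of W Z) < m"
  shows "k \<le> root_children W Z t"
proof -
  let ?S = "depth_one_vertices 0 t W Z"
  note c = depth_one_count_eq_card[of W, OF assms(1,2), where d=0 and Z=Z]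
  have "finite ?S"
  proof (rule ccontr)
    assume inf: "infinite ?S"
    obtain m where m: "\<forall>n. depth_one_count n 0 t (events_of W Z) < m" using assms(4) by auto
    obtain F where F: "F \<subseteq> ?S" "finite F" "card F = m" using infinite_arbitrarily_large[OF inf] by blast
    define n where "n = Max (insert 0 (weight ` F))"
    have "F \<subseteq> {u \<in> ?S. weight u \<le> n}" using F by (auto simp: n_def)
    then have "m \<le> depth_one_count n 0 t (events_of W Z)" using c[where n=n] F(3) by (metis card_mono)
    then show False using m leD by blast
  qed
  then have "card {u \<in> ?S. weight u \<le> n} \<le> card ?S" by (intro card_mono) auto
  then show ?thesis using c[where n=n] assms(3) by (simp add: root_children_eq)
qed

lemma depth_one_count_ge: "(if d = 1 then 1 else 0) \<le> depth_one_count n d t x"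
proof (induction n arbitrary: d t x)
  case (Suc n)
  then show ?case using trans_le_add1[OF Suc[of d "t - fst (x [])" "branch True x"]] by (simp)
qed simp

lemma depth_one_count_mono_time: "t \<le> t' \<Longrightarrow> depth_one_count n d t x \<le> depth_one_count n d t' x"
proof (induction n arbitrary: d t t' x)
  case (Suc n)
  then have "depth_one_count n e (t - fst (x [])) y \<le> depth_one_count n e (t' - fst (x [])) y" for e y by simp
  moreover have "(if d = 1 then 1 else 0) \<le> depth_one_count n d (t' - fst (x [])) (branch True x) + m" for m
    by (rule trans_le_add1[OF depth_one_count_ge])
  ultimately show ?case using Suc.prems by (simp add: add_mono)
qed simp

lemma depth_one_count_mono_Suc: "depth_one_count n d t x \<le> depth_one_count (Suc n) d t x"
proof (induction n arbitrary: d t x)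
  case 0 show ?case by (simp)
next
  case (Suc n)
  show ?case
    unfolding depth_one_count.simps(2)[of n d t x] depth_one_count.simps(2)[of "Suc n" d t x]
    by (simp add: add_mono Suc del: depth_one_count.simps)
qed

lemma depth_one_count_incseq: "incseq (\<lambda>n. depth_one_count n d t x)"
  using depth_one_count_mono_Suc by (intro incseq_SucI)

section \<open>The law of the events\<close>
definition unit_exp :: "real measure" where
  "unit_exp = density lborel (\<lambda>x. ennreal (exponential_density 1 x))"

lemma prob_space_unit_exp: "prob_space unit_exp"
  unfolding unit_exp_def by (rule prob_space_exponential_density) simp

lemma sets_unit_exp [measurable_cong, simp]: "sets unit_exp = sets borel"
  by (simp add: unit_exp_def)

lemma space_unit_exp [simp]: "space unit_exp = UNIV"
  by (simp add: unit_exp_def)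

lemma nn_integral_unit_exp:
  assumes [measurable]: "g \<in> borel_measurable borel"
  shows "(\<integral>\<^sup>+x. g x \<partial>unit_exp) = (\<integral>\<^sup>+x. ennreal (exp (- x)) * indicator {0..} x * g x \<partial>lborel)"
  unfolding unit_exp_def
  by (subst nn_integral_density)
     (auto intro!: nn_integral_cong simp: exponential_density_def split: split_indicator)

lemma unit_exp_memoryless:
  assumes [measurable]: "g \<in> borel_measurable borel" and h: "0 \<le> h"
  shows "(\<integral>\<^sup>+x. g x * indicator {h..} x \<partial>unit_exp) = ennreal (exp (- h)) * (\<integral>\<^sup>+x. g (x + h) \<partial>unit_exp)"
proof -
  have "(\<integral>\<^sup>+x. g x * indicator {h..} x \<partial>unit_exp)
      = (\<integral>\<^sup>+x. ennreal (exp (- x)) * indicator {0..} x * (g x * indicator {h..} x) \<partial>lborel)"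
    by (subst nn_integral_unit_exp) auto
  also have "\<dots> = (\<integral>\<^sup>+x. ennreal (exp (- (h + 1 * x))) * indicator {0..} (h + 1 * x) * (g (h + 1 * x) * indicator {h..} (h + 1 * x)) \<partial>lborel)"
    by (subst nn_integral_real_affine[where c=1 and t=h]) auto
  also have "\<dots> = (\<integral>\<^sup>+x. ennreal (exp (- h)) * (ennreal (exp (- x)) * indicator {0..} x * g (x + h)) \<partial>lborel)"
  proof (intro nn_integral_cong)
    fix x :: real
    have "ennreal (exp (- (h + 1 * x))) = ennreal (exp (- h)) * ennreal (exp (- x))"
      by (subst ennreal_mult[symmetric]) (simp_all flip: exp_add)
    then show "ennreal (exp (- (h + 1 * x))) * indicator {0..} (h + 1 * x) * (g (h + 1 * x) * indicator {h..} (h + 1 * x))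
        = ennreal (exp (- h)) * (ennreal (exp (- x)) * indicator {0..} x * g (x + h))"
      using h by (cases "0 \<le> x") (simp_all add: mult.assoc add.commute)
  qed
  also have "\<dots> = ennreal (exp (- h)) * (\<integral>\<^sup>+x. ennreal (exp (- x)) * indicator {0..} x * g (x + h) \<partial>lborel)"
    by (subst nn_integral_cmult) auto
  also have "(\<integral>\<^sup>+x. ennreal (exp (- x)) * indicator {0..} x * g (x + h) \<partial>lborel) = (\<integral>\<^sup>+x. g (x + h) \<partial>unit_exp)"
    by (subst nn_integral_unit_exp) auto
  finally show ?thesis .
qed

lemma nn_integral_unit_exp_const: "(\<integral>\<^sup>+x. c \<partial>unit_exp) = c"
proof -
  interpret prob_space unit_exp by (rule prob_space_unit_exp)
  show ?thesis using emeasure_space_1 by simp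
qed

lemma unit_exp_tail: "0 \<le> h \<Longrightarrow> emeasure unit_exp {h..} = ennreal (exp (- h))"
  using unit_exp_memoryless[of "\<lambda>_. 1" h] nn_integral_unit_exp_const[of 1] by simp

lemma unit_exp_head: assumes "0 \<le> h" shows "emeasure unit_exp {..<h} = ennreal (1 - exp (- h))"
proof -
  interpret prob_space unit_exp by (rule prob_space_unit_exp)
  have "emeasure unit_exp (space unit_exp - {h..}) = emeasure unit_exp (space unit_exp) - emeasure unit_exp {h..}"
    by (intro emeasure_compl) auto
  moreover have "space unit_exp - {h..} = {..<h}" by auto
  ultimately show ?thesis
    using unit_exp_tail[OF assms] assms emeasure_space_1
    by (simp add: ennreal_minus ennreal_1[symmetric] del: ennreal_1)
qed

lemma unit_exp_AE_nonneg: "AE x in unit_exp. 0 \<le> x"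
  unfolding unit_exp_def by (subst AE_density) (auto simp: exponential_density_def)

lemma unit_exp_moment:
  assumes "c < 1" shows "(\<integral>\<^sup>+x. ennreal (exp (c * x)) \<partial>unit_exp) = ennreal (1 / (1 - c))"
proof -
  have "(\<integral>\<^sup>+x. ennreal (exp (c * x)) \<partial>unit_exp)
     = (\<integral>\<^sup>+x. ennreal (exp (- ((1 - c) * x))) * indicator {0..} x \<partial>lborel)"
  proof (subst nn_integral_unit_exp)
    have "ennreal (exp (- x)) * ennreal (exp (c * x)) = ennreal (exp (- ((1 - c) * x)))" for x
      by (subst ennreal_mult[symmetric]) (simp_all add: algebra_simps flip: exp_add)
    then show "(\<integral>\<^sup>+x. ennreal (exp (- x)) * indicator {0..} x * ennreal (exp (c * x)) \<partial>lborel)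
       = (\<integral>\<^sup>+x. ennreal (exp (- ((1 - c) * x))) * indicator {0..} x \<partial>lborel)"
      by (intro nn_integral_cong) (simp split: split_indicator)
  qed simp
  also have "\<dots> = ennreal (0 * (- 1 / (1 - c)) - (exp (- ((1 - c) * 0)) * (- 1 / (1 - c))))"
  proof (rule nn_integral_FTC_atLeast[where F="\<lambda>x. exp (- ((1 - c) * x)) * (- 1 / (1 - c))"])
    show "((\<lambda>x. exp (- ((1 - c) * x)) * (- 1 / (1 - c))) \<longlongrightarrow> 0 * (- 1 / (1 - c))) at_top"
    proof -
      have "filterlim (\<lambda>x. (1 - c) * x) at_top at_top"
        by (rule filterlim_tendsto_pos_mult_at_top[OF tendsto_const _ filterlim_ident]) (use assms in simp)
      then have "filterlim (\<lambda>x. - ((1 - c) * x)) at_bot at_top" by (simp add: filterlim_uminus_at_bot)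
      from filterlim_compose[OF exp_at_bot this]
      show ?thesis by (intro tendsto_mult tendsto_const)
    qed
    show "((\<lambda>x. exp (- ((1 - c) * x)) * (- 1 / (1 - c))) has_real_derivative exp (- ((1 - c) * x))) (at x)" for x
    proof -
      have "- (1 - c) * (- 1 / (1 - c)) = 1" using assms by (simp add: field_simps)
      then have "exp (- ((1 - c) * x)) * (- (1 - c)) * (- 1 / (1 - c)) = exp (- ((1 - c) * x))"
        by (simp only: mult.assoc mult_1_right)
      moreover have "((\<lambda>x. exp (- ((1 - c) * x)) * (- 1 / (1 - c))) has_real_derivative
          exp (- ((1 - c) * x)) * (- (1 - c)) * (- 1 / (1 - c))) (at x)"
        by (intro DERIV_cmult_right) (auto intro!: derivative_eq_intros)
      ultimately show ?thesis by simp
    qed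
  qed auto
  finally show ?thesis by simp
qed

text \<open>
  If \<open>w\<close> is the time of the first event, then \<open>G(t) = e\<^bsup>-t\<^esup> G(0) + \<integral>\<^bsub>0\<^esub>\<^bsup>t\<^esup> e\<^bsup>-w\<^esup> (G + G')(t - w) dw\<close>. So a
  function \<open>G\<close> is a supersolution of a first-event recursion as soon as \<open>G + G'\<close> dominates what
  happens after the event.
\<close>
lemma first_event_integral:
  fixes G G' :: "real \<Rightarrow> real"
  assumes deriv: "\<And>u. (G has_real_derivative G' u) (at u)"
    and [measurable]: "G' \<in> borel_measurable borel"
    and pos: "\<And>u. 0 \<le> G u + G' u" and t: "0 \<le> t" and c: "0 \<le> c" "c \<le> G 0"
  shows "(\<integral>\<^sup>+w. ennreal (if w \<le> t then G (t - w) + G' (t - w) else c) \<partial>unit_exp) \<le> ennreal (G t)"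
proof -
  have [measurable]: "G \<in> borel_measurable borel"
    using deriv by (intro borel_measurable_continuous_onI) (auto intro!: continuous_at_imp_continuous_on DERIV_isCont)
  have "(\<integral>\<^sup>+w. ennreal (if w \<le> t then G (t - w) + G' (t - w) else c) \<partial>unit_exp)
     = (\<integral>\<^sup>+w. ennreal (exp (- w)) * indicator {0..} w * ennreal (if w \<le> t then G (t - w) + G' (t - w) else c) \<partial>lborel)"
    by (subst nn_integral_unit_exp) auto
  also have "\<dots> \<le> (\<integral>\<^sup>+w. ennreal (exp (- w) * (G (t - w) + G' (t - w))) * indicator {0..t} w
       + ennreal c * (ennreal (exp (- w)) * indicator {0..} w * indicator {t..} w) \<partial>lborel)"
    using pos c by (intro nn_integral_mono) (auto split: split_indicator simp: ennreal_mult mult.commute)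
  also have "\<dots> = (\<integral>\<^sup>+w. ennreal (exp (- w) * (G (t - w) + G' (t - w))) * indicator {0..t} w \<partial>lborel)
       + ennreal c * (\<integral>\<^sup>+w. ennreal (exp (- w)) * indicator {0..} w * indicator {t..} w \<partial>lborel)"
    by (subst nn_integral_add) (auto simp: nn_integral_cmult)
  also have "(\<integral>\<^sup>+w. ennreal (exp (- w)) * indicator {0..} w * indicator {t..} w \<partial>lborel) = ennreal (exp (- t))"
    using unit_exp_tail[OF t] nn_integral_unit_exp[of "indicator {t..}"] by simp
  also have "(\<integral>\<^sup>+w. ennreal (exp (- w) * (G (t - w) + G' (t - w))) * indicator {0..t} w \<partial>lborel)
     = ennreal (- exp (- t) * G (t - t) - (- exp (- 0) * G (t - 0)))"
  proof (rule nn_integral_FTC_Icc[where F="\<lambda>w. - exp (- w) * G (t - w)"])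
    fix x assume "x \<in> {0..t}"
    have "((\<lambda>w. G (t - w)) has_real_derivative G' (t - x) * (- 1)) (at x)"
      by (rule DERIV_chain'[where f="\<lambda>w. t - w", OF _ deriv]) (auto intro!: derivative_eq_intros)
    moreover have "((\<lambda>w. - exp (- w)) has_real_derivative exp (- x)) (at x)"
      by (auto intro!: derivative_eq_intros)
    ultimately have "((\<lambda>w. - exp (- w) * G (t - w)) has_real_derivative
        exp (- x) * G (t - x) + G' (t - x) * - 1 * - exp (- x)) (at x)"
      by (rule DERIV_mult[rotated])
    moreover have "exp (- x) * G (t - x) + G' (t - x) * - 1 * - exp (- x) = exp (- x) * (G (t - x) + G' (t - x))"
      by (simp add: distrib_left mult.commute)
    ultimately show "((\<lambda>w. - exp (- w) * G (t - w)) has_real_derivative exp (- x) * (G (t - x) + G' (t - x))) (at x)"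
      by simp
  qed (use pos t in auto)
  also have "\<dots> + ennreal c * ennreal (exp (- t)) \<le> ennreal (G t)"
  proof -
    have "ennreal (G t - exp (- t) * G 0) + ennreal (c * exp (- t)) \<le> ennreal (G t - exp (- t) * G 0) + ennreal (exp (- t) * G 0)"
      using c by (intro add_left_mono ennreal_leI) (auto simp: mult.commute)
    also have "\<dots> = ennreal (G t)"
    proof -
      have "0 \<le> (G t - exp (- t) * G 0)"
      proof -
        have "exp 0 * G 0 \<le> exp t * G t"
        proof (rule DERIV_nonneg_imp_nondecreasing[OF t])
          fix x
          have "((\<lambda>u. exp u * G u) has_real_derivative exp x * G x + G' x * exp x) (at x)"
            by (rule DERIV_mult[OF DERIV_exp deriv])
          moreover have "0 \<le> exp x * (G x + G' x)" using pos by simp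
          ultimately show "\<exists>y. ((\<lambda>u. exp u * G u) has_real_derivative y) (at x) \<and> 0 \<le> y"
            by (auto simp: algebra_simps)
        qed
        then have "exp (- t) * G 0 \<le> exp (- t) * (exp t * G t)" by simp
        also have "exp (- t) * (exp t * G t) = G t" by (simp flip: exp_add mult.assoc)
        finally show ?thesis by simp
      qed
      moreover have "0 \<le> exp (- t) * G 0" using c by auto
      ultimately show ?thesis by (simp flip: ennreal_plus)
    qed
    finally show ?thesis using c by (simp add: ennreal_mult)
  qed
  finally show ?thesis .
qed

definition event_law :: "nat pmf \<Rightarrow> (real \<times> nat) measure" where
  "event_law p = unit_exp \<Otimes>\<^sub>M measure_pmf p"

definition events_law :: "nat pmf \<Rightarrow> events measure" where
  "events_law p = Pi\<^sub>M UNIV (\<lambda>_. event_law p)"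

lemma prob_space_event_law: "prob_space (event_law p)"
proof -
  interpret E: prob_space unit_exp by (rule prob_space_unit_exp)
  interpret P: pair_prob_space unit_exp "measure_pmf p" ..
  show ?thesis unfolding event_law_def by unfold_locales
qed

lemma prob_space_events_law: "prob_space (events_law p)"
  unfolding events_law_def by (intro prob_space_PiM prob_space_event_law)

lemma sets_event_law [measurable_cong]: "sets (event_law p) = sets (borel \<Otimes>\<^sub>M count_space UNIV)"
  unfolding event_law_def by (intro sets_pair_measure_cong) auto

lemma sets_events_law [measurable_cong]: "sets (events_law p) = sets (Pi\<^sub>M UNIV (\<lambda>_. borel \<Otimes>\<^sub>M count_space UNIV))"
  unfolding events_law_def by (intro sets_PiM_cong sets_event_law) auto

lemma space_event_law: "space (event_law p) = UNIV"
  by (simp add: event_law_def space_pair_measure)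

lemma space_events_law: "space (events_law p) = UNIV"
  by (simp add: events_law_def space_PiM space_event_law)

abbreviation split_law :: "nat pmf \<Rightarrow> ((real \<times> nat) \<times> events \<times> events) measure" where
  "split_law p \<equiv> event_law p \<Otimes>\<^sub>M events_law p \<Otimes>\<^sub>M events_law p"

abbreviation timed_law :: "nat pmf \<Rightarrow> (real \<times> events) measure" where
  "timed_law p \<equiv> borel \<Otimes>\<^sub>M events_law p"

abbreviation law_integral :: "nat pmf \<Rightarrow> (events \<Rightarrow> ennreal) \<Rightarrow> ennreal" where
  "law_integral p g \<equiv> integral\<^sup>N (events_law p) g"

abbreviation law_measure :: "nat pmf \<Rightarrow> (events \<Rightarrow> bool) \<Rightarrow> ennreal" where
  "law_measure p P \<equiv> emeasure (events_law p) {x \<in> space (events_law p). P x}"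

abbreviation after_event_prod ::
    "nat pmf \<Rightarrow> (nat \<Rightarrow> real \<Rightarrow> events \<Rightarrow> ennreal) \<Rightarrow> nat \<Rightarrow> real \<Rightarrow> ennreal" where
  "after_event_prod p A d s \<equiv> law_integral p (A d s)
     * (\<integral>\<^sup>+z. (if z \<le> d then law_integral p (A (Suc d - z) s) else 1) \<partial>measure_pmf p)"

abbreviation after_event_sum ::
    "nat pmf \<Rightarrow> (nat \<Rightarrow> real \<Rightarrow> events \<Rightarrow> ennreal) \<Rightarrow> nat \<Rightarrow> real \<Rightarrow> ennreal" where
  "after_event_sum p A d s \<equiv> law_integral p (A d s)
     + (\<integral>\<^sup>+z. (if z \<le> d then law_integral p (A (Suc d - z) s) else 0) \<partial>measure_pmf p)"

fun join_events :: "real \<times> nat \<Rightarrow> events \<Rightarrow> events \<Rightarrow> events" where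
  "join_events e a b [] = e"
| "join_events e a b (True # l) = a l"
| "join_events e a b (False # l) = b l"

lemma join_events_Cons:
  "branch True (join_events e a b) = a" "branch False (join_events e a b) = b"
  by (auto simp: fun_eq_iff branch_def)

lemma measurable_join_events [measurable]:
  "(\<lambda>(e, a, b). join_events e a b) \<in> split_law p \<rightarrow>\<^sub>M events_law p"
proof -
  have "(\<lambda>y l. join_events (fst y) (fst (snd y)) (snd (snd y)) l)
     \<in> split_law p \<rightarrow>\<^sub>M Pi\<^sub>M UNIV (\<lambda>_. event_law p)"
  proof (rule measurable_PiM_single')
    fix l :: "bool list"
    have c: "(\<lambda>x. x l) \<in> events_law p \<rightarrow>\<^sub>M event_law p" for l
      unfolding events_law_def by simp
    show "(\<lambda>y. join_events (fst y) (fst (snd y)) (snd (snd y)) l) \<in> split_law p \<rightarrow>\<^sub>M event_law p"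
    proof (cases l)
      case (Cons c' l')
      then show ?thesis
        by (cases c') (auto intro!: measurable_compose[OF _ c])
    qed simp
  qed (auto simp: space_event_law)
  then show ?thesis by (simp add: events_law_def split_beta')
qed

text \<open>
  The first event, the continuation and the process of the child are independent, and the latter two
  are distributed like the whole process.
\<close>
lemma distr_join_events:
  "distr (split_law p) (events_law p) (\<lambda>(e, a, b). join_events e a b) = events_law p"
  (is "distr ?P _ ?f = _")
proof -
  interpret E: prob_space "event_law p" by (rule prob_space_event_law)
  interpret Q: prob_space "events_law p" by (rule prob_space_events_law)
  interpret QQ: pair_prob_space "events_law p" "events_law p" ..
  interpret EQQ: pair_prob_space "event_law p" "events_law p \<Otimes>\<^sub>M events_law p" ..
  interpret PP: product_prob_space "\<lambda>_::bool list. event_law p" UNIV ..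
  let ?I = "UNIV :: bool list set" and ?M = "\<lambda>_::bool list. event_law p"
  have "distr ?P (Pi\<^sub>M ?I ?M) ?f = Pi\<^sub>M ?I ?M"
  proof (rule PP.PiM_eq)
    fix J F assume J: "finite J" "J \<subseteq> ?I" "\<And>j. j \<in> J \<Longrightarrow> F j \<in> sets (event_law p)"
    let ?X = "prod_emb ?I ?M J (\<Pi>\<^sub>E j\<in>J. F j)"
    let ?E = "if [] \<in> J then F [] else space (event_law p)"
    let ?A = "\<lambda>c. prod_emb ?I ?M (Cons c -` J) (\<Pi>\<^sub>E l\<in>Cons c -` J. F (c # l))"
    have fin: "finite (Cons c -` J)" for c using J by (intro finite_vimageI) (auto simp: inj_on_def)
    have X: "?f -` ?X \<inter> space ?P = ?E \<times> ?A True \<times> ?A False"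
    proof -
      have "join_events e a b \<in> ?X \<longleftrightarrow> e \<in> ?E \<and> a \<in> ?A True \<and> b \<in> ?A False" for e a b
      proof -
        have "join_events e a b \<in> ?X \<longleftrightarrow> (\<forall>j\<in>J. join_events e a b j \<in> F j)"
          by (auto simp: prod_emb_def space_event_law PiE_iff)
        also have "\<dots> \<longleftrightarrow> ([] \<in> J \<longrightarrow> e \<in> F []) \<and> (\<forall>l. True # l \<in> J \<longrightarrow> a l \<in> F (True # l)) \<and> (\<forall>l. False # l \<in> J \<longrightarrow> b l \<in> F (False # l))"
        proof (intro iffI ballI)
          assume *: "([] \<in> J \<longrightarrow> e \<in> F []) \<and> (\<forall>l. True # l \<in> J \<longrightarrow> a l \<in> F (True # l)) \<and> (\<forall>l. False # l \<in> J \<longrightarrow> b l \<in> F (False # l))"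
          fix j assume "j \<in> J" then show "join_events e a b j \<in> F j"
            using * by (cases "(e, a, b, j)" rule: join_events.cases) auto
        qed force
        also have "\<dots> \<longleftrightarrow> e \<in> ?E \<and> a \<in> ?A True \<and> b \<in> ?A False"
          by (auto simp: prod_emb_def space_event_law PiE_iff)
        finally show ?thesis .
      qed
      then show ?thesis by (auto simp: space_pair_measure space_event_law space_events_law)
    qed
    have mA: "?A c \<in> sets (events_law p)" for c
      unfolding events_law_def using J fin by (intro sets_PiM_I) auto
    have mE: "?E \<in> sets (event_law p)" using J by auto
    have eA: "emeasure (events_law p) (?A c) = (\<Prod>l\<in>Cons c -` J. emeasure (event_law p) (F (c # l)))" for c
      unfolding events_law_def using J fin by (intro PP.emeasure_PiM_emb) auto
    have mf: "?f \<in> ?P \<rightarrow>\<^sub>M Pi\<^sub>M ?I ?M" using measurable_join_events[of p] by (simp add: events_law_def)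
    have mX: "?X \<in> sets (Pi\<^sub>M ?I ?M)" using J by (intro sets_PiM_I) auto
    have "emeasure (distr ?P (Pi\<^sub>M ?I ?M) ?f) ?X = emeasure ?P (?E \<times> ?A True \<times> ?A False)"
      using X by (simp add: emeasure_distr[OF mf mX])
    also have "\<dots> = emeasure (event_law p) ?E * (emeasure (events_law p) (?A True) * emeasure (events_law p) (?A False))"
      using mA mE by (subst QQ.P.emeasure_pair_measure_Times Q.emeasure_pair_measure_Times; auto)+
    also have "emeasure (event_law p) ?E = (\<Prod>j\<in>J \<inter> {[]}. emeasure (event_law p) (F j))"
      by (cases "[] \<in> J") (auto simp: E.emeasure_space_1 space_event_law[symmetric])
    also have "emeasure (events_law p) (?A True) = (\<Prod>j\<in>J \<inter> range (Cons True). emeasure (event_law p) (F j))"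
      unfolding eA by (rule prod.reindex_bij_witness[of _ tl "Cons True"]) auto
    also have "emeasure (events_law p) (?A False) = (\<Prod>j\<in>J \<inter> range (Cons False). emeasure (event_law p) (F j))"
      unfolding eA by (rule prod.reindex_bij_witness[of _ tl "Cons False"]) auto
    also have "(\<Prod>j\<in>J \<inter> {[]}. emeasure (event_law p) (F j)) *
        ((\<Prod>j\<in>J \<inter> range (Cons True). emeasure (event_law p) (F j)) * (\<Prod>j\<in>J \<inter> range (Cons False). emeasure (event_law p) (F j)))
        = (\<Prod>j\<in>J \<inter> {[]} \<union> (J \<inter> range (Cons True) \<union> J \<inter> range (Cons False)). emeasure (event_law p) (F j))"
      using J by (subst prod.union_disjoint; (subst prod.union_disjoint)?; auto)
    also have "J \<inter> {[]} \<union> (J \<inter> range (Cons True) \<union> J \<inter> range (Cons False)) = J"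
    proof -
      have "j \<in> {[]} \<union> (range (Cons True) \<union> range (Cons False))" for j :: "bool list"
        by (cases j; cases "hd j") auto
      then show ?thesis by blast
    qed
    finally show "emeasure (distr ?P (Pi\<^sub>M ?I ?M) ?f) ?X = (\<Prod>j\<in>J. emeasure (event_law p) (F j))" .
  qed simp
  then show ?thesis by (simp add: events_law_def)
qed

lemma nn_integral_events_law:
  assumes g [measurable]: "g \<in> borel_measurable (events_law p)"
  shows "(\<integral>\<^sup>+x. g x \<partial>events_law p) =
    (\<integral>\<^sup>+w. \<integral>\<^sup>+z. \<integral>\<^sup>+a. \<integral>\<^sup>+b. g (join_events (w, z) a b) \<partial>events_law p \<partial>events_law p \<partial>measure_pmf p \<partial>unit_exp)"
proof -
  interpret Q: prob_space "events_law p" by (rule prob_space_events_law)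
  interpret QQ: pair_prob_space "events_law p" "events_law p" ..
  have m: "(\<lambda>y. g (case y of (e, a, b) \<Rightarrow> join_events e a b)) \<in> borel_measurable (split_law p)"
    by (rule measurable_compose[OF measurable_join_events g])
  have m1: "(\<lambda>e. \<integral>\<^sup>+y. g (case y of (a, b) \<Rightarrow> join_events e a b) \<partial>(events_law p \<Otimes>\<^sub>M events_law p)) \<in> borel_measurable (event_law p)"
    using QQ.P.borel_measurable_nn_integral_fst[OF m] by (simp add: split_beta')
  have "(\<integral>\<^sup>+x. g x \<partial>events_law p)
     = (\<integral>\<^sup>+y. g (case y of (e, a, b) \<Rightarrow> join_events e a b) \<partial>(split_law p))"
    by (subst distr_join_events[symmetric], subst nn_integral_distr) auto
  also have "\<dots> = (\<integral>\<^sup>+e. \<integral>\<^sup>+y. g (case y of (a, b) \<Rightarrow> join_events e a b) \<partial>(events_law p \<Otimes>\<^sub>M events_law p) \<partial>event_law p)"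
    using QQ.P.nn_integral_fst[OF m] by simp
  also have "\<dots> = (\<integral>\<^sup>+w. \<integral>\<^sup>+z. \<integral>\<^sup>+y. g (case y of (a, b) \<Rightarrow> join_events (w, z) a b) \<partial>(events_law p \<Otimes>\<^sub>M events_law p) \<partial>measure_pmf p \<partial>unit_exp)"
    using measure_pmf.nn_integral_fst[OF m1[unfolded event_law_def]] unfolding event_law_def by simp
  also have "\<dots> = (\<integral>\<^sup>+w. \<integral>\<^sup>+z. \<integral>\<^sup>+a. \<integral>\<^sup>+b. g (join_events (w, z) a b) \<partial>events_law p \<partial>events_law p \<partial>measure_pmf p \<partial>unit_exp)"
  proof (intro nn_integral_cong)
    fix w z
    have "(\<lambda>y. (\<lambda>y. g (case y of (e, a, b) \<Rightarrow> join_events e a b)) ((w, z), y)) \<in> borel_measurable (events_law p \<Otimes>\<^sub>M events_law p)"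
      by (rule measurable_compose[OF _ m]) (auto simp: space_event_law intro!: measurable_Pair)
    then have "(\<lambda>y. g (case y of (a, b) \<Rightarrow> join_events (w, z) a b)) \<in> borel_measurable (events_law p \<Otimes>\<^sub>M events_law p)"
      by (simp add: split_beta')
    from Q.nn_integral_fst[OF this]
    show "(\<integral>\<^sup>+y. g (case y of (a, b) \<Rightarrow> join_events (w, z) a b) \<partial>(events_law p \<Otimes>\<^sub>M events_law p))
       = (\<integral>\<^sup>+a. \<integral>\<^sup>+b. g (join_events (w, z) a b) \<partial>events_law p \<partial>events_law p)" by simp
  qed
  finally show ?thesis .
qed

lemma measurable_component_events [measurable]: "(\<lambda>x. x l) \<in> events_law p \<rightarrow>\<^sub>M borel \<Otimes>\<^sub>M count_space UNIV"
proof -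
  have "(\<lambda>x. x l) \<in> events_law p \<rightarrow>\<^sub>M event_law p" unfolding events_law_def by simp
  then show ?thesis using sets_event_law[of p] by (simp cong: measurable_cong_sets)
qed

lemma measurable_shift_events [measurable]: "branch c \<in> events_law p \<rightarrow>\<^sub>M events_law p"
proof -
  have "(\<lambda>x l. x (c # l)) \<in> events_law p \<rightarrow>\<^sub>M Pi\<^sub>M UNIV (\<lambda>_. event_law p)"
    by (rule measurable_PiM_single') (auto simp: events_law_def space_event_law)
  then show ?thesis by (simp add: events_law_def branch_def[abs_def])
qed

lemma measurable_first_event_sum:
  fixes A :: "nat \<Rightarrow> real \<Rightarrow> events \<Rightarrow> nat"
  assumes A: "\<And>e. (\<lambda>y. A e (fst y) (snd y)) \<in> timed_law p \<rightarrow>\<^sub>M count_space UNIV"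
  shows "(\<lambda>y. if fst (snd y []) \<le> fst y
      then A d (fst y - fst (snd y [])) (branch True (snd y))
         + (if snd (snd y []) \<le> d then A (Suc d - snd (snd y [])) (fst y - fst (snd y [])) (branch False (snd y)) else 0)
      else c) \<in> timed_law p \<rightarrow>\<^sub>M count_space UNIV"
proof -
  have c: "(\<lambda>y. A e (fst y - fst (snd y [])) (branch c (snd y))) \<in> timed_law p \<rightarrow>\<^sub>M count_space UNIV" for e c
    using measurable_compose[OF _ A[of e], of "\<lambda>y. (fst y - fst (snd y []), branch c (snd y))" "timed_law p"]
    by simp
  have z: "(\<lambda>y. snd (snd y [])) \<in> timed_law p \<rightarrow>\<^sub>M count_space (UNIV :: nat set)" by measurable
  have B: "(\<lambda>y. (\<lambda>z y. if z \<le> d then A (Suc d - z) (fst y - fst (snd y [])) (branch False (snd y)) else 0) (snd (snd y [])) y)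
      \<in> timed_law p \<rightarrow>\<^sub>M count_space UNIV"
    by (rule measurable_compose_countable[OF _ z]) (use c in auto)
  define F where "F = (\<lambda>y. A d (fst y - fst (snd y [])) (branch True (snd y))
     + (if snd (snd y []) \<le> d then A (Suc d - snd (snd y [])) (fst y - fst (snd y [])) (branch False (snd y)) else 0))"
  have F: "F \<in> timed_law p \<rightarrow>\<^sub>M count_space UNIV"
    unfolding F_def by (rule measurable_compose_countable[OF measurable_compose[OF B] c]) simp
  have P: "{y \<in> space (timed_law p). fst (snd y []) \<le> fst y} \<in> sets (timed_law p)" by measurable
  have "(\<lambda>y. if fst (snd y []) \<le> fst y then F y else c) \<in> timed_law p \<rightarrow>\<^sub>M count_space UNIV"
    by (rule measurable_If[OF F _ P]) simp
  then show ?thesis by (simp only: F_def)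
qed

lemma measurable_depth_one_count:
  "(\<lambda>y. depth_one_count n d (fst y) (snd y)) \<in> timed_law p \<rightarrow>\<^sub>M count_space UNIV"
proof (induction n arbitrary: d)
  case (Suc n)
  show ?case unfolding depth_one_count.simps by (rule measurable_first_event_sum[OF Suc])
qed simp

lemma measurable_fixed_time:
  assumes "(\<lambda>y. A (fst y) (snd y)) \<in> timed_law p \<rightarrow>\<^sub>M N"
  shows "A (t :: real) \<in> events_law p \<rightarrow>\<^sub>M N"
  using measurable_compose[OF _ assms, of "\<lambda>x. (t, x)" "events_law p"] by simp

section \<open>A discrete logistic equation\<close>
lemma logistic_step_mono:
  assumes k: "0 \<le> kap" "kap \<le> 1" and w: "\<And>d. 0 \<le> w d" "\<And>d. w d \<le> v d" and v: "\<And>d. v d \<le> 1"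
  shows "w d + kap * (1 - w d) * offspring_sum p w d \<le> v d + kap * (1 - v d) * offspring_sum p v d"
proof -
  let ?O = "offspring_sum p"
  have o: "0 \<le> ?O w d" "?O w d \<le> ?O v d" "?O v d \<le> 1"
    using w v by (auto intro: offspring_sum_nonneg offspring_sum_mono offspring_sum_le)
  have "w d + kap * (1 - w d) * ?O w d \<le> w d + kap * (1 - w d) * ?O v d"
    using k o w(2)[of d] v[of d] by (intro add_left_mono mult_left_mono) auto
  also have "\<dots> \<le> v d + kap * (1 - v d) * ?O v d"
  proof -
    have "kap * ?O v d \<le> 1" using k o by (intro mult_le_one) auto
    then have "0 \<le> (v d - w d) * (1 - kap * ?O v d)" using w(2)[of d] by (intro mult_nonneg_nonneg) auto
    then show ?thesis by (simp add: algebra_simps)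
  qed
  finally show ?thesis .
qed

text \<open>
  As long as \<open>w \<le> \<delta>\<close>, the logistic step dominates the linear one with rate \<open>bet\<close>. The first \<open>N\<close>
  steps spread the initial mass \<open>eps\<close> from depth one to a multiple of
  \<open>phi = \<Sum>\<^bsub>i < N\<^esub> \<theta>\<^bsup>-i\<^esup> walks p i\<close>. Telescoping shows that \<open>phi\<close> is a subeigenvector for \<open>\<theta>\<close> if
  \<open>\<theta>\<^sup>N \<le> walks p N 1\<close>, so from then on the mass grows by the factor \<open>g\<close> in each step until
  it reaches \<open>\<delta>\<close>.
\<close>
lemma logistic_iteration_lower_bound:
  assumes th: "0 < th" "th < 1" and N: "1 \<le> N" "th ^ N \<le> walks p N 1"
    and kap: "0 < kap" "kap \<le> 1" and del: "0 < del" "del < 1"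
    and v: "\<And>m d. 0 \<le> v m d" "\<And>m d. v m d \<le> 1"
    and step: "\<And>m d. v m d + kap * (1 - v m d) * offspring_sum p (v m) d \<le> v (Suc m) d"
    and eps: "0 < eps" "eps \<le> v 0 1" "eps * (real N + 1) \<le> del"
  defines "bet \<equiv> kap * (1 - del)"
  defines "g \<equiv> 1 + bet * th"
  defines "M \<equiv> (\<Sum>i<N. (1 / th) ^ i)"
  shows "\<exists>m. eps * (bet * th) ^ N * g ^ m * M \<le> del \<and> del / (g * M) \<le> v (N + m) 1"
proof -
  have bet: "0 < bet" "bet \<le> 1" "bet \<le> kap" unfolding bet_def using kap del by (auto intro!: mult_le_one)
  have bt: "0 < bet * th" "bet * th \<le> 1" using bet th by (auto intro!: mult_le_one)
  have grow: "w' d \<le> v (Suc m) d"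
    if "\<And>d. 0 \<le> w d" "\<And>d. w d \<le> v m d" "\<And>d. w d \<le> del" "w' d \<le> w d + bet * offspring_sum p w d" for w w' m d
  proof -
    have "bet * offspring_sum p w d \<le> kap * (1 - w d) * offspring_sum p w d"
      unfolding bet_def using that kap by (intro mult_right_mono mult_left_mono offspring_sum_nonneg) auto
    moreover have "w d + kap * (1 - w d) * offspring_sum p w d \<le> v m d + kap * (1 - v m d) * offspring_sum p (v m) d"
      using kap that v by (intro logistic_step_mono) auto
    ultimately show ?thesis using step[of m d] that(4) by linarith
  qed
  \<comment> \<open>Satisfies \<open>a (Suc n) = eps e + bet A (a n)\<close> with the mean matrix \<open>A\<close> and the unit vector \<open>e\<close> at depth one.\<close>
  define a where "a = (\<lambda>n d. eps * (\<Sum>i<Suc n. bet ^ i * walks p i d))"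
  have a_nonneg: "0 \<le> a n d" for n d
    unfolding a_def using eps bet by (intro mult_nonneg_nonneg sum_nonneg) (auto simp: walks_nonneg)
  have a_le: "a n d \<le> eps * (real n + 1)" for n d
  proof -
    have "(\<Sum>i<Suc n. bet ^ i * walks p i d) \<le> (\<Sum>i<Suc n. 1)"
      using bet by (intro sum_mono mult_le_one power_le_one walks_nonneg walks_le_1) auto
    then show ?thesis unfolding a_def using eps by (intro mult_left_mono) auto
  qed
  have phase1: "n \<le> N \<Longrightarrow> a n d \<le> v n d" for n d
  proof (induction n arbitrary: d)
    case 0
    show ?case using eps v(1)[of 0 d] by (auto simp: a_def walks_0)
  next
    case (Suc n)
    have small: "a n d \<le> del" for d
    proof -
      have "eps * (real n + 1) \<le> eps * (real N + 1)" using Suc.prems eps by (intro mult_left_mono) auto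
      then show ?thesis using a_le[of n d] eps by linarith
    qed
    have "a (Suc n) d = eps * walks p 0 d + bet * offspring_sum p (a n) d"
      unfolding a_def offspring_sum_cmult offspring_sum_sum walks_Suc[symmetric]
      by (subst sum.lessThan_Suc_shift) (simp add: sum_distrib_left algebra_simps walks_Suc)
    also have "eps * walks p 0 d \<le> a n d"
      unfolding a_def sum.lessThan_Suc_shift using eps bet
      by (intro mult_left_mono) (auto intro!: sum_nonneg mult_nonneg_nonneg walks_nonneg)
    finally have "a (Suc n) d \<le> a n d + bet * offspring_sum p (a n) d" by simp
    then show ?case using Suc small a_nonneg by (intro grow[where w="a n"]) auto
  qed
  define phi where "phi = (\<lambda>d. \<Sum>i<N. (1 / th) ^ i * walks p i d)"
  have phi_nonneg: "0 \<le> phi d" for d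
    unfolding phi_def using th by (intro sum_nonneg mult_nonneg_nonneg walks_nonneg) auto
  have phi_le: "phi d \<le> M" for d
    unfolding phi_def M_def using th walks_le_1
    by (intro sum_mono mult_left_le) auto
  have phi_1: "1 \<le> phi 1"
  proof -
    have "(\<Sum>i\<in>{0}. (1 / th) ^ i * walks p i 1) \<le> phi 1"
      unfolding phi_def using N th by (intro sum_mono2) (auto intro!: mult_nonneg_nonneg walks_nonneg)
    then show ?thesis by (simp add: walks_0)
  qed
  have M1: "1 \<le> M" using phi_1 phi_le[of 1] by linarith
  have phi_eig: "th * phi d \<le> offspring_sum p phi d" for d
  proof -
    have "offspring_sum p phi d = (\<Sum>i<N. (1 / th) ^ i * walks p (Suc i) d)"
      unfolding phi_def offspring_sum_sum offspring_sum_cmult walks_Suc ..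
    also have "\<dots> = th * (\<Sum>i<N. (1 / th) ^ Suc i * walks p (Suc i) d)"
      using th by (simp add: sum_distrib_left)
    also have "(\<Sum>i<N. (1 / th) ^ Suc i * walks p (Suc i) d) = phi d + (1 / th) ^ N * walks p N d - walks p 0 d"
    proof -
      have "(\<Sum>i<Suc N. (1 / th) ^ i * walks p i d) = phi d + (1 / th) ^ N * walks p N d" by (simp add: phi_def)
      then show ?thesis unfolding sum.lessThan_Suc_shift by simp
    qed
    finally have eq: "offspring_sum p phi d = th * (phi d + (1 / th) ^ N * walks p N d - walks p 0 d)" .
    have "walks p 0 d \<le> (1 / th) ^ N * walks p N d"
    proof (cases "d = 1")
      case True
      have "(1 / th) ^ N * th ^ N \<le> (1 / th) ^ N * walks p N 1" using N th by (intro mult_left_mono) auto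
      then show ?thesis using True th by (simp add: walks_0 power_divide)
    qed (use th in \<open>auto simp: walks_0 walks_nonneg\<close>)
    then show ?thesis unfolding eq using th by (intro mult_left_mono) auto
  qed
  define c where "c = (bet * th) ^ N"
  have c: "0 < c" unfolding c_def using bt by simp
  have c_le: "c * (1 / th) ^ i \<le> bet ^ i" if "i < N" for i
  proof -
    have "c * (1 / th) ^ i \<le> (bet * th) ^ i * (1 / th) ^ i"
      unfolding c_def using that bt th by (intro mult_right_mono power_decreasing) auto
    also have "\<dots> = bet ^ i" using th by (simp add: power_mult_distrib power_divide)
    finally show ?thesis .
  qed
  have start: "eps * c * phi d \<le> v N d" for d
  proof -
    have "c * phi d \<le> (\<Sum>i<Suc N. bet ^ i * walks p i d)"
    proof -
      have "c * phi d = (\<Sum>i<N. c * ((1 / th) ^ i * walks p i d))" by (simp add: phi_def sum_distrib_left)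
      also have "\<dots> \<le> (\<Sum>i<N. bet ^ i * walks p i d)"
      proof (rule sum_mono)
        fix i assume i: "i \<in> {..<N}"
        show "c * ((1 / th) ^ i * walks p i d) \<le> bet ^ i * walks p i d"
          using mult_right_mono[of "c * (1 / th) ^ i" "bet ^ i" "walks p i d"] walks_nonneg[of p i d] c_le[of i] i
          by (simp add: mult.assoc)
      qed
      also have "\<dots> \<le> (\<Sum>i<Suc N. bet ^ i * walks p i d)" using bet by (simp add: walks_nonneg)
      finally show ?thesis .
    qed
    then have "eps * c * phi d \<le> a N d" unfolding a_def using eps by simp
    then show ?thesis using phase1[of N d] by simp
  qed
  have g1: "1 < g" unfolding g_def using bt by simp
  have phase2: "(\<And>j. j < m \<Longrightarrow> eps * c * g ^ j * M \<le> del) \<Longrightarrow> eps * c * g ^ m * phi d \<le> v (N + m) d" for m d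
  proof (induction m arbitrary: d)
    case 0 then show ?case using start[of d] by simp
  next
    case (Suc m)
    let ?w = "\<lambda>d. eps * c * g ^ m * phi d"
    have pos: "0 \<le> eps * c * g ^ m" using eps c g1 by simp
    have IH: "?w d \<le> v (N + m) d" for d using Suc.IH Suc.prems by simp
    have small: "?w d \<le> del" for d
    proof -
      have "?w d \<le> eps * c * g ^ m * M" using pos phi_le by (intro mult_left_mono) auto
      then show ?thesis using Suc.prems[of m] by simp
    qed
    have "eps * c * g ^ Suc m * phi d = ?w d + bet * (eps * c * g ^ m * (th * phi d))"
      by (simp add: g_def algebra_simps)
    also have "\<dots> \<le> ?w d + bet * (eps * c * g ^ m * offspring_sum p phi d)"
      using pos bet phi_eig by (intro add_left_mono mult_left_mono) auto
    finally have "eps * c * g ^ Suc m * phi d \<le> ?w d + bet * offspring_sum p ?w d"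
      by (simp add: offspring_sum_cmult)
    then have "eps * c * g ^ Suc m * phi d \<le> v (Suc (N + m)) d"
      using IH small pos phi_nonneg by (intro grow[where w="?w"]) auto
    then show ?case by simp
  qed
  have cM: "eps * c * M \<le> del"
  proof -
    have "c * M = (\<Sum>i<N. c * (1 / th) ^ i)" by (simp add: M_def sum_distrib_left)
    also have "\<dots> \<le> (\<Sum>i<N. 1)"
    proof (rule sum_mono)
      fix i assume i: "i \<in> {..<N}"
      have "c * (1 / th) ^ i \<le> bet ^ i" using c_le i by simp
      also have "\<dots> \<le> 1" using bet by (intro power_le_one) auto
      finally show "c * (1 / th) ^ i \<le> 1" .
    qed
    finally have "c * M \<le> real N + 1" by simp
    then have "eps * (c * M) \<le> eps * (real N + 1)" using eps by (intro mult_left_mono) auto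
    then show ?thesis unfolding mult.assoc using eps(3) by (rule order_trans)
  qed
  have "\<exists>m. \<not> eps * c * g ^ m * M \<le> del"
  proof -
    obtain m where "del / (eps * c * M) < g ^ m" using real_arch_pow[OF g1] by blast
    then show ?thesis using eps c M1 by (intro exI[of _ m]) (simp add: field_simps not_le)
  qed
  then obtain m where m: "\<not> eps * c * g ^ m * M \<le> del" "\<And>j. j < m \<Longrightarrow> eps * c * g ^ j * M \<le> del"
    using exists_least_iff[of "\<lambda>m. \<not> eps * c * g ^ m * M \<le> del"] by blast
  then obtain n where n: "m = Suc n" using cM by (cases m) auto
  have "eps * c * g ^ n * 1 \<le> eps * c * g ^ n * phi 1"
    using phi_1 eps c g1 by (intro mult_left_mono) auto
  also have "\<dots> \<le> v (N + n) 1" using m n by (intro phase2) auto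
  finally have "eps * c * g ^ n \<le> v (N + n) 1" by simp
  moreover have "del / (g * M) \<le> eps * c * g ^ n"
    using m(1) n g1 M1 by (simp add: field_simps)
  ultimately show ?thesis using m(2)[of n] n unfolding c_def by (intro exI[of _ n]) auto
qed

section \<open>Exponential moments\<close>
lemma nn_integral_pmf_truncated:
  fixes g :: "nat \<Rightarrow> real"
  assumes "\<And>z. 0 \<le> g z"
  shows "(\<integral>\<^sup>+z. ennreal (if z \<le> d then g z else 0) \<partial>measure_pmf p) = ennreal (\<Sum>z\<le>d. pmf p z * g z)"
proof -
  have "(\<integral>\<^sup>+z. ennreal (if z \<le> d then g z else 0) \<partial>measure_pmf p)
      = (\<Sum>z\<in>{..d}. ennreal (if z \<le> d then g z else 0) * ennreal (pmf p z))"
    by (rule nn_integral_measure_pmf_support) auto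
  also have "\<dots> = (\<Sum>z\<in>{..d}. ennreal (pmf p z * g z))"
    using assms by (intro sum.cong) (auto simp: ennreal_mult mult.commute)
  also have "\<dots> = ennreal (\<Sum>z\<le>d. pmf p z * g z)"
    using assms by (intro sum_ennreal) auto
  finally show ?thesis .
qed

lemma nn_integral_pmf_one_plus:
  fixes g :: "nat \<Rightarrow> real"
  assumes "\<And>z. 0 \<le> g z"
  shows "(\<integral>\<^sup>+z. ennreal (if z \<le> d then g z else 1) \<partial>measure_pmf p) = ennreal (1 + (\<Sum>z\<le>d. pmf p z * (g z - 1)))"
proof -
  let ?S = "ennreal (\<Sum>z\<le>d. pmf p z)"
  have "(\<integral>\<^sup>+z. ennreal (if z \<le> d then g z else 1) \<partial>measure_pmf p) + ?S
     = (\<integral>\<^sup>+z. ennreal (if z \<le> d then g z else 1) \<partial>measure_pmf p) + (\<integral>\<^sup>+z. ennreal (if z \<le> d then 1 else 0) \<partial>measure_pmf p)"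
    by (subst nn_integral_pmf_truncated) auto
  also have "\<dots> = (\<integral>\<^sup>+z. ennreal (if z \<le> d then g z else 1) + ennreal (if z \<le> d then 1 else 0) \<partial>measure_pmf p)"
    by (subst nn_integral_add) auto
  also have "\<dots> = (\<integral>\<^sup>+z. 1 + ennreal (if z \<le> d then g z else 0) \<partial>measure_pmf p)"
    by (intro nn_integral_cong) auto
  also have "\<dots> = 1 + (\<integral>\<^sup>+z. ennreal (if z \<le> d then g z else 0) \<partial>measure_pmf p)"
    by (subst nn_integral_add) (auto simp: measure_pmf.emeasure_space_1[simplified])
  also have "\<dots> = 1 + ennreal (\<Sum>z\<le>d. pmf p z * g z)"
    using assms by (subst nn_integral_pmf_truncated) auto
  also have "\<dots> = ennreal (1 + (\<Sum>z\<le>d. pmf p z * (g z - 1))) + ?S"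
  proof -
    have e: "1 + (\<Sum>z\<le>d. pmf p z * (g z - 1)) + (\<Sum>z\<le>d. pmf p z) = 1 + (\<Sum>z\<le>d. pmf p z * g z)"
      by (simp add: algebra_simps flip: sum.distrib)
    have "(\<Sum>z\<le>d. pmf p z * g z) \<ge> 0" using assms by (intro sum_nonneg) auto
    moreover have "(\<Sum>z\<le>d. pmf p z) \<le> 1" by (rule pmf_sum_le_1) simp
    ultimately have "0 \<le> 1 + (\<Sum>z\<le>d. pmf p z * (g z - 1))" "0 \<le> (\<Sum>z\<le>d. pmf p z)" "0 \<le> (\<Sum>z\<le>d. pmf p z * g z)"
      using e by (auto intro: sum_nonneg)
    then have "ennreal (1 + (\<Sum>z\<le>d. pmf p z * (g z - 1))) + ?S = ennreal (1 + (\<Sum>z\<le>d. pmf p z * g z))"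
      unfolding e[symmetric] by (intro ennreal_plus[symmetric])
    then show ?thesis using \<open>0 \<le> (\<Sum>z\<le>d. pmf p z * g z)\<close> by simp
  qed
  finally show ?thesis by (simp add: add.commute[of _ ?S] ennreal_add_left_cancel)
qed

lemma nn_integral_first_event_prod:
  fixes A :: "nat \<Rightarrow> real \<Rightarrow> events \<Rightarrow> ennreal"
  assumes [measurable]: "G \<in> borel_measurable (events_law p)" "\<And>e s. A e s \<in> borel_measurable (events_law p)"
    and G: "\<And>x. G x = (if fst (x []) \<le> t
       then A d (t - fst (x [])) (branch True x)
          * (if snd (x []) \<le> d then A (Suc d - snd (x [])) (t - fst (x [])) (branch False x) else 1)
       else c)"
  shows "(\<integral>\<^sup>+x. G x \<partial>events_law p) = (\<integral>\<^sup>+w. (if w \<le> t then after_event_prod p A d (t - w) else c) \<partial>unit_exp)"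
proof -
  interpret Q: prob_space "events_law p" by (rule prob_space_events_law)
  show ?thesis
    unfolding nn_integral_events_law[OF assms(1)]
  proof (intro nn_integral_cong)
    fix w
    show "(\<integral>\<^sup>+z. \<integral>\<^sup>+a. \<integral>\<^sup>+b. G (join_events (w, z) a b) \<partial>events_law p \<partial>events_law p \<partial>measure_pmf p)
      = (if w \<le> t then after_event_prod p A d (t - w) else c)"
    proof (cases "w \<le> t")
      case True
      have "(\<integral>\<^sup>+a. \<integral>\<^sup>+b. G (join_events (w, z) a b) \<partial>events_law p \<partial>events_law p)
         = law_integral p (A d (t - w)) * (if z \<le> d then law_integral p (A (Suc d - z) (t - w)) else 1)" for z
        using True by (cases "z \<le> d") (simp_all add: G join_events_Cons Q.emeasure_space_1 nn_integral_cmult nn_integral_multc)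
      then show ?thesis using True by (simp add: nn_integral_cmult)
    next
      case False then show ?thesis by (simp add: G Q.emeasure_space_1 measure_pmf.emeasure_space_1)
    qed
  qed
qed

lemma nn_integral_first_event_sum:
  fixes A :: "nat \<Rightarrow> real \<Rightarrow> events \<Rightarrow> ennreal"
  assumes [measurable]: "G \<in> borel_measurable (events_law p)" "\<And>e s. A e s \<in> borel_measurable (events_law p)"
    and G: "\<And>x. G x = (if fst (x []) \<le> t
       then A d (t - fst (x [])) (branch True x)
          + (if snd (x []) \<le> d then A (Suc d - snd (x [])) (t - fst (x [])) (branch False x) else 0)
       else c)"
  shows "(\<integral>\<^sup>+x. G x \<partial>events_law p) = (\<integral>\<^sup>+w. (if w \<le> t then after_event_sum p A d (t - w) else c) \<partial>unit_exp)"
proof -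
  interpret Q: prob_space "events_law p" by (rule prob_space_events_law)
  show ?thesis
    unfolding nn_integral_events_law[OF assms(1)]
  proof (intro nn_integral_cong)
    fix w
    show "(\<integral>\<^sup>+z. \<integral>\<^sup>+a. \<integral>\<^sup>+b. G (join_events (w, z) a b) \<partial>events_law p \<partial>events_law p \<partial>measure_pmf p)
      = (if w \<le> t then after_event_sum p A d (t - w) else c)"
    proof (cases "w \<le> t")
      case True
      have "(\<integral>\<^sup>+a. \<integral>\<^sup>+b. G (join_events (w, z) a b) \<partial>events_law p \<partial>events_law p)
         = law_integral p (A d (t - w)) + (if z \<le> d then law_integral p (A (Suc d - z) (t - w)) else 0)" for z
        using True by (cases "z \<le> d") (simp_all add: G join_events_Cons Q.emeasure_space_1 nn_integral_add)
      then show ?thesis using True by (simp add: nn_integral_add measure_pmf.emeasure_space_1)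
    next
      case False then show ?thesis by (simp add: G Q.emeasure_space_1 measure_pmf.emeasure_space_1)
    qed
  qed
qed

text \<open>
  The recursion stops where the condition \<open>b\<close> on the depth and the remaining time holds; these
  places are counted.
\<close>
fun exceed_count :: "(nat \<Rightarrow> real \<Rightarrow> bool) \<Rightarrow> nat \<Rightarrow> nat \<Rightarrow> real \<Rightarrow> events \<Rightarrow> nat" where
  "exceed_count b 0 d t x = (if b d t then 1 else 0)"
| "exceed_count b (Suc n) d t x =
    (if b d t then 1
     else if fst (x []) \<le> t
      then exceed_count b n d (t - fst (x [])) (branch True x)
         + (if snd (x []) \<le> d then exceed_count b n (Suc d - snd (x [])) (t - fst (x [])) (branch False x) else 0)
      else 0)"

lemma measurable_exceed_count:
  assumes b: "\<And>d. Measurable.pred borel (b d)"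
  shows "(\<lambda>y. exceed_count b n d (fst y) (snd y)) \<in> timed_law p \<rightarrow>\<^sub>M count_space UNIV"
proof (induction n arbitrary: d)
  case 0
  note [measurable] = b
  show ?case by simp
next
  case (Suc n)
  have P: "{y \<in> space (timed_law p). b d (fst y)} \<in> sets (timed_law p)"
    using b[of d] by measurable
  show ?case unfolding exceed_count.simps
    by (rule measurable_If[OF _ measurable_first_event_sum[OF Suc] P]) simp
qed

lemma exp_le_quadratic: "0 \<le> (x::real) \<Longrightarrow> x \<le> del \<Longrightarrow> del \<le> 1 \<Longrightarrow> exp x \<le> 1 + (1 + del) * x"
  using exp_bound[of x] mult_right_mono[of x del x] by (simp add: power2_eq_square algebra_simps)

lemma offspring_sum_geometric:
  assumes "0 < s" "pgf_summable p s"
  shows "offspring_sum p (\<lambda>e. (1 / s) ^ e) d \<le> pgf p s / s * (1 / s) ^ d"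
proof -
  have "offspring_sum p (\<lambda>e. (1 / s) ^ e) d = (\<Sum>j\<le>d. pmf p j * s ^ j) * (1 / s) ^ Suc d"
    unfolding offspring_sum_def sum_distrib_right
  proof (rule sum.cong)
    fix j assume "j \<in> {..d}"
    then have "s ^ Suc d = s ^ j * s ^ (Suc d - j)" by (simp flip: power_add)
    then show "pmf p j * (1 / s) ^ (Suc d - j) = pmf p j * s ^ j * (1 / s) ^ Suc d"
      using assms(1) by (simp add: power_divide field_simps del: power_Suc)
  qed simp
  also have "\<dots> \<le> pgf p s * (1 / s) ^ Suc d"
    unfolding pgf_def using assms by (intro mult_right_mono sum_le_suminf) auto
  finally show ?thesis by (simp add: field_simps)
qed

text \<open>
  \<open>V\<close> dominates the number of vertices at depth one at time \<open>0\<close>, multiplied by \<open>lam\<close>. The logarithm of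
  the exponential moment from depth \<open>d\<close> grows at the rate \<open>\<Sum>\<^bsub>j \<le> d\<^esub> p\<^sub>j (e\<^bsup>V(d+1-j)\<^esup> - 1)\<close>. When
  \<open>V \<le> \<delta>\<close> this is at most \<open>(1 + \<delta>) (f(s) / s) V\<close>, which the factor \<open>e\<^bsup>\<theta>t\<^esup>\<close> absorbs. A vertex
  with larger \<open>V\<close> contributes nothing to the restricted moment.
\<close>
lemma killed_exponential_moment:
  assumes s: "0 < s" "pgf_summable p s" and th: "(1 + del) * (pgf p s / s) \<le> th"
    and del: "0 < del" "del \<le> 1" and lam: "0 \<le> lam"
  defines "V \<equiv> \<lambda>d t. lam * s * (1 / s) ^ d * exp (th * t)"
  assumes t: "0 \<le> t"
  shows "(\<integral>\<^sup>+x. (if exceed_count (\<lambda>d t. del < V d t) n d t x = 0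
       then ennreal (exp (lam * depth_one_count n d t x)) else 0) \<partial>events_law p)
     \<le> (if del < V d t then 0 else ennreal (exp (V d t)))"
  using t
proof (induction n arbitrary: d t)
  case 0
  interpret Q: prob_space "events_law p" by (rule prob_space_events_law)
  have f: "0 \<le> pgf p s" using s by (intro pgf_nonneg) auto
  have "0 \<le> (1 + del) * (pgf p s / s)" using del s f by (intro mult_nonneg_nonneg) auto
  then have th0: "0 \<le> th" using th by linarith
  have "lam * (if d = 1 then 1 else 0) \<le> V d t"
  proof (cases "d = 1")
    case True
    have "lam * 1 \<le> lam * exp (th * t)" using lam th0 0 by (intro mult_left_mono) auto
    then show ?thesis using True s by (simp add: V_def)
  qed (use lam s in \<open>simp add: V_def\<close>)
  then show ?case by (auto simp: Q.emeasure_space_1)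
next
  case (Suc n)
  interpret Q: prob_space "events_law p" by (rule prob_space_events_law)
  let ?b = "\<lambda>d t. del < V d t"
  define Phi where "Phi = (\<lambda>n d t x. if exceed_count ?b n d t x = 0
       then ennreal (exp (lam * depth_one_count n d t x)) else 0)"
  have f: "0 \<le> pgf p s" using s by (intro pgf_nonneg) auto
  have "0 \<le> (1 + del) * (pgf p s / s)" using del s f by (intro mult_nonneg_nonneg) auto
  then have th0: "0 \<le> th" using th by linarith
  have V0: "0 \<le> V d t" for d t unfolding V_def using lam s by auto
  have b: "Measurable.pred borel (?b d)" for d unfolding V_def by measurable
  have Phi_meas: "Phi n d t \<in> borel_measurable (events_law p)" for n d t
  proof -
    note [measurable] = measurable_fixed_time[OF measurable_depth_one_count, of n d t p]
      measurable_fixed_time[OF measurable_exceed_count[where b="?b" and n=n and d=d and p=p, OF b], where t=t]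
    show ?thesis unfolding Phi_def by measurable
  qed
  show ?case
  proof (cases "?b d t")
    case True then show ?thesis by simp
  next
    case False
    let ?c = "ennreal (exp (lam * (if d = 1 then 1 else 0)))"
    have rec: "Phi (Suc n) d t x = (if fst (x []) \<le> t
       then Phi n d (t - fst (x [])) (branch True x)
          * (if snd (x []) \<le> d then Phi n (Suc d - snd (x [])) (t - fst (x [])) (branch False x) else 1)
       else ?c)" for x
      using False unfolding Phi_def
      by (auto simp: distrib_left exp_add ennreal_mult)
    have "law_integral p (Phi (Suc n) d t) = (\<integral>\<^sup>+w. (if w \<le> t then after_event_prod p (Phi n) d (t - w) else ?c) \<partial>unit_exp)"
      by (rule nn_integral_first_event_prod[OF Phi_meas Phi_meas rec])
    also have "\<dots> \<le> (\<integral>\<^sup>+w. ennreal (if w \<le> t then exp (V d (t - w)) + exp (V d (t - w)) * (th * V d (t - w))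
         else exp (lam * (if d = 1 then 1 else 0))) \<partial>unit_exp)"
    proof (intro nn_integral_mono)
      fix w
      show "(if w \<le> t then after_event_prod p (Phi n) d (t - w) else ?c) \<le> ennreal (if w \<le> t then exp (V d (t - w)) + exp (V d (t - w)) * (th * V d (t - w))
         else exp (lam * (if d = 1 then 1 else 0)))"
      proof (cases "w \<le> t")
        case True
        define u where "u = t - w"
        have u: "0 \<le> u" using True by (simp add: u_def)
        have IH: "law_integral p (Phi n e u) \<le> (if ?b e u then 0 else ennreal (exp (V e u)))" for e
          unfolding Phi_def using Suc.IH[OF u] .
        have small: "law_integral p (Phi n e u) \<le> ennreal (1 + (1 + del) * V e u)" for e
        proof (cases "?b e u")
          case True then show ?thesis using IH[of e] by simp
        next
          case False
          then have "exp (V e u) \<le> 1 + (1 + del) * V e u" using del V0 by (intro exp_le_quadratic) auto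
          then have "ennreal (exp (V e u)) \<le> ennreal (1 + (1 + del) * V e u)" by (rule ennreal_leI)
          moreover have "law_integral p (Phi n e u) \<le> ennreal (exp (V e u))"
            using IH[of e] False by simp
          ultimately show ?thesis by (rule order_trans[rotated])
        qed
        have IHd: "law_integral p (Phi n d u) \<le> ennreal (exp (V d u))"
          using IH[of d] by (auto split: if_splits elim: order_trans)
        have "(\<integral>\<^sup>+z. (if z \<le> d then law_integral p (Phi n (Suc d - z) u) else 1) \<partial>measure_pmf p)
            \<le> (\<integral>\<^sup>+z. ennreal (if z \<le> d then 1 + (1 + del) * V (Suc d - z) u else 1) \<partial>measure_pmf p)"
          using small by (intro nn_integral_mono) auto
        also have "\<dots> = ennreal (1 + (\<Sum>z\<le>d. pmf p z * (1 + (1 + del) * V (Suc d - z) u - 1)))"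
          using V0 del by (intro nn_integral_pmf_one_plus) auto
        also have "(\<Sum>z\<le>d. pmf p z * (1 + (1 + del) * V (Suc d - z) u - 1))
            = (1 + del) * (lam * s * exp (th * u)) * offspring_sum p (\<lambda>e. (1 / s) ^ e) d"
          by (simp add: offspring_sum_def V_def sum_distrib_left mult_ac)
        also have "\<dots> \<le> (1 + del) * (lam * s * exp (th * u)) * (pgf p s / s * (1 / s) ^ d)"
          using del lam s by (intro mult_left_mono offspring_sum_geometric) auto
        also have "\<dots> = (1 + del) * (pgf p s / s) * V d u" by (simp add: V_def mult_ac)
        also have "\<dots> \<le> th * V d u" using th V0 by (intro mult_right_mono) auto
        finally have "(\<integral>\<^sup>+z. (if z \<le> d then law_integral p (Phi n (Suc d - z) u) else 1) \<partial>measure_pmf p)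
            \<le> ennreal (1 + th * V d u)"
          by (simp add: ennreal_leI)
        from mult_mono[OF IHd this]
        have "after_event_prod p (Phi n) d u
          \<le> ennreal (exp (V d u) * (1 + th * V d u))"
          using th0 V0[of d u] by (simp add: ennreal_mult)
        then show ?thesis using True unfolding u_def by (simp add: distrib_left)
      qed auto
    qed
    also have "\<dots> \<le> ennreal (exp (V d t))"
    proof (rule first_event_integral[where G="\<lambda>u. exp (V d u)" and G'="\<lambda>u. exp (V d u) * (th * V d u)"])
      show "((\<lambda>u. exp (V d u)) has_real_derivative exp (V d u) * (th * V d u)) (at u)" for u
        unfolding V_def by (auto intro!: derivative_eq_intros)
      show "(\<lambda>u. exp (V d u) * (th * V d u)) \<in> borel_measurable borel" unfolding V_def by measurable
      show "0 \<le> exp (V d u) + exp (V d u) * (th * V d u)" for u using th0 V0[of d u] by simp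
      show "exp (lam * (if d = 1 then 1 else 0)) \<le> exp (V d 0)" using lam s by (auto simp: V_def)
    qed (use Suc.prems in auto)
    finally show ?thesis using False unfolding Phi_def by simp
  qed
qed

section \<open>The polynomial upper bound\<close>
text \<open>
  The right-hand side is at least one at a violating vertex and grows at a rate that dominates the births.
\<close>
lemma exceed_count_expectation:
  assumes s: "0 < s" "pgf_summable p s" and gam: "pgf p s / s \<le> gam" and K: "0 \<le> K"
    and b: "\<And>d. Measurable.pred borel (b d)"
    and dom: "\<And>d t. 0 \<le> t \<Longrightarrow> b d t \<Longrightarrow> 1 \<le> K * (1 / s) ^ d * exp (gam * t)"
    and t: "0 \<le> t"
  shows "(\<integral>\<^sup>+x. ennreal (real (exceed_count b n d t x)) \<partial>events_law p) \<le> ennreal (K * (1 / s) ^ d * exp (gam * t))"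
  using t
proof (induction n arbitrary: d t)
  case 0
  interpret Q: prob_space "events_law p" by (rule prob_space_events_law)
  show ?case using dom[of t d] 0 by (auto simp: Q.emeasure_space_1)
next
  case (Suc n)
  interpret Q: prob_space "events_law p" by (rule prob_space_events_law)
  define Psi where "Psi = (\<lambda>d t. K * (1 / s) ^ d * exp (gam * t))"
  have f: "0 \<le> pgf p s" using s by (intro pgf_nonneg) auto
  then have gam0: "0 \<le> gam" using gam s by (meson divide_nonneg_pos order_trans)
  have Psi0: "0 \<le> Psi d t" for d t unfolding Psi_def using K s by auto
  define E where "E = (\<lambda>n d t x. ennreal (real (exceed_count b n d t x)))"
  have E_meas: "E n d t \<in> borel_measurable (events_law p)" for n d t
  proof -
    note [measurable] = measurable_fixed_time[OF measurable_exceed_count[where b=b and n=n and d=d and p=p, OF b], where t=t]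
    show ?thesis unfolding E_def by measurable
  qed
  have "law_integral p (E (Suc n) d t) \<le> ennreal (Psi d t)"
  proof (cases "b d t")
    case True
    then show ?thesis using dom[of t d] Suc.prems unfolding E_def Psi_def
      by (simp add: Q.emeasure_space_1)
  next
    case False
    have rec: "E (Suc n) d t x = (if fst (x []) \<le> t
       then E n d (t - fst (x [])) (branch True x)
          + (if snd (x []) \<le> d then E n (Suc d - snd (x [])) (t - fst (x [])) (branch False x) else 0)
       else 0)" for x
      using False unfolding E_def by auto
    have "law_integral p (E (Suc n) d t) = (\<integral>\<^sup>+w. (if w \<le> t then after_event_sum p (E n) d (t - w) else 0) \<partial>unit_exp)"
      by (rule nn_integral_first_event_sum[OF E_meas E_meas rec])
    also have "\<dots> \<le> (\<integral>\<^sup>+w. ennreal (if w \<le> t then Psi d (t - w) + gam * Psi d (t - w) else 0) \<partial>unit_exp)"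
    proof (intro nn_integral_mono)
      fix w
      show "(if w \<le> t then after_event_sum p (E n) d (t - w) else 0) \<le> ennreal (if w \<le> t then Psi d (t - w) + gam * Psi d (t - w) else 0)"
      proof (cases "w \<le> t")
        case True
        define u where "u = t - w"
        have u: "0 \<le> u" using True by (simp add: u_def)
        have IH: "law_integral p (E n e u) \<le> ennreal (Psi e u)" for e
          unfolding E_def Psi_def using Suc.IH[OF u] .
        have "(\<integral>\<^sup>+z. (if z \<le> d then law_integral p (E n (Suc d - z) u) else 0) \<partial>measure_pmf p)
            \<le> (\<integral>\<^sup>+z. ennreal (if z \<le> d then Psi (Suc d - z) u else 0) \<partial>measure_pmf p)"
          using IH by (intro nn_integral_mono) auto
        also have "\<dots> = ennreal (\<Sum>z\<le>d. pmf p z * Psi (Suc d - z) u)"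
          using Psi0 by (intro nn_integral_pmf_truncated) auto
        also have "(\<Sum>z\<le>d. pmf p z * Psi (Suc d - z) u) = K * exp (gam * u) * offspring_sum p (\<lambda>e. (1 / s) ^ e) d"
          by (simp add: offspring_sum_def Psi_def sum_distrib_left mult_ac)
        also have "\<dots> \<le> K * exp (gam * u) * (pgf p s / s * (1 / s) ^ d)"
          using K s by (intro mult_left_mono offspring_sum_geometric) auto
        also have "\<dots> = pgf p s / s * Psi d u" by (simp add: Psi_def mult_ac)
        also have "\<dots> \<le> gam * Psi d u" using gam Psi0 by (intro mult_right_mono) auto
        finally have "(\<integral>\<^sup>+z. (if z \<le> d then law_integral p (E n (Suc d - z) u) else 0) \<partial>measure_pmf p)
            \<le> ennreal (gam * Psi d u)"
          by (simp add: ennreal_leI)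
        from add_mono[OF IH this]
        have "after_event_sum p (E n) d u
          \<le> ennreal (Psi d u + gam * Psi d u)"
          using gam0 Psi0[of d u] by simp
        then show ?thesis using True unfolding u_def by simp
      qed auto
    qed
    also have "\<dots> \<le> ennreal (Psi d t)"
    proof (rule first_event_integral[where G="\<lambda>u. Psi d u" and G'="\<lambda>u. gam * Psi d u"])
      show "((\<lambda>u. Psi d u) has_real_derivative gam * Psi d u) (at u)" for u
        unfolding Psi_def by (auto intro!: derivative_eq_intros)
      show "(\<lambda>u. gam * Psi d u) \<in> borel_measurable borel" unfolding Psi_def by measurable
      show "0 \<le> Psi d u + gam * Psi d u" for u using gam0 Psi0[of d u] by simp
      show "0 \<le> Psi d 0" using Psi0 .
    qed (use Suc.prems in auto)
    finally show ?thesis .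
  qed
  then show ?case unfolding E_def Psi_def .
qed

lemma exceed_count_eq_0:
  assumes "\<And>l. 0 \<le> fst (x l)" "\<And>e u. 0 \<le> u \<Longrightarrow> u \<le> t \<Longrightarrow> \<not> b e u" "0 \<le> t"
  shows "exceed_count b n d t x = 0"
  using assms
proof (induction n arbitrary: d t x)
  case (Suc n)
  have "exceed_count b n e (t - fst (x [])) (branch c x) = 0" if "fst (x []) \<le> t" for e c
    using that Suc.prems(1)[of "[]"] by (intro Suc.IH Suc.prems) (auto simp: branch_def Suc.prems(1) intro: order_trans)
  then show ?case using Suc.prems by simp
qed simp

lemma AE_events_law_nonneg: "AE x in events_law p. \<forall>l. 0 \<le> fst (x l)"
proof -
  have "AE y in event_law p. 0 \<le> fst y"
  proof -
    interpret P: pair_prob_space unit_exp "measure_pmf p"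
      by (intro pair_prob_space.intro pair_sigma_finite.intro prob_space_unit_exp measure_pmf.prob_space_axioms
            prob_space_imp_sigma_finite)
    have "{y \<in> space (unit_exp \<Otimes>\<^sub>M measure_pmf p). 0 \<le> fst y} \<in> sets (unit_exp \<Otimes>\<^sub>M measure_pmf p)"
      by measurable
    moreover have "AE w in unit_exp. AE z in measure_pmf p. 0 \<le> fst (w, z)" using unit_exp_AE_nonneg by simp
    ultimately show ?thesis unfolding event_law_def by (rule P.AE_pair_measure)
  qed
  then show ?thesis unfolding events_law_def AE_all_countable
    by (intro allI AE_PiM_component prob_space_event_law) auto
qed

text \<open>
  If \<open>s \<ge> 1\<close>, then the violated quantity is largest at the initial vertex. Otherwise its \<open>r\<close>-th power
  has depth weights \<open>(s\<^sup>r)\<^bsup>-d\<^esup>\<close>, to which the expectation bound applies. The rate \<open>gam\<close> has to be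
  less than one, since it is integrated against the density \<open>e\<^bsup>-t\<^esup>\<close> of the clock.
\<close>
lemma exceed_probability:
  assumes s: "0 < s" "pgf_summable p s" and r: "0 < r" and th: "0 \<le> th" "r * th < 1" and del: "0 < del"
    and cases: "1 \<le> s \<or> pgf_summable p (s powr r) \<and> pgf p (s powr r) < s powr r"
  shows "\<exists>gam<1. \<exists>A\<ge>0. \<forall>lam>0. \<forall>t\<ge>0. \<forall>n.
    law_measure p (\<lambda>x. exceed_count (\<lambda>d t. del < lam * s * (1 / s) ^ d * exp (th * t)) n 0 t x \<noteq> 0)
      \<le> ennreal (A * lam powr r * exp (gam * t))"
proof -
  interpret Q: prob_space "events_law p" by (rule prob_space_events_law)
  let ?b = "\<lambda>lam d t. del < lam * s * (1 / s) ^ d * exp (th * t)"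
  have b: "Measurable.pred borel (?b lam d)" for lam d by measurable
  have power: "(lam * s * (1 / s) ^ d * exp (th * t) / del) powr r
      = (s / del) powr r * lam powr r * (1 / s powr r) ^ d * exp (r * th * t)" if "0 < lam" for lam d t
  proof -
    have "((1 / s) ^ d) powr r = (1 / s powr r) ^ d"
      using s by (simp add: powr_realpow[symmetric] powr_powr powr_divide mult.commute powr_power flip: powr_realpow)
    moreover have "exp (th * t) powr r = exp (r * th * t)" by (simp add: powr_def mult_ac)
    ultimately show ?thesis using s del that by (simp add: powr_mult powr_divide mult_ac)
  qed
  have ge1: "1 \<le> (s / del) powr r * lam powr r * (1 / s powr r) ^ d * exp (r * th * t)" if "0 < lam" "?b lam d t" for lam d t
  proof -
    have "1 \<le> lam * s * (1 / s) ^ d * exp (th * t) / del" using that del by simp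
    then show ?thesis using r unfolding power[OF that(1), symmetric] by (simp add: ge_one_powr_ge_zero)
  qed
  have meas: "{x \<in> space (events_law p). exceed_count (?b lam) n 0 t x \<noteq> 0} \<in> sets (events_law p)" for lam n t
  proof -
    note [measurable] = measurable_fixed_time[OF measurable_exceed_count[where b="?b lam" and n=n and d=0 and p=p, OF b], where t=t]
    show ?thesis by measurable
  qed
  show ?thesis
    using cases
  proof
    assume s1: "1 \<le> s"
    show ?thesis
    proof (rule exI[of _ "r * th"], rule conjI[rotated], rule exI[of _ "(s / del) powr r"], intro conjI allI impI)
      fix lam t :: real and n assume lt: "0 < lam" "0 \<le> t"
      let ?S = "{x \<in> space (events_law p). exceed_count (?b lam) n 0 t x \<noteq> 0}"
      show "emeasure (events_law p) ?S \<le> ennreal ((s / del) powr r * lam powr r * exp (r * th * t))"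
      proof (cases "?b lam 0 t")
        case True
        then have "1 \<le> ennreal ((s / del) powr r * lam powr r * exp (r * th * t))"
          using ge1[OF lt(1) True] by simp
        then show ?thesis using Q.emeasure_le_1 order_trans by blast
      next
        case False
        have nb: "\<not> ?b lam e u" if "0 \<le> u" "u \<le> t" for e u
        proof -
          have "lam * s * (1 / s) ^ e * exp (th * u) \<le> lam * s * 1 * exp (th * t)"
            using lt s s1 th that by (intro mult_mono power_le_one) (auto intro!: mult_left_mono)
          then show ?thesis using False by simp
        qed
        have "AE x in events_law p. x \<notin> ?S"
          using AE_events_law_nonneg
        proof eventually_elim
          case (elim x) then show ?case using exceed_count_eq_0[of x t "?b lam" n 0] nb lt by simp
        qed
        then have "emeasure (events_law p) ?S = 0" using meas by (subst (asm) AE_iff_null_sets[symmetric]) auto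
        then show ?thesis by simp
      qed
    qed (use th in auto)
  next
    assume q: "pgf_summable p (s powr r) \<and> pgf p (s powr r) < s powr r"
    define gam where "gam = max (r * th) (pgf p (s powr r) / s powr r)"
    show ?thesis
    proof (rule exI[of _ gam], rule conjI[rotated], rule exI[of _ "(s / del) powr r"], intro conjI allI impI)
      fix lam t :: real and n assume lt: "0 < lam" "0 \<le> t"
      let ?S = "{x \<in> space (events_law p). exceed_count (?b lam) n 0 t x \<noteq> 0}"
      have "emeasure (events_law p) ?S = (\<integral>\<^sup>+x. indicator ?S x \<partial>events_law p)" using meas by simp
      also have "\<dots> \<le> (\<integral>\<^sup>+x. ennreal (real (exceed_count (?b lam) n 0 t x)) \<partial>events_law p)"
      proof (intro nn_integral_mono)
        fix x
        have "1 \<le> ennreal (real (exceed_count (?b lam) n 0 t x))" if "exceed_count (?b lam) n 0 t x \<noteq> 0"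
          using that by (cases "exceed_count (?b lam) n 0 t x") auto
        then show "indicator ?S x \<le> ennreal (real (exceed_count (?b lam) n 0 t x))"
          by (simp split: split_indicator)
      qed
      also have "\<dots> \<le> ennreal ((s / del) powr r * lam powr r * (1 / s powr r) ^ 0 * exp (gam * t))"
      proof (rule exceed_count_expectation[OF _ _ _ _ b])
        fix d and u :: real assume u: "0 \<le> u" "?b lam d u"
        have "(s / del) powr r * lam powr r * (1 / s powr r) ^ d * exp (r * th * u)
            \<le> (s / del) powr r * lam powr r * (1 / s powr r) ^ d * exp (gam * u)"
          using u unfolding gam_def by (intro mult_left_mono) (auto intro!: mult_right_mono)
        then show "1 \<le> (s / del) powr r * lam powr r * (1 / s powr r) ^ d * exp (gam * u)"
          using ge1[OF lt(1) u(2)] by linarith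
      qed (use s q lt in \<open>auto simp: gam_def\<close>)
      finally show "emeasure (events_law p) ?S \<le> ennreal ((s / del) powr r * lam powr r * exp (gam * t))" by simp
    qed (use th q s in \<open>auto simp: gam_def\<close>)
  qed
qed

text \<open>
  Chernoff's bound on the event that no vertex violates the condition.
\<close>
lemma tail_at_fixed_time:
  assumes s: "0 < s" "pgf_summable p s" and th: "(1 + del) * (pgf p s / s) \<le> th"
    and del: "0 < del" "del \<le> 1" and lam: "0 < lam" and t: "0 \<le> t"
  defines "b \<equiv> \<lambda>d t. del < lam * s * (1 / s) ^ d * exp (th * t)"
  shows "law_measure p (\<lambda>x. k \<le> depth_one_count n 0 t x)
     \<le> law_measure p (\<lambda>x. exceed_count b n 0 t x \<noteq> 0) + ennreal (exp (del - lam * real k))"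
proof -
  have b: "Measurable.pred borel (b d)" for d unfolding b_def by measurable
  note m1 [measurable] = measurable_fixed_time[OF measurable_exceed_count[where b=b and n=n and d=0 and p=p, OF b], where t=t]
  note m2 [measurable] = measurable_fixed_time[OF measurable_depth_one_count, of n 0 t p]
  define Phi where "Phi = (\<lambda>x. if exceed_count b n 0 t x = 0 then ennreal (exp (lam * depth_one_count n 0 t x)) else 0)"
  have [measurable]: "Phi \<in> borel_measurable (events_law p)" unfolding Phi_def by measurable
  let ?K = "{x \<in> space (events_law p). k \<le> depth_one_count n 0 t x}"
  let ?S = "{x \<in> space (events_law p). exceed_count b n 0 t x \<noteq> 0}"
  have "emeasure (events_law p) ?K = (\<integral>\<^sup>+x. indicator ?K x \<partial>events_law p)" by simp
  also have "\<dots> \<le> (\<integral>\<^sup>+x. indicator ?S x + ennreal (exp (- lam * real k)) * Phi x \<partial>events_law p)"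
  proof (intro nn_integral_mono)
    fix x assume x: "x \<in> space (events_law p)"
    have "1 \<le> ennreal (exp (- lam * real k)) * Phi x" if "exceed_count b n 0 t x = 0" "k \<le> depth_one_count n 0 t x"
    proof -
      have "ennreal (exp (- lam * real k)) * Phi x = ennreal (exp (lam * (real (depth_one_count n 0 t x) - real k)))"
        unfolding Phi_def using that(1)
        by (simp add: ennreal_mult[symmetric] exp_add[symmetric] algebra_simps)
      moreover have "1 \<le> exp (lam * (real (depth_one_count n 0 t x) - real k))" using that lam by simp
      ultimately show ?thesis by simp
    qed
    then show "indicator ?K x \<le> indicator ?S x + ennreal (exp (- lam * real k)) * Phi x"
      using x by (auto split: split_indicator)
  qed
  also have "\<dots> = emeasure (events_law p) ?S + ennreal (exp (- lam * real k)) * law_integral p Phi"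
    by (subst nn_integral_add) (auto simp: nn_integral_cmult)
  also have "\<dots> \<le> emeasure (events_law p) ?S + ennreal (exp (- lam * real k)) * ennreal (exp del)"
  proof (intro add_left_mono mult_left_mono)
    have "law_integral p Phi \<le> (if b 0 t then 0 else ennreal (exp (lam * s * (1 / s) ^ 0 * exp (th * t))))"
      unfolding Phi_def b_def using killed_exponential_moment[OF s th del less_imp_le[OF lam] t, of n 0] .
    also have "\<dots> \<le> ennreal (exp del)" by (auto simp: b_def not_less intro!: ennreal_leI)
    finally show "law_integral p Phi \<le> ennreal (exp del)" .
  qed auto
  also have "ennreal (exp (- lam * real k)) * ennreal (exp del) = ennreal (exp (del - lam * real k))"
    by (simp add: ennreal_mult[symmetric] exp_add[symmetric])
  finally show ?thesis .
qed

text \<open>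
  The probability that there are at least \<open>k\<close> vertices at depth one at time \<open>t\<close>, started from the root.
\<close>
definition tail_at :: "nat pmf \<Rightarrow> nat \<Rightarrow> real \<Rightarrow> ennreal" where
  "tail_at p k t = law_measure p (\<lambda>x. \<exists>n. k \<le> depth_one_count n 0 t x)"

lemma tail_at_le:
  assumes "\<And>n. law_measure p (\<lambda>x. k \<le> depth_one_count n 0 t x) \<le> B"
  shows "tail_at p k t \<le> B"
proof -
  let ?A = "\<lambda>n. {x \<in> space (events_law p). k \<le> depth_one_count n 0 t x}"
  have "?A n \<in> sets (events_law p)" for n
  proof -
    note [measurable] = measurable_fixed_time[OF measurable_depth_one_count, of n 0 t p]
    show ?thesis by measurable
  qed
  moreover have "incseq ?A"
    using depth_one_count_incseq by (fastforce simp: incseq_def intro: order_trans)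
  ultimately have "emeasure (events_law p) (\<Union>n. ?A n) = (SUP n. emeasure (events_law p) (?A n))"
    by (intro SUP_emeasure_incseq[symmetric]) auto
  moreover have "(\<Union>n. ?A n) = {x \<in> space (events_law p). \<exists>n. k \<le> depth_one_count n 0 t x}" by auto
  ultimately show ?thesis unfolding tail_at_def using assms by (simp add: SUP_least)
qed

text \<open>
  With \<open>\<lambda> = r log k / k\<close> the Chernoff term is \<open>k\<^bsup>-r\<^esup>\<close>, and the violation has probability of order
  \<open>\<lambda>\<^sup>r\<close>.
\<close>
lemma exponential_time_tail_upper:
  assumes s: "0 < s" "pgf_summable p s" and r: "0 < r" "r * (pgf p s / s) < 1"
    and cases: "1 \<le> s \<or> pgf_summable p (s powr r) \<and> pgf p (s powr r) < s powr r"
  shows "\<exists>A\<ge>0. \<forall>k\<ge>2. (\<integral>\<^sup>+t. tail_at p k t \<partial>unit_exp)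
     \<le> ennreal (A * (ln (real k) / real k) powr r + exp 1 * real k powr (- r))"
proof -
  have f: "0 \<le> pgf p s" using s by (intro pgf_nonneg) auto
  define th0 where "th0 = pgf p s / s"
  have th0: "0 \<le> th0" using f s by (simp add: th0_def)
  obtain del where del: "0 < del" "del \<le> 1" "r * ((1 + del) * th0) < 1"
  proof -
    have x: "0 < 1 - r * th0" "r * th0 \<le> 1" using r(2) unfolding th0_def by auto
    \<comment> \<open>Enlarging the rate by the factor \<open>1 + del\<close> takes up at most half of the gap \<open>1 - r f(s) / s\<close>.\<close>
    define del where "del = min 1 ((1 - r * th0) / 2)"
    have "r * th0 * del \<le> 1 * del" using x by (intro mult_right_mono) (auto simp: del_def)
    also have "1 * del \<le> (1 - r * th0) / 2" unfolding del_def mult_1 by (rule min.cobounded2)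
    also have "\<dots> < 1 - r * th0" using x by simp
    finally have "r * ((1 + del) * th0) < 1" by (simp add: algebra_simps)
    then show thesis using x by (intro that[of del]) (auto simp: del_def)
  qed
  define th where "th = (1 + del) * th0"
  have th: "0 \<le> th" "r * th < 1" "(1 + del) * (pgf p s / s) \<le> th"
    using del th0 by (auto simp: th_def intro!: mult_nonneg_nonneg) (simp add: th0_def)
  obtain gam A where g: "gam < 1" "0 \<le> A" and A: "\<And>lam t n. 0 < lam \<Longrightarrow> 0 \<le> t \<Longrightarrow>
    law_measure p (\<lambda>x. exceed_count (\<lambda>d t. del < lam * s * (1 / s) ^ d * exp (th * t)) n 0 t x \<noteq> 0)
      \<le> ennreal (A * lam powr r * exp (gam * t))"
    using exceed_probability[OF s r(1) th(1,2) del(1) cases] by blast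
  show ?thesis
  proof (intro exI[of _ "A * r powr r / (1 - gam)"] conjI allI impI)
    show "0 \<le> A * r powr r / (1 - gam)" using g by simp
    fix k :: nat assume k: "2 \<le> k"
    define lam where "lam = r * ln (real k) / real k"
    have lam: "0 < lam" using r k by (auto simp: lam_def)
    have lk: "exp (del - lam * real k) \<le> exp 1 * real k powr (- r)"
    proof -
      have "exp (del - lam * real k) = exp del * exp (- r * ln (real k))" using k by (simp add: lam_def flip: exp_add)
      also have "exp (- r * ln (real k)) = real k powr (- r)" using k by (simp add: powr_def)
      finally show ?thesis using del by (simp add: mult_right_mono)
    qed
    have bound: "tail_at p k t \<le> ennreal (A * lam powr r) * ennreal (exp (gam * t)) + ennreal (exp 1 * real k powr (- r))"
      if t: "0 \<le> t" for t
    proof (rule tail_at_le)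
      fix n
      have "law_measure p (\<lambda>x. k \<le> depth_one_count n 0 t x)
        \<le> law_measure p (\<lambda>x. exceed_count (\<lambda>d t. del < lam * s * (1 / s) ^ d * exp (th * t)) n 0 t x \<noteq> 0)
          + ennreal (exp (del - lam * real k))"
        by (rule tail_at_fixed_time[OF s th(3) del(1,2) lam t])
      also have "\<dots> \<le> ennreal (A * lam powr r * exp (gam * t)) + ennreal (exp 1 * real k powr (- r))"
        by (intro add_mono A lam t ennreal_leI lk)
      finally show "law_measure p (\<lambda>x. k \<le> depth_one_count n 0 t x)
        \<le> ennreal (A * lam powr r) * ennreal (exp (gam * t)) + ennreal (exp 1 * real k powr (- r))"
        using g by (simp add: ennreal_mult)
    qed
    have "(\<integral>\<^sup>+t. tail_at p k t \<partial>unit_exp)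
       \<le> (\<integral>\<^sup>+t. ennreal (A * lam powr r) * ennreal (exp (gam * t)) + ennreal (exp 1 * real k powr (- r)) \<partial>unit_exp)"
      using unit_exp_AE_nonneg by (intro nn_integral_mono_AE) (auto elim!: eventually_mono intro: bound)
    also have "\<dots> = ennreal (A * lam powr r) * ennreal (1 / (1 - gam)) + ennreal (exp 1 * real k powr (- r))"
      using unit_exp_moment[OF g(1)] nn_integral_unit_exp_const
      by (subst nn_integral_add) (auto simp: nn_integral_cmult)
    also have "\<dots> = ennreal (A * lam powr r * (1 / (1 - gam)) + exp 1 * real k powr (- r))"
      using g by (simp add: ennreal_mult[symmetric] ennreal_plus[symmetric] del: ennreal_plus)
    also have "A * lam powr r * (1 / (1 - gam)) = A * r powr r / (1 - gam) * (ln (real k) / real k) powr r"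
      using r k by (simp add: lam_def powr_mult powr_divide mult_ac)
    finally show "(\<integral>\<^sup>+t. tail_at p k t \<partial>unit_exp)
       \<le> ennreal (A * r powr r / (1 - gam) * (ln (real k) / real k) powr r + exp 1 * real k powr (- r))" .
  qed
qed

section \<open>The Laplace transform\<close>
text \<open>
  \<open>e\<^bsup>-\<lambda>N\<^esup>\<close> for the number \<open>N\<close> of all vertices at depth one, read as \<open>0\<close> if \<open>N\<close> is infinite.
\<close>
definition damped :: "real \<Rightarrow> nat \<Rightarrow> real \<Rightarrow> events \<Rightarrow> ennreal" where
  "damped lam d t x = (INF n. ennreal (exp (- lam * real (depth_one_count n d t x))))"

lemma measurable_damped: "(\<lambda>y. damped lam d (fst y) (snd y)) \<in> borel_measurable (timed_law p)"
proof -
  note [measurable] = measurable_depth_one_count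
  show ?thesis unfolding damped_def by (intro borel_measurable_INF) auto
qed

lemma damped_limit:
  assumes "0 \<le> lam"
  shows "(\<lambda>n. ennreal (exp (- lam * real (depth_one_count n d t x)))) \<longlonglongrightarrow> damped lam d t x"
  unfolding damped_def
proof (rule LIMSEQ_INF)
  show "decseq (\<lambda>n. ennreal (exp (- lam * real (depth_one_count n d t x))))"
    using depth_one_count_incseq[of d t x] assms
    by (auto simp: decseq_def incseq_def intro!: ennreal_leI mult_left_mono)
qed

lemma damped_le: "damped lam d t x \<le> ennreal (exp (- lam * (if d = 1 then 1 else 0)))"
  unfolding damped_def by (rule INF_lower2[of 0]) auto

lemma damped_le_1: "0 \<le> lam \<Longrightarrow> damped lam d t x \<le> 1"
  using damped_le[of lam d t x] by (rule order_trans) auto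

lemma damped_antimono: "0 \<le> lam \<Longrightarrow> t \<le> t' \<Longrightarrow> damped lam d t' x \<le> damped lam d t x"
  unfolding damped_def
proof (rule INF_mono)
  fix m assume "0 \<le> lam" "t \<le> t'"
  then show "\<exists>n\<in>UNIV. ennreal (exp (- lam * real (depth_one_count n d t' x)))
      \<le> ennreal (exp (- lam * real (depth_one_count m d t x)))"
    by (intro bexI[of _ m]) (auto intro!: ennreal_leI mult_left_mono depth_one_count_mono_time)
qed

lemma damped_first_event:
  assumes lam: "0 \<le> lam"
  shows "damped lam d t x = (if fst (x []) \<le> t
       then damped lam d (t - fst (x [])) (branch True x)
          * (if snd (x []) \<le> d then damped lam (Suc d - snd (x [])) (t - fst (x [])) (branch False x) else 1)
       else ennreal (exp (- lam * (if d = 1 then 1 else 0))))" (is "_ = ?R")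
proof -
  let ?e = "\<lambda>n d t x. ennreal (exp (- lam * real (depth_one_count n d t x)))"
  have fin: "damped lam d t x \<noteq> \<top>" for d t x
    using damped_le_1[OF lam, of d t x] by (auto simp: top_unique)
  have "(\<lambda>n. ?e (Suc n) d t x) \<longlonglongrightarrow> ?R"
  proof (cases "fst (x []) \<le> t")
    case True
    have "(\<lambda>n. ?e n d (t - fst (x [])) (branch True x)
        * (if snd (x []) \<le> d then ?e n (Suc d - snd (x [])) (t - fst (x [])) (branch False x) else 1)) \<longlonglongrightarrow> ?R"
    proof (cases "snd (x []) \<le> d")
      case z: True
      show ?thesis unfolding if_P[OF z] if_P[OF True]
        by (rule tendsto_mult_ennreal[OF damped_limit[OF lam] damped_limit[OF lam]]) (simp add: fin)
    next
      case False
      show ?thesis using damped_limit[OF lam, of d "t - fst (x [])" "branch True x"]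
        unfolding if_not_P[OF False] if_P[OF True] mult_1_right .
    qed
    moreover have "?e (Suc n) d t x = ?e n d (t - fst (x [])) (branch True x)
        * (if snd (x []) \<le> d then ?e n (Suc d - snd (x [])) (t - fst (x [])) (branch False x) else 1)" for n
      using True by (auto simp: ennreal_mult[symmetric] exp_add[symmetric] algebra_simps)
    ultimately show ?thesis by simp
  qed simp
  moreover have "(\<lambda>n. ?e (Suc n) d t x) \<longlonglongrightarrow> damped lam d t x"
    by (rule LIMSEQ_Suc[OF damped_limit[OF lam]])
  ultimately show ?thesis using LIMSEQ_unique by blast
qed

definition deficit :: "nat pmf \<Rightarrow> real \<Rightarrow> nat \<Rightarrow> real \<Rightarrow> real" where
  "deficit p lam d t = 1 - enn2real (law_integral p (damped lam d t))"

lemma damped_integral: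
  assumes "0 \<le> lam"
  shows "law_integral p (damped lam d t) = ennreal (1 - deficit p lam d t)"
    and "0 \<le> deficit p lam d t" "deficit p lam d t \<le> 1"
proof -
  interpret Q: prob_space "events_law p" by (rule prob_space_events_law)
  have "law_integral p (damped lam d t) \<le> (\<integral>\<^sup>+x. 1 \<partial>events_law p)"
    using damped_le_1[OF assms] by (intro nn_integral_mono)
  then have le: "law_integral p (damped lam d t) \<le> 1" by (simp add: Q.emeasure_space_1)
  then have fin: "law_integral p (damped lam d t) < \<top>" by (simp add: order_le_less_trans)
  show "law_integral p (damped lam d t) = ennreal (1 - deficit p lam d t)"
    unfolding deficit_def using fin by simp
  show "0 \<le> deficit p lam d t" unfolding deficit_def using le
    by (simp add: enn2real_leI)
  show "deficit p lam d t \<le> 1" unfolding deficit_def by simp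
qed

lemma deficit_mono:
  assumes "0 \<le> lam" "t \<le> t'" shows "deficit p lam d t \<le> deficit p lam d t'"
proof -
  have "ennreal (1 - deficit p lam d t') \<le> ennreal (1 - deficit p lam d t)"
    unfolding damped_integral(1)[OF assms(1), symmetric]
    using assms by (intro nn_integral_mono damped_antimono)
  then show ?thesis using damped_integral(3)[OF assms(1), of p d] by (simp add: ennreal_le_iff)
qed

lemma deficit_initial:
  assumes "0 \<le> lam" shows "1 - exp (- lam) \<le> deficit p lam 1 t"
proof -
  interpret Q: prob_space "events_law p" by (rule prob_space_events_law)
  have "ennreal (1 - deficit p lam 1 t) \<le> (\<integral>\<^sup>+x. ennreal (exp (- lam)) \<partial>events_law p)"
    unfolding damped_integral(1)[OF assms, symmetric]
    using damped_le[of lam 1 t] by (intro nn_integral_mono) simp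
  then show ?thesis by (simp add: Q.emeasure_space_1 ennreal_le_iff)
qed

text \<open>
  Split at the first event. If it comes after time \<open>h\<close>, the process starts afresh at \<open>h\<close>. Otherwise,
  at the time of the event, at least \<open>t\<close> remains for both processes, and the transform decreases in
  time.
\<close>
lemma deficit_step:
  assumes lam: "0 \<le> lam" and t: "0 \<le> t" and h: "0 \<le> h"
  shows "deficit p lam d t + (1 - exp (- h)) * (1 - deficit p lam d t) * offspring_sum p (\<lambda>e. deficit p lam e t) d
     \<le> deficit p lam d (t + h)"
proof -
  let ?v = "deficit p lam"
  note v = damped_integral(2,3)[OF lam]
  define H where "H = (\<lambda>u. 1 - offspring_sum p (\<lambda>e. ?v e u) d)"
  define F where "F = (\<lambda>u. 1 - ?v d u)"
  have H: "0 \<le> H u" "H u \<le> 1" for u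
    unfolding H_def using v by (auto intro: offspring_sum_le offspring_sum_nonneg)
  have F: "0 \<le> F u" "F u \<le> 1" for u unfolding F_def using v by auto
  have FH_anti: "F u' * H u' \<le> F u * H u" if "u \<le> u'" for u u'
    using that F H unfolding F_def H_def
    by (intro mult_mono) (auto intro!: deficit_mono[OF lam] offspring_sum_mono)
  let ?c = "exp (- lam * (if d = 1 then 1 else 0))"
  define K where "K = (\<lambda>u. if 0 \<le> u then ennreal (F u * H u) else ennreal ?c)"
  have dm: "damped lam e s \<in> borel_measurable (events_law p)" for e s
    using measurable_fixed_time[OF measurable_damped] .
  have eq: "ennreal (F s) = (\<integral>\<^sup>+w. K (s - w) \<partial>unit_exp)" for s
  proof -
    have "ennreal (F s) = (\<integral>\<^sup>+w. (if w \<le> s then after_event_prod p (damped lam) d (s - w) else ennreal ?c) \<partial>unit_exp)"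
      unfolding F_def damped_integral(1)[OF lam, symmetric]
      by (rule nn_integral_first_event_prod[OF dm dm damped_first_event[OF lam]])
    also have "\<dots> = (\<integral>\<^sup>+w. K (s - w) \<partial>unit_exp)"
    proof (intro nn_integral_cong)
      fix w
      have "(\<integral>\<^sup>+z. (if z \<le> d then law_integral p (damped lam (Suc d - z) (s - w)) else 1) \<partial>measure_pmf p)
         = (\<integral>\<^sup>+z. ennreal (if z \<le> d then 1 - ?v (Suc d - z) (s - w) else 1) \<partial>measure_pmf p)"
        by (intro nn_integral_cong) (simp add: damped_integral(1)[OF lam])
      also have "\<dots> = ennreal (1 + (\<Sum>z\<le>d. pmf p z * (1 - ?v (Suc d - z) (s - w) - 1)))"
        using v by (intro nn_integral_pmf_one_plus) auto
      also have "1 + (\<Sum>z\<le>d. pmf p z * (1 - ?v (Suc d - z) (s - w) - 1)) = H (s - w)"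
        by (simp add: H_def offspring_sum_def sum_negf)
      finally show "(if w \<le> s then after_event_prod p (damped lam) d (s - w) else ennreal ?c) = K (s - w)"
        using F H by (simp add: K_def damped_integral(1)[OF lam] F_def ennreal_mult)
    qed
    finally show ?thesis .
  qed
  have Kmeas [measurable]: "K \<in> borel_measurable borel"
  proof -
    have "(\<lambda>u. deficit p lam e u) \<in> borel_measurable borel" for e
      by (rule borel_measurable_mono) (auto simp: mono_def intro: deficit_mono[OF lam])
    note [measurable] = this
    show ?thesis unfolding K_def F_def H_def offspring_sum_def by measurable
  qed
  have "ennreal (F (t + h)) = (\<integral>\<^sup>+w. K (t + h - w) * indicator {..<h} w + K (t + h - w) * indicator {h..} w \<partial>unit_exp)"
    unfolding eq by (intro nn_integral_cong) (auto split: split_indicator)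
  also have "\<dots> = (\<integral>\<^sup>+w. K (t + h - w) * indicator {..<h} w \<partial>unit_exp) + (\<integral>\<^sup>+w. K (t + h - w) * indicator {h..} w \<partial>unit_exp)"
    by (subst nn_integral_add) auto
  also have "(\<integral>\<^sup>+w. K (t + h - w) * indicator {h..} w \<partial>unit_exp) = ennreal (exp (- h)) * ennreal (F t)"
    unfolding eq[of t] by (subst unit_exp_memoryless[OF _ h]) auto
  also have "(\<integral>\<^sup>+w. K (t + h - w) * indicator {..<h} w \<partial>unit_exp) \<le> (\<integral>\<^sup>+w. ennreal (F t * H t) * indicator {..<h} w \<partial>unit_exp)"
    using t FH_anti by (intro nn_integral_mono) (auto simp: K_def split: split_indicator intro!: ennreal_leI)
  also have "\<dots> = ennreal (F t * H t) * ennreal (1 - exp (- h))"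
    using unit_exp_head[OF h] by (subst nn_integral_cmult) auto
  finally have "ennreal (F (t + h)) \<le> ennreal (F t * H t) * ennreal (1 - exp (- h)) + ennreal (exp (- h)) * ennreal (F t)"
    by (simp add: add_right_mono)
  also have "\<dots> = ennreal (F t * H t * (1 - exp (- h)) + exp (- h) * F t)"
    using F[of t] H[of t] h by (simp add: ennreal_mult[symmetric] ennreal_plus[symmetric] del: ennreal_plus)
  finally have "F (t + h) \<le> F t * H t * (1 - exp (- h)) + exp (- h) * F t"
    using F[of t] H[of t] h by (subst (asm) ennreal_le_iff) auto
  then show ?thesis unfolding F_def H_def by (simp add: algebra_simps)
qed

text \<open>
  If there are fewer than \<open>k\<close> vertices at depth one, then \<open>e\<^bsup>-\<lambda>N\<^esup> \<ge> 1 - \<lambda>k\<close>.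
\<close>
lemma deficit_le_tail:
  assumes lam: "0 \<le> lam" and t: "0 \<le> t"
  shows "ennreal (deficit p lam 0 t - lam * real k) \<le> tail_at p k t"
proof -
  interpret Q: prob_space "events_law p" by (rule prob_space_events_law)
  let ?A = "{x \<in> space (events_law p). \<exists>n. k \<le> depth_one_count n 0 t x}"
  have A: "?A \<in> sets (events_law p)"
  proof -
    note [measurable] = measurable_fixed_time[OF measurable_depth_one_count[where d=0 and p=p], where t=t]
    show ?thesis by measurable
  qed
  have "ennreal (exp (- lam * real k)) * emeasure (events_law p) (space (events_law p) - ?A)
     = (\<integral>\<^sup>+x. ennreal (exp (- lam * real k)) * indicator (space (events_law p) - ?A) x \<partial>events_law p)"
    using A by (subst nn_integral_cmult) auto
  also have "\<dots> \<le> law_integral p (damped lam 0 t)"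
  proof (intro nn_integral_mono)
    fix x
    have "ennreal (exp (- lam * real k)) \<le> damped lam 0 t x" if "\<And>n. \<not> k \<le> depth_one_count n 0 t x"
      unfolding damped_def
    proof (intro INF_greatest ennreal_leI)
      fix n
      show "exp (- lam * real k) \<le> exp (- lam * real (depth_one_count n 0 t x))"
        using that[of n] lam by (simp add: mult_left_mono)
    qed
    then show "ennreal (exp (- lam * real k)) * indicator (space (events_law p) - ?A) x \<le> damped lam 0 t x"
      by (auto split: split_indicator)
  qed
  also have "\<dots> = ennreal (1 - deficit p lam 0 t)" by (rule damped_integral(1)[OF lam])
  finally have "ennreal (exp (- lam * real k)) * ennreal (Q.prob (space (events_law p) - ?A)) \<le> ennreal (1 - deficit p lam 0 t)"
    by (simp add: Q.emeasure_eq_measure)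
  then have "exp (- lam * real k) * (1 - Q.prob ?A) \<le> 1 - deficit p lam 0 t"
    using A damped_integral(3)[OF lam, of p 0 t] Q.prob_compl[OF A]
    by (simp add: ennreal_mult[symmetric] ennreal_le_iff)
  moreover have "(1 - lam * real k) * (1 - Q.prob ?A) \<le> exp (- lam * real k) * (1 - Q.prob ?A)"
    using exp_ge_add_one_self[of "- lam * real k"] Q.prob_le_1 by (intro mult_right_mono) auto
  moreover have "(1 - lam * real k) * (1 - Q.prob ?A) = 1 - Q.prob ?A - lam * real k + lam * real k * Q.prob ?A"
    by (simp add: algebra_simps)
  moreover have "0 \<le> lam * real k * Q.prob ?A" using lam by (intro mult_nonneg_nonneg) auto
  ultimately have "deficit p lam 0 t - lam * real k \<le> Q.prob ?A" by linarith
  then show ?thesis unfolding tail_at_def Q.emeasure_eq_measure by (rule ennreal_leI)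
qed

section \<open>From the tree process to the law of the events\<close>
lemma measurable_card_ge:
  fixes S :: "'a \<Rightarrow> 'b :: countable set"
  assumes S: "\<And>u. {\<omega> \<in> space M. u \<in> S \<omega>} \<in> sets M"
  shows "{\<omega> \<in> space M. k \<le> card (S \<omega>)} \<in> sets M"
proof (cases "k = 0")
  case False
  let ?C = "{F :: 'b set. finite F \<and> k \<le> card F}"
  have "{\<omega> \<in> space M. S \<omega> = F} \<in> sets M" for F
  proof -
    have "{\<omega> \<in> space M. u \<in> S \<omega> \<longleftrightarrow> u \<in> F} \<in> sets M" for u
      using S[of u] sets.sets_Collect_neg[OF S[of u]] by (cases "u \<in> F") auto
    then have "{\<omega> \<in> space M. \<forall>u. u \<in> S \<omega> \<longleftrightarrow> u \<in> F} \<in> sets M"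
      by (intro sets.sets_Collect_countable_All)
    then show ?thesis by (simp add: set_eq_iff)
  qed
  moreover have "countable ?C"
    by (rule countable_subset[OF _ countable_Collect_finite]) auto
  ultimately have "(\<Union>F\<in>?C. {\<omega> \<in> space M. S \<omega> = F}) \<in> sets M"
    by (intro sets.countable_UN') auto
  moreover have "(\<Union>F\<in>?C. {\<omega> \<in> space M. S \<omega> = F}) = {\<omega> \<in> space M. k \<le> card (S \<omega>)}"
    using False card.infinite by fastforce
  ultimately show ?thesis by simp
qed simp

lemma (in prob_space) indep_var_joint_image:
  assumes ind: "indep_var M1 X1 M2 X2"
    and Y: "Y1 \<in> M1 \<rightarrow>\<^sub>M N1" "Y2 \<in> M2 \<rightarrow>\<^sub>M N2"
  shows "distr M N1 (\<lambda>\<omega>. Y1 (X1 \<omega>)) \<Otimes>\<^sub>M distr M N2 (\<lambda>\<omega>. Y2 (X2 \<omega>))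
    = distr M (N1 \<Otimes>\<^sub>M N2) (\<lambda>\<omega>. (Y1 (X1 \<omega>), Y2 (X2 \<omega>)))"
proof -
  note X = indep_var_rv1[OF ind] indep_var_rv2[OF ind]
  have joint: "distr M M1 X1 \<Otimes>\<^sub>M distr M M2 X2 = distr M (M1 \<Otimes>\<^sub>M M2) (\<lambda>\<omega>. (X1 \<omega>, X2 \<omega>))"
    using ind unfolding indep_var_distribution_eq by simp
  have Y': "Y1 \<in> distr M M1 X1 \<rightarrow>\<^sub>M N1" "Y2 \<in> distr M M2 X2 \<rightarrow>\<^sub>M N2" using Y by simp_all
  have m: "(\<lambda>(x, y). (Y1 x, Y2 y)) \<in> M1 \<Otimes>\<^sub>M M2 \<rightarrow>\<^sub>M N1 \<Otimes>\<^sub>M N2"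
    using Y by measurable
  have sf: "sigma_finite_measure (distr (distr M M2 X2) N2 Y2)"
    using X Y by (intro prob_space_imp_sigma_finite prob_space.prob_space_distr prob_space_distr) auto
  have "distr M N1 (\<lambda>\<omega>. Y1 (X1 \<omega>)) \<Otimes>\<^sub>M distr M N2 (\<lambda>\<omega>. Y2 (X2 \<omega>))
     = distr (distr M M1 X1) N1 Y1 \<Otimes>\<^sub>M distr (distr M M2 X2) N2 Y2"
    using X Y by (simp add: distr_distr comp_def)
  also have "\<dots> = distr (distr M M1 X1 \<Otimes>\<^sub>M distr M M2 X2) (N1 \<Otimes>\<^sub>M N2) (\<lambda>(x, y). (Y1 x, Y2 y))"
    by (rule pair_measure_distr[OF Y' sf])
  also have "\<dots> = distr M (N1 \<Otimes>\<^sub>M N2) (\<lambda>\<omega>. (Y1 (X1 \<omega>), Y2 (X2 \<omega>)))"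
    unfolding joint using X m by (subst distr_distr) (auto simp: comp_def)
  finally show ?thesis .
qed

context tree_process begin

definition run :: "'w \<Rightarrow> events" where
  "run \<omega> = events_of (\<lambda>v i. W v i \<omega>) (\<lambda>v i. Z v i \<omega>)"

lemma W_measurable [measurable]: "W v i \<in> borel_measurable M"
  using distributed_measurable[OF W_exponential] by simp

lemma tau_measurable [measurable]: "\<tau> \<in> borel_measurable M"
  using distributed_measurable[OF \<tau>_exponential] by simp

lemma distr_unit_exp:
  assumes "distributed M lborel X (exponential_density 1)" shows "distr M borel X = unit_exp"
proof -
  have "distr M borel X = distr M lborel X" by (rule distr_cong) auto
  then show ?thesis using distributed_distr_eq_density[OF assms] by (simp add: unit_exp_def)
qed

abbreviation "src \<equiv> \<lambda>s. case s of Wait v i \<Rightarrow> W v i | Steps v i \<Rightarrow> (\<lambda>\<omega>. real (Z v i \<omega>)) | Stop \<Rightarrow> \<tau>"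

definition read_event :: "bool list \<Rightarrow> (source \<Rightarrow> real) \<Rightarrow> real \<times> nat" where
  "read_event b g = (case event_label b of (v, i) \<Rightarrow> (g (Wait v i), nat \<lfloor>g (Steps v i)\<rfloor>))"

definition event_sources :: "bool list \<Rightarrow> source set" where
  "event_sources b = (case event_label b of (v, i) \<Rightarrow> {Wait v i, Steps v i})"

lemma read_event_src: "event_sources b \<subseteq> B \<Longrightarrow> read_event b (restrict (\<lambda>s. src s \<omega>) B) = run \<omega> b"
  by (auto simp: read_event_def event_sources_def run_def events_of_def split: prod.splits)

lemma measurable_read_event:
  assumes "event_sources b \<subseteq> B"
  shows "read_event b \<in> Pi\<^sub>M B (\<lambda>_. borel) \<rightarrow>\<^sub>M borel \<Otimes>\<^sub>M count_space UNIV"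
proof -
  obtain v i where vi: "event_label b = (v, i)" by fastforce
  have [measurable]: "(\<lambda>g. g (Wait v i)) \<in> borel_measurable (Pi\<^sub>M B (\<lambda>_. borel))"
    "(\<lambda>g. g (Steps v i)) \<in> borel_measurable (Pi\<^sub>M B (\<lambda>_. borel :: real measure))"
    using assms by (auto simp: event_sources_def vi intro!: measurable_component_singleton)
  show ?thesis unfolding read_event_def vi by simp
qed

lemma disjoint_event_sources: "disjoint_family event_sources"
proof -
  have "event_label b = event_label c" if "event_sources b \<inter> event_sources c \<noteq> {}" for b c
    using that by (auto simp: event_sources_def split: prod.splits)
  then show ?thesis using injD[OF event_label_inj] by (fastforce simp: disjoint_family_on_def)
qed

lemma events_component_law: "distr M (borel \<Otimes>\<^sub>M count_space UNIV) (\<lambda>\<omega>. run \<omega> b) = event_law p"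
proof -
  obtain v i where vi: "event_label b = (v, i)" by fastforce
  have ind: "indep_var (Pi\<^sub>M {Wait v i} (\<lambda>_. borel)) (\<lambda>\<omega>. restrict (\<lambda>s. src s \<omega>) {Wait v i})
       (Pi\<^sub>M {Steps v i} (\<lambda>_. borel)) (\<lambda>\<omega>. restrict (\<lambda>s. src s \<omega>) {Steps v i})"
    by (rule indep_var_restrict[OF independent]) auto
  have mW: "(\<lambda>g. g (Wait v i)) \<in> Pi\<^sub>M {Wait v i} (\<lambda>_. borel) \<rightarrow>\<^sub>M (borel :: real measure)"
    by (rule measurable_component_singleton) simp
  have mS: "(\<lambda>g. g (Steps v i)) \<in> Pi\<^sub>M {Steps v i} (\<lambda>_. borel) \<rightarrow>\<^sub>M (borel :: real measure)"
    by (rule measurable_component_singleton) simp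
  then have mZ: "(\<lambda>g. nat \<lfloor>g (Steps v i)\<rfloor>) \<in> Pi\<^sub>M {Steps v i} (\<lambda>_. borel :: real measure) \<rightarrow>\<^sub>M count_space UNIV"
    by simp
  have "distr M borel (W v i) \<Otimes>\<^sub>M distr M (count_space UNIV) (Z v i)
      = distr M (borel \<Otimes>\<^sub>M count_space UNIV) (\<lambda>\<omega>. (W v i \<omega>, Z v i \<omega>))"
    using indep_var_joint_image[OF ind mW mZ] by simp
  then show ?thesis
    by (simp add: event_law_def distr_unit_exp[OF W_exponential] Z_law run_def events_of_def vi)
qed

lemma events_distr: "distr M (Pi\<^sub>M UNIV (\<lambda>_. borel \<Otimes>\<^sub>M count_space UNIV)) run = events_law p"
proof -
  have "indep_vars (\<lambda>b. Pi\<^sub>M (event_sources b) (\<lambda>_. borel)) (\<lambda>b \<omega>. restrict (\<lambda>s. src s \<omega>) (event_sources b)) UNIV"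
    by (rule indep_vars_restrict[OF independent]) (use disjoint_event_sources in auto)
  from indep_vars_compose2[OF this measurable_read_event[OF order_refl]]
  have ind: "indep_vars (\<lambda>_. borel \<Otimes>\<^sub>M count_space UNIV) (\<lambda>b \<omega>. run \<omega> b) UNIV"
    by (simp add: read_event_src)
  then have rv: "(\<lambda>\<omega>. run \<omega> b) \<in> M \<rightarrow>\<^sub>M borel \<Otimes>\<^sub>M count_space UNIV" for b
    by (auto simp: indep_vars_def)
  show ?thesis
    using indep_vars_iff_distr_eq_PiM[where I=UNIV and M'="\<lambda>_. borel \<Otimes>\<^sub>M count_space UNIV" and X="\<lambda>b \<omega>. run \<omega> b"] ind rv
    by (simp add: events_component_law events_law_def restrict_def)
qed

text \<open>
  Each event reads its own two sources and none of them is the clock, so the events are independent of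
  each other and of \<open>\<tau>\<close>.
\<close>
lemma stopped_events_distr:
  shows stopped_events_measurable: "(\<lambda>\<omega>. (\<tau> \<omega>, run \<omega>)) \<in> M \<rightarrow>\<^sub>M timed_law p"
    and "distr M (timed_law p) (\<lambda>\<omega>. (\<tau> \<omega>, run \<omega>)) = unit_exp \<Otimes>\<^sub>M events_law p"
proof -
  have sub: "event_sources b \<subseteq> UNIV - {Stop}" for b
    by (auto simp: event_sources_def split: prod.splits)
  have ind: "indep_var (Pi\<^sub>M {Stop} (\<lambda>_. borel)) (\<lambda>\<omega>. restrict (\<lambda>s. src s \<omega>) {Stop})
       (Pi\<^sub>M (UNIV - {Stop}) (\<lambda>_. borel)) (\<lambda>\<omega>. restrict (\<lambda>s. src s \<omega>) (UNIV - {Stop}))"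
    by (rule indep_var_restrict[OF independent]) auto
  have m1: "(\<lambda>g. g Stop) \<in> Pi\<^sub>M {Stop} (\<lambda>_. borel) \<rightarrow>\<^sub>M (borel :: real measure)"
    by (rule measurable_component_singleton) simp
  have m2: "(\<lambda>g b. read_event b g) \<in> Pi\<^sub>M (UNIV - {Stop}) (\<lambda>_. borel) \<rightarrow>\<^sub>M Pi\<^sub>M UNIV (\<lambda>_. borel \<Otimes>\<^sub>M count_space UNIV)"
    by (rule measurable_PiM_single') (auto intro: measurable_read_event[OF sub] simp: space_pair_measure)
  have rd: "(\<lambda>\<omega> b. read_event b (restrict (\<lambda>s. src s \<omega>) (UNIV - {Stop}))) = run"
    by (simp add: fun_eq_iff read_event_src[OF sub])
  have "run \<in> M \<rightarrow>\<^sub>M Pi\<^sub>M UNIV (\<lambda>_. borel \<Otimes>\<^sub>M count_space UNIV)"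
    using measurable_compose[OF indep_var_rv2[OF ind] m2] unfolding rd .
  then have "run \<in> M \<rightarrow>\<^sub>M events_law p"
    using sets_events_law[of p] by (simp cong: measurable_cong_sets)
  then show "(\<lambda>\<omega>. (\<tau> \<omega>, run \<omega>)) \<in> M \<rightarrow>\<^sub>M timed_law p" by measurable
  have "distr M borel \<tau> \<Otimes>\<^sub>M distr M (Pi\<^sub>M UNIV (\<lambda>_. borel \<Otimes>\<^sub>M count_space UNIV)) run
      = distr M (borel \<Otimes>\<^sub>M Pi\<^sub>M UNIV (\<lambda>_. borel \<Otimes>\<^sub>M count_space UNIV)) (\<lambda>\<omega>. (\<tau> \<omega>, run \<omega>))"
    using indep_var_joint_image[OF ind m1 m2] read_event_src[OF sub] by simp
  also have "\<dots> = distr M (timed_law p) (\<lambda>\<omega>. (\<tau> \<omega>, run \<omega>))"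
    by (rule distr_cong) (auto intro: sets_pair_measure_cong simp: sets_events_law)
  finally show "distr M (timed_law p) (\<lambda>\<omega>. (\<tau> \<omega>, run \<omega>)) = unit_exp \<Otimes>\<^sub>M events_law p"
    by (simp add: distr_unit_exp[OF \<tau>_exponential] events_distr)
qed


lemma depth_from_measurable: "(\<lambda>\<omega>. depth_from d (\<lambda>v i. Z v i \<omega>) u) \<in> M \<rightarrow>\<^sub>M count_space UNIV"
proof (induction u)
  case (Cons i v)
  have "(\<lambda>\<omega>. (\<lambda>a \<omega>. case a of None \<Rightarrow> None | Some e \<Rightarrow> if Z v i \<omega> \<le> e then Some (Suc e - Z v i \<omega>) else None)
      (depth_from d (\<lambda>v i. Z v i \<omega>) v) \<omega>) \<in> M \<rightarrow>\<^sub>M count_space UNIV"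
  proof (rule measurable_compose_countable[OF _ Cons])
    fix a :: "nat option"
    show "(\<lambda>\<omega>. case a of None \<Rightarrow> None | Some e \<Rightarrow> if Z v i \<omega> \<le> e then Some (Suc e - Z v i \<omega>) else None)
       \<in> M \<rightarrow>\<^sub>M count_space UNIV"
      using measurable_compose[OF Z_measurable[of v i],
          of "\<lambda>z. case a of None \<Rightarrow> None | Some e \<Rightarrow> if z \<le> e then Some (Suc e - z) else None" "count_space UNIV"]
      by simp
  qed
  then show ?case by simp
qed simp

lemma birth_time_measurable [measurable]: "(\<lambda>\<omega>. birth_time (\<lambda>v i. W v i \<omega>) u) \<in> borel_measurable M"
  by (induction u) simp_all

lemma D_event_measurable: "{\<omega> \<in> space M. k \<le> D \<omega>} \<in> sets M"
  unfolding D_def root_children_eq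
proof (rule measurable_card_ge)
  fix u
  note [measurable] = depth_from_measurable[of 0 u]
  show "{\<omega> \<in> space M. u \<in> depth_one_vertices 0 (\<tau> \<omega>) (\<lambda>v i. W v i \<omega>) (\<lambda>v i. Z v i \<omega>)} \<in> sets M"
    unfolding depth_one_vertices_def mem_Collect_eq by measurable
qed

lemma AE_nonneg: "AE \<omega> in M. (\<forall>v i. 0 \<le> W v i \<omega>) \<and> 0 \<le> \<tau> \<omega>"
proof -
  have "AE \<omega> in M. 0 \<le> X \<omega>" if X: "distributed M lborel X (exponential_density 1)" for X
  proof -
    have [measurable]: "X \<in> borel_measurable M" using distributed_measurable[OF X] by simp
    have "AE x in distr M borel X. 0 \<le> x" unfolding distr_unit_exp[OF X] by (rule unit_exp_AE_nonneg)
    then show ?thesis by (subst (asm) AE_distr_iff) auto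
  qed
  then show ?thesis using W_exponential \<tau>_exponential by (simp add: AE_all_countable)
qed

abbreviation "found k \<equiv> {\<omega> \<in> space M. \<exists>n. k \<le> depth_one_count n 0 (\<tau> \<omega>) (run \<omega>)}"

lemma found_measurable: "found k \<in> sets M"
  and emeasure_found: "emeasure M (found k) = (\<integral>\<^sup>+t. tail_at p k t \<partial>unit_exp)"
proof -
  interpret Q: prob_space "events_law p" by (rule prob_space_events_law)
  interpret E: prob_space unit_exp by (rule prob_space_unit_exp)
  let ?S = "{y \<in> space (timed_law p). \<exists>n. k \<le> depth_one_count n 0 (fst y) (snd y)}"
  have S: "?S \<in> sets (timed_law p)"
  proof -
    note [measurable] = measurable_depth_one_count[where d=0 and p=p]
    show ?thesis by measurable
  qed
  then have S': "?S \<in> sets (unit_exp \<Otimes>\<^sub>M events_law p)"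
    by (simp cong: sets_pair_measure_cong)
  have pre: "(\<lambda>\<omega>. (\<tau> \<omega>, run \<omega>)) -` ?S \<inter> space M = found k"
    by (auto simp: space_pair_measure space_events_law)
  show "found k \<in> sets M" using measurable_sets[OF stopped_events_measurable S] unfolding pre .
  have "emeasure M (found k) = emeasure (unit_exp \<Otimes>\<^sub>M events_law p) ?S"
    unfolding stopped_events_distr(2)[symmetric] emeasure_distr[OF stopped_events_measurable S] pre ..
  also have "\<dots> = (\<integral>\<^sup>+t. tail_at p k t \<partial>unit_exp)"
    unfolding Q.emeasure_pair_measure_alt[OF S'] tail_at_def
    by (intro nn_integral_cong arg_cong2[where f=emeasure]) (auto simp: space_pair_measure space_events_law)
  finally show "emeasure M (found k) = (\<integral>\<^sup>+t. tail_at p k t \<partial>unit_exp)" .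
qed

text \<open>
  The upper bound with \<open>s = 1\<close>, where \<open>f(s) / s = 1\<close>, and any \<open>r < 1\<close> tends to zero as \<open>k\<close>
  grows.
\<close>
lemma AE_finite: "AE \<omega> in M. \<exists>m. \<forall>n. depth_one_count n 0 (\<tau> \<omega>) (run \<omega>) < m"
proof -
  obtain A where A: "0 \<le> A" "\<And>k. 2 \<le> k \<Longrightarrow> (\<integral>\<^sup>+t. tail_at p k t \<partial>unit_exp)
     \<le> ennreal (A * (ln (real k) / real k) powr (1 / 2) + exp 1 * real k powr (- (1 / 2)))"
    using exponential_time_tail_upper[of 1 p "1 / 2"] pgf_summable_1[of p] pgf_1[of p] by auto
  let ?N = "{\<omega> \<in> space M. \<forall>m. \<exists>n. m \<le> depth_one_count n 0 (\<tau> \<omega>) (run \<omega>)}"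
  have N: "?N = (\<Inter>k. found k)" by auto
  have N_meas: "?N \<in> sets M" unfolding N using found_measurable by (intro sets.countable_INT) auto
  have le: "emeasure M ?N \<le> ennreal (A * (ln (real k) / real k) powr (1 / 2) + exp 1 * real k powr (- (1 / 2)))"
    if "2 \<le> k" for k
  proof -
    have "emeasure M ?N \<le> emeasure M (found k)" unfolding N using found_measurable by (intro emeasure_mono) auto
    also have "\<dots> \<le> ennreal (A * (ln (real k) / real k) powr (1 / 2) + exp 1 * real k powr (- (1 / 2)))"
      unfolding emeasure_found using A(2)[OF that] .
    finally show ?thesis .
  qed
  have "(\<lambda>k. A * (ln (real k) / real k) powr (1 / 2) + exp 1 * real k powr (- (1 / 2))) \<longlonglongrightarrow> 0"
  proof -
    have "(\<lambda>k. (ln (real k) / real k) powr (1 / 2)) \<longlonglongrightarrow> 0" by real_asymp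
    moreover have "(\<lambda>k. real k powr (- (1 / 2))) \<longlonglongrightarrow> 0" by real_asymp
    ultimately have "(\<lambda>k. A * (ln (real k) / real k) powr (1 / 2) + exp 1 * real k powr (- (1 / 2))) \<longlonglongrightarrow> A * 0 + exp 1 * 0"
      by (intro tendsto_intros)
    then show ?thesis by simp
  qed
  from LIMSEQ_le_const[OF tendsto_ennrealI[OF this], of "emeasure M ?N"]
  have "emeasure M ?N \<le> 0" using le by (metis (no_types, lifting) ennreal_0)
  then have "?N \<in> null_sets M" using N_meas by auto
  from AE_not_in[OF this] AE_space show ?thesis by eventually_elim (auto simp: not_le)
qed

lemma emeasure_D_ge: "emeasure M {\<omega> \<in> space M. k \<le> D \<omega>} = (\<integral>\<^sup>+t. tail_at p k t \<partial>unit_exp)"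
proof -
  have "AE \<omega> in M. \<omega> \<in> {\<omega> \<in> space M. k \<le> D \<omega>} \<longleftrightarrow> \<omega> \<in> found k"
    using AE_nonneg AE_finite AE_space
  proof eventually_elim
    case (elim \<omega>)
    have "k \<le> D \<omega> \<longleftrightarrow> (\<exists>n. k \<le> depth_one_count n 0 (\<tau> \<omega>) (run \<omega>))"
      unfolding D_def run_def
      using le_root_children_imp[of "\<lambda>v i. W v i \<omega>" "\<tau> \<omega>" k "\<lambda>v i. Z v i \<omega>"]
        imp_le_root_children[of "\<lambda>v i. W v i \<omega>" "\<tau> \<omega>" k _ "\<lambda>v i. Z v i \<omega>"] elim
      unfolding run_def by blast
    then show ?case using elim by simp
  qed
  from emeasure_eq_AE[OF this D_event_measurable found_measurable] show ?thesis
    unfolding emeasure_found .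
qed

end

section \<open>The polynomial lower bound and the exponents\<close>
context step_law begin

text \<open>
  With \<open>\<lambda>\<close> of order \<open>1/k\<close>, the logistic equation reaches a constant by time
  \<open>log k / \<theta>\<^sub>0 + O(1)\<close>, and the clock survives this long with probability of order
  \<open>k\<^bsup>-1/\<theta>\<^sub>0\<^esup>\<close>.
\<close>
lemma exponential_time_tail_lower:
  assumes th0: "0 < th0" "th0 < 1 / R_const p"
  shows "\<exists>C>0. \<exists>k0. \<forall>k\<ge>k0. ennreal (C * real k powr (- (1 / th0))) \<le> (\<integral>\<^sup>+t. tail_at p k t \<partial>unit_exp)"
proof -
  obtain th where th: "th0 < th" "th < 1 / R_const p" using th0 dense by blast
  have "1 / R_const p \<le> 1" using one_le_R by simp
  then have th': "0 < th" "th < 1" using th th0 by auto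
  obtain N where N: "1 \<le> N" "th ^ N \<le> walks p N 1" using walks_growth[of th] th th' by auto
  \<comment> \<open>The growth rate per unit of time tends to \<open>th\<close> as the step \<open>h\<close> and the threshold \<open>h\<close> tend to 0.\<close>
  have "((\<lambda>h. ln (1 + (1 - exp (- h)) * (1 - h) * th) / h) \<longlongrightarrow> th) (at_right 0)"
    using th' by real_asymp
  then have "eventually (\<lambda>h. th0 < ln (1 + (1 - exp (- h)) * (1 - h) * th) / h) (at_right 0)"
    using th(1) by (rule order_tendstoD)
  moreover have "eventually (\<lambda>h. h \<in> {0<..<1}) (at_right (0::real))"
    by (rule eventually_at_right_real) simp
  ultimately have "eventually (\<lambda>h. th0 < ln (1 + (1 - exp (- h)) * (1 - h) * th) / h \<and> h \<in> {0<..<1}) (at_right 0)"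
    by eventually_elim auto
  then obtain h where h: "th0 < ln (1 + (1 - exp (- h)) * (1 - h) * th) / h" "0 < h" "h < 1"
    using eventually_happens[of _ "at_right (0::real)"] by auto
  define kap where "kap = 1 - exp (- h)"
  have kap: "0 < kap" "kap \<le> 1" using h by (auto simp: kap_def)
  define bet where "bet = kap * (1 - h)"
  define g where "g = 1 + bet * th"
  define M where "M = (\<Sum>i<N. (1 / th) ^ i)"
  define c where "c = (bet * th) ^ N"
  have bet: "0 < bet" using kap h by (simp add: bet_def)
  have g: "1 < g" using bet th' by (simp add: g_def)
  have c: "0 < c" using bet th' by (simp add: c_def)
  have M: "0 < M" unfolding M_def using th' N(1) by (intro sum_pos) (auto simp: lessThan_empty_iff)
  have hg: "th0 * h \<le> ln g"
    using h by (simp add: g_def bet_def kap_def field_simps)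
  define c0 where "c0 = kap * pmf p 0 * (h / (g * M))"
  have c0: "0 < c0" using kap p0 h g M by (simp add: c0_def)
  define B where "B = 4 * h / (c0 * c * M)"
  have B: "0 < B" using h c0 c M by (simp add: B_def)
  define C where "C = c0 / 2 * exp (- (real N + 1) * h) * B powr (- (1 / th0))"
  have C: "0 < C" using c0 B by (simp add: C_def)
  define k0 where "k0 = nat \<lceil>max 1 (max c0 (c0 * (real N + 1) / h))\<rceil>"
  have main: "ennreal (C * real k powr (- (1 / th0))) \<le> (\<integral>\<^sup>+t. tail_at p k t \<partial>unit_exp)" if "k0 \<le> k" for k
  proof -
    have k: "1 \<le> real k" "c0 \<le> real k" "c0 * (real N + 1) / h \<le> real k"
      using that unfolding k0_def by linarith+
    define lam where "lam = c0 / (2 * real k)"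
    have lam: "0 < lam" "lam \<le> 1" "lam * (real N + 1) \<le> h"
    proof -
      show "0 < lam" "lam \<le> 1" using c0 k by (auto simp: lam_def)
      have "c0 * (real N + 1) \<le> h * real k" using k(3) h by (simp add: field_simps)
      moreover have "0 \<le> h * real k" using h by simp
      ultimately have "c0 * (real N + 1) \<le> 2 * (h * real k)" by linarith
      then show "lam * (real N + 1) \<le> h" using k by (simp add: lam_def field_simps)
    qed
    define eps where "eps = 1 - exp (- lam)"
    have eps: "lam / 2 \<le> eps" "eps \<le> lam"
    proof -
      have "1 + lam \<le> exp lam" by (rule exp_ge_add_one_self)
      then have "exp (- lam) \<le> 1 / (1 + lam)" using lam by (simp add: exp_minus field_simps)
      moreover have "1 / (1 + lam) \<le> 1 - lam / 2" using lam by (simp add: field_simps)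
      ultimately show "lam / 2 \<le> eps" by (simp add: eps_def)
      show "eps \<le> lam" using exp_ge_add_one_self[of "- lam"] by (simp add: eps_def)
    qed
    have eps0: "0 < eps" using eps lam by linarith
    have lam0: "0 \<le> lam" using lam by simp
    define v where "v = (\<lambda>m d. deficit p lam d (real m * h))"
    have "\<exists>m. eps * (kap * (1 - h) * th) ^ N * (1 + kap * (1 - h) * th) ^ m * (\<Sum>i<N. (1 / th) ^ i) \<le> h
        \<and> h / ((1 + kap * (1 - h) * th) * (\<Sum>i<N. (1 / th) ^ i)) \<le> v (N + m) 1"
    proof (rule logistic_iteration_lower_bound[OF th' N kap h(2,3), where v=v and eps=eps])
      show "0 \<le> v m d" "v m d \<le> 1" for m d unfolding v_def using damped_integral(2,3)[OF lam0] by auto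
      show "v m d + kap * (1 - v m d) * offspring_sum p (v m) d \<le> v (Suc m) d" for m d
        using deficit_step[OF lam0, of "real m * h" h p d] h
        by (simp add: v_def kap_def algebra_simps)
      show "eps \<le> v 0 1" unfolding v_def eps_def using deficit_initial[OF lam0] by simp
      have "eps * (real N + 1) \<le> lam * (real N + 1)" using eps by (intro mult_right_mono) auto
      then show "eps * (real N + 1) \<le> h" using lam by linarith
    qed (use eps0 in auto)
    then obtain m where m: "eps * c * g ^ m * M \<le> h" "h / (g * M) \<le> v (N + m) 1"
      unfolding c_def g_def M_def bet_def by auto
    define T where "T = real (N + m) * h + h"
    have T0: "0 \<le> T" using h by (simp add: T_def)
    have reach: "c0 \<le> deficit p lam 0 T"
    proof -
      let ?v0 = "deficit p lam 0 (real (N + m) * h)"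
      let ?o = "pmf p 0 * v (N + m) 1"
      have o: "offspring_sum p (\<lambda>e. deficit p lam e (real (N + m) * h)) 0 = ?o"
        by (simp add: offspring_sum_def v_def)
      have v0: "0 \<le> ?v0" "0 \<le> v (N + m) 1" "v (N + m) 1 \<le> 1"
        using damped_integral(2,3)[OF lam0] by (auto simp: v_def)
      have "kap * ?o \<le> 1" using kap v0 by (intro mult_le_one mult_nonneg_nonneg) (auto simp: pmf_le_1)
      then have "0 \<le> ?v0 * (1 - kap * ?o)" using v0 by (intro mult_nonneg_nonneg) auto
      then have "kap * ?o \<le> ?v0 + kap * (1 - ?v0) * ?o" by (simp add: algebra_simps)
      also have "\<dots> \<le> deficit p lam 0 T"
        using deficit_step[OF lam0, of "real (N + m) * h" h p 0] h unfolding o by (simp add: T_def kap_def)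
      finally have "kap * ?o \<le> deficit p lam 0 T" .
      moreover have "c0 \<le> kap * ?o"
        unfolding c0_def mult.assoc using m(2) kap by (intro mult_left_mono) auto
      ultimately show ?thesis by linarith
    qed
    have tail: "ennreal (c0 / 2) \<le> tail_at p k t" if "T \<le> t" for t
    proof -
      have "c0 / 2 = c0 - lam * real k" using k by (simp add: lam_def)
      also have "\<dots> \<le> deficit p lam 0 t - lam * real k"
        using reach deficit_mono[OF lam0 that, of p 0] by simp
      finally have "ennreal (c0 / 2) \<le> ennreal (deficit p lam 0 t - lam * real k)" by (rule ennreal_leI)
      also have "\<dots> \<le> tail_at p k t" using T0 that by (intro deficit_le_tail lam0) auto
      finally show ?thesis .
    qed
    have "g ^ m \<le> B * real k"
    proof -
      have "lam / 2 * (c * g ^ m * M) \<le> eps * (c * g ^ m * M)" using eps c g M by (intro mult_right_mono) auto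
      then have "lam / 2 * (c * g ^ m * M) \<le> h" using m(1) by (simp add: mult_ac)
      then show ?thesis using c0 c M k by (simp add: lam_def B_def field_simps)
    qed
    then have "ln (g ^ m) \<le> ln (B * real k)" using g k B by (subst ln_le_cancel_iff) auto
    then have "real m * ln g \<le> ln (B * real k)" using g by (simp add: ln_realpow)
    moreover have "real m * (th0 * h) \<le> real m * ln g" using hg by (intro mult_left_mono) auto
    ultimately have "real m * h \<le> ln (B * real k) / th0" using th0 by (simp add: field_simps)
    then have "T \<le> (real N + 1) * h + ln (B * real k) / th0" by (simp add: T_def algebra_simps)
    then have "exp (- ((real N + 1) * h + ln (B * real k) / th0)) \<le> exp (- T)" by simp
    moreover have "exp (- ((real N + 1) * h + ln (B * real k) / th0))
        = exp (- (real N + 1) * h) * (B powr (- (1 / th0)) * real k powr (- (1 / th0)))"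
    proof -
      have "exp (- ((real N + 1) * h + ln (B * real k) / th0))
          = exp (- (real N + 1) * h) * exp (- (1 / th0) * ln (B * real k))"
        by (subst exp_add[symmetric]) (simp add: algebra_simps)
      also have "exp (- (1 / th0) * ln (B * real k)) = (B * real k) powr (- (1 / th0))"
        using B k by (simp add: powr_def)
      finally show ?thesis using B k by (simp add: powr_mult)
    qed
    ultimately have "exp (- (real N + 1) * h) * (B powr (- (1 / th0)) * real k powr (- (1 / th0))) \<le> exp (- T)"
      by (simp only:)
    from mult_left_mono[OF this, of "c0 / 2"] have "C * real k powr (- (1 / th0)) \<le> c0 / 2 * exp (- T)"
      unfolding C_def mult.assoc using c0 by linarith
    then have "ennreal (C * real k powr (- (1 / th0))) \<le> ennreal (c0 / 2 * exp (- T))" by (rule ennreal_leI)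
    also have "\<dots> = ennreal (c0 / 2) * emeasure unit_exp {T..}"
      unfolding unit_exp_tail[OF T0] using c0 by (subst ennreal_mult[symmetric]) auto
    also have "\<dots> = (\<integral>\<^sup>+t. ennreal (c0 / 2) * indicator {T..} t \<partial>unit_exp)"
      by (subst nn_integral_cmult_indicator) auto
    also have "\<dots> \<le> (\<integral>\<^sup>+t. tail_at p k t \<partial>unit_exp)"
      using tail by (intro nn_integral_mono) (auto split: split_indicator)
    finally show ?thesis .
  qed
  show ?thesis using C main by blast
qed

end

lemma log_ratio_upper:
  assumes P: "\<And>k. 2 \<le> k \<Longrightarrow> P k \<le> A * (ln (real k) / real k) powr r + exp 1 * real k powr (- r)"
    and pos: "eventually (\<lambda>k. 0 < P k) sequentially" and A: "0 \<le> A" and r: "0 < r" and y: "- r < y"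
  shows "eventually (\<lambda>k. ln (P k) / ln (real k) < y) sequentially"
proof -
  let ?u = "\<lambda>k. (ln (A + exp 1) + r * ln (ln (real k)) - r * ln (real k)) / ln (real k)"
  have "?u \<longlonglongrightarrow> - r" by real_asymp
  then have "eventually (\<lambda>k. ?u k < y) sequentially" using y by (rule order_tendstoD)
  moreover have "eventually (\<lambda>k. 3 \<le> k) sequentially" by (rule eventually_ge_at_top)
  ultimately show ?thesis using pos
  proof eventually_elim
    case (elim k)
    have lnk: "1 \<le> ln (real k)"
    proof -
      have "exp 1 \<le> real k" using elim by (intro order_trans[OF exp_le]) simp
      then show ?thesis by (metis exp_gt_zero ln_exp ln_mono)
    qed
    have "P k \<le> A * (ln (real k) / real k) powr r + exp 1 * real k powr (- r)" using P elim by auto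
    also have "\<dots> = (A * ln (real k) powr r + exp 1) * real k powr (- r)"
      using elim lnk by (simp add: powr_divide powr_minus field_simps)
    also have "\<dots> \<le> ((A + exp 1) * ln (real k) powr r) * real k powr (- r)"
      using lnk r ge_one_powr_ge_zero[of "ln (real k)" r] by (intro mult_right_mono) (auto simp: distrib_right)
    finally have "ln (P k) \<le> ln (((A + exp 1) * ln (real k) powr r) * real k powr (- r))"
      using elim lnk A by (subst ln_le_cancel_iff) (auto intro!: mult_pos_pos add_nonneg_pos)
    also have "\<dots> = ln (A + exp 1) + r * ln (ln (real k)) - r * ln (real k)"
    proof -
      have "0 < A + exp 1" using A by (intro add_nonneg_pos) auto
      then show ?thesis using elim lnk by (simp add: ln_mult ln_powr)
    qed
    finally have "ln (P k) / ln (real k) \<le> ?u k" using lnk by (intro divide_right_mono) auto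
    then show ?case using elim by simp
  qed
qed

lemma log_ratio_lower:
  assumes P: "\<And>k. k0 \<le> k \<Longrightarrow> C * real k powr (- b) \<le> P k" and C: "0 < C" and y: "y < - b"
  shows "eventually (\<lambda>k. y < ln (P k) / ln (real k)) sequentially"
    and "eventually (\<lambda>k. 0 < P k) sequentially"
proof -
  let ?u = "\<lambda>k. (ln C - b * ln (real k)) / ln (real k)"
  have ev: "eventually (\<lambda>k. k0 \<le> k) sequentially" "eventually (\<lambda>k. 2 \<le> k) sequentially" by (rule eventually_ge_at_top)+
  have pos: "0 < C * real k powr (- b)" if "2 \<le> k" for k :: nat using C that by simp
  show "eventually (\<lambda>k. 0 < P k) sequentially"
    using ev by eventually_elim (use P pos in \<open>meson order_less_le_trans\<close>)
  have "?u \<longlonglongrightarrow> - b" by real_asymp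
  then have "eventually (\<lambda>k. y < ?u k) sequentially" using y by (rule order_tendstoD)
  then show "eventually (\<lambda>k. y < ln (P k) / ln (real k)) sequentially"
    using ev
  proof eventually_elim
    case (elim k)
    have "ln (C * real k powr (- b)) \<le> ln (P k)"
      using P[of k] pos[of k] elim by (subst ln_le_cancel_iff) auto
    then have "ln C - b * ln (real k) \<le> ln (P k)" using C elim by (simp add: ln_mult ln_powr)
    then have "?u k \<le> ln (P k) / ln (real k)" using elim by (intro divide_right_mono) auto
    then show ?case using elim by simp
  qed
qed

theorem theorem3p8:
  fixes p :: "nat pmf"
    and M :: "'w measure"
    and W :: "vertex \<Rightarrow> nat \<Rightarrow> 'w \<Rightarrow> real"
    and Z :: "vertex \<Rightarrow> nat \<Rightarrow> 'w \<Rightarrow> nat"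
    and \<tau> :: "'w \<Rightarrow> real"
    and D :: "'w \<Rightarrow> nat"
    and L :: "nat \<Rightarrow> real"
  assumes finite_mean: "integrable (measure_pmf p) real"
    and p0: "0 < pmf p 0" "pmf p 0 < 1"
    and p01: "pmf p 0 + pmf p 1 < 1"
    and aperiodic: "Gcd {j. pmf p j > 0} = 1"
    and process: "tree_process M p W Z \<tau>"
  defines "D \<equiv> tree_process.D W Z \<tau>"
    and "L \<equiv> (\<lambda>k. ln (measure M {\<omega> \<in> space M. k \<le> D \<omega>}) / ln (real k))"
  shows "(mean p \<le> 1 \<longrightarrow> L \<longlonglongrightarrow> - R_const p) \<and>
         (mean p > 1 \<longrightarrow>
            ereal (- R_const p) \<le> liminf (\<lambda>k. ereal (L k)) \<and>
            liminf (\<lambda>k. ereal (L k)) \<le> limsup (\<lambda>k. ereal (L k)) \<and>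
            limsup (\<lambda>k. ereal (L k)) \<le>
              ereal (- min (R_const p) (ln (q_star p) / ln (s0 p))))"
proof -
  interpret tree: tree_process M p W Z \<tau> by (rule process)
  interpret step_law p using p0 p01 by unfold_locales auto
  define P where "P = (\<lambda>k. measure M {\<omega> \<in> space M. k \<le> D \<omega>})"
  have P: "ennreal (P k) = (\<integral>\<^sup>+t. tail_at p k t \<partial>unit_exp)" for k
    unfolding P_def D_def using tree.emeasure_D_ge[of k] by (simp add: tree.emeasure_eq_measure)
  have L: "L k = ln (P k) / ln (real k)" for k by (simp add: L_def P_def)
  have P_nonneg: "0 \<le> P k" for k by (simp add: P_def)
  have R1: "1 \<le> R_const p" by (rule one_le_R)
  have lower: "\<exists>C>0. \<exists>k0. \<forall>k\<ge>k0. C * real k powr (- b) \<le> P k" if "R_const p < b" for b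
  proof -
    have "0 < 1 / b" "1 / b < 1 / R_const p" using that R1 by (auto intro!: divide_strict_left_mono mult_pos_pos)
    from exponential_time_tail_lower[OF this] obtain C k0 where
      "0 < C" "\<And>k. k0 \<le> k \<Longrightarrow> ennreal (C * real k powr (- b)) \<le> ennreal (P k)"
      unfolding P by auto
    then show ?thesis using P_nonneg by (auto simp: ennreal_le_iff)
  qed
  have LB: "eventually (\<lambda>k. y < L k) sequentially" if "y < - R_const p" for y
  proof -
    have "R_const p < - y" using that by simp
    then obtain b where b: "R_const p < b" "b < - y" using dense by blast
    then obtain C k0 where "0 < C" "\<And>k. k0 \<le> k \<Longrightarrow> C * real k powr (- b) \<le> P k" using lower by blast
    then show ?thesis unfolding L using b by (intro log_ratio_lower(1)[of k0 C b P]) auto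
  qed
  have pos: "eventually (\<lambda>k. 0 < P k) sequentially"
  proof -
    obtain C k0 where "0 < C" "\<And>k. k0 \<le> k \<Longrightarrow> C * real k powr (- (R_const p + 1)) \<le> P k"
      using lower[of "R_const p + 1"] by auto
    then show ?thesis by (intro log_ratio_lower(2)[of k0 C "R_const p + 1" P "- (R_const p + 2)"]) auto
  qed
  have UB: "eventually (\<lambda>k. L k < y) sequentially"
    if s: "0 < s" "pgf_summable p s" and r: "0 < r" "r < s / pgf p s" and y: "- r < y"
      and cases: "1 \<le> s \<or> pgf_summable p (s powr r) \<and> pgf p (s powr r) < s powr r" for s r y
  proof -
    have "0 < pgf p s" using s by (intro pgf_pos) auto
    then have "r * (pgf p s / s) < 1" using r s by (simp add: field_simps)
    from exponential_time_tail_upper[OF s r(1) this cases] obtain A where A: "0 \<le> A"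
      "\<And>k. 2 \<le> k \<Longrightarrow> ennreal (P k) \<le> ennreal (A * (ln (real k) / real k) powr r + exp 1 * real k powr (- r))"
      unfolding P by auto
    have "P k \<le> A * (ln (real k) / real k) powr r + exp 1 * real k powr (- r)" if "2 \<le> k" for k
      using A(2)[OF that] A(1) by (subst (asm) ennreal_le_iff) auto
    then show ?thesis unfolding L using pos A r y by (intro log_ratio_upper[of P A r]) auto
  qed
  have sub: "L \<longlonglongrightarrow> - R_const p" if m: "mean p \<le> 1"
  proof (rule order_tendstoI)
    fix y assume "- R_const p < y"
    then obtain r where r: "max 0 (- y) < r" "r < R_const p"
      using R1 dense[of "max 0 (- y)" "R_const p"] by auto
    obtain s where "1 \<le> s" "pgf_summable p s" "r < s / pgf p s"
      using approximate_R_subcritical[OF finite_mean m r(2)] by auto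
    then show "eventually (\<lambda>k. L k < y) sequentially" using r by (intro UB[of s r]) auto
  qed (rule LB)
  have super_lower: "ereal (- R_const p) \<le> liminf (\<lambda>k. ereal (L k))"
  proof (rule ccontr)
    assume "\<not> ?thesis"
    then obtain y where y: "liminf (\<lambda>k. ereal (L k)) < ereal y" "ereal y < ereal (- R_const p)"
      using ereal_dense2 by (metis not_le)
    then have "eventually (\<lambda>k. y < L k) sequentially" by (intro LB) auto
    then have "eventually (\<lambda>k. ereal y \<le> ereal (L k)) sequentially" by eventually_elim auto
    then have "ereal y \<le> liminf (\<lambda>k. ereal (L k))" by (rule Liminf_bounded)
    then show False using y by simp
  qed
  have super_upper: "limsup (\<lambda>k. ereal (L k)) \<le> ereal (- min (R_const p) (ln (q_star p) / ln (s0 p)))"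
    if m: "1 < mean p"
  proof (rule ccontr)
    let ?x = "min (R_const p) (ln (q_star p) / ln (s0 p))"
    note con = supercritical_constants[OF finite_mean m]
    assume "\<not> ?thesis"
    then obtain y where y: "ereal (- ?x) < ereal y" "ereal y < limsup (\<lambda>k. ereal (L k))"
      using ereal_dense2 by (metis not_le)
    have ln_s0: "ln (s0 p) < 0" using con by simp
    have sum: "pgf_summable p x" if "0 \<le> x" "x \<le> 1" for x
      using pgf_summable_mono[OF that pgf_summable_1] .
    have "0 < ln (q_star p) / ln (s0 p)" using ln_s0 con by (intro divide_neg_neg) auto
    then have "max 0 (- y) < ?x" using y R1 by auto
    then obtain r where r: "max 0 (- y) < r" "r < ?x" using dense by blast
    \<comment> \<open>The second bound on \<open>r\<close> says that \<open>q_star p < s0 p powr r\<close>, because \<open>ln (s0 p) < 0\<close>.\<close>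
    have "ln (q_star p) < r * ln (s0 p)" using r(2) ln_s0 by (simp add: field_simps)
    then have "q_star p < s0 p powr r"
      using con by (metis exp_less_cancel_iff exp_ln powr_def less_irrefl)
    moreover have "s0 p powr r < 1"
      using mult_pos_neg[of r "ln (s0 p)"] r con ln_s0 by (simp add: powr_def)
    ultimately have "eventually (\<lambda>k. L k < y) sequentially"
      using r con sum[of "s0 p"] sum[of "s0 p powr r"] by (intro UB[of "s0 p" r]) auto
    then have "eventually (\<lambda>k. ereal (L k) \<le> ereal y) sequentially" by eventually_elim auto
    then have "limsup (\<lambda>k. ereal (L k)) \<le> ereal y" by (rule Limsup_bounded)
    then show False using y by simp
  qed
  show ?thesis using sub super_lower super_upper by (auto intro: Liminf_le_Limsup)
qed

end
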